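(* Assume that $\varepsilon_1>|\varepsilon_2|R$ and $\Delta t<\min\Big\{\frac{L}{2d|\varepsilon_3|},\frac{\varepsilon_1-|\varepsilon_2|R}{3(\varepsilon_1+|\varepsilon_2|R^2)}\Big\}$ (the first entry being $+\infty$ if $\varepsilon_3=0$). Then there is a constant $C>0$, not depending on $\Delta t$ or $h$, such that the approximations $(Q_h^n,u_h^n)$ defined by the fully discrete scheme in the context satisfy, for all $N\in\mathbb{N}$ (with $t^N=N\Delta t$), $$\begin{aligned}&\int_\Omega\mathcal{F}_B(Q_h^N)\,dx+\frac14(L-2d\Delta t|\varepsilon_3|)\|\nabla Q_h^N\|_{L^2}^2+\frac16(\varepsilon_1-|\varepsilon_2|R)\|\nabla u_h^N\|_{L^2}^2\\&\le C\big(1+t^N\exp(Ct^N)\big)\Big(\|\nabla Q_h^0\|_{L^2}^2+\int_\Omega\mathcal{F}_B(Q_h^0)\,dx+(1+R)\|\nabla u_h^0\|_{L^2}^2+\|\nabla\tilde g_h^0\|_{L^2}^2\Big)\\&\quad+C\big(1+t^N\exp(Ct^N)\big)\Delta t\sum_{n=0}^{N-1}\|D_t^+\nabla\tilde g_h^n\|_{L^2}^2+C\|\nabla\tilde g_h^N\|_{L^2}^2+C\exp(Ct^N)\Delta t\sum_{n=0}^{N-1}\|\nabla\tilde g_h^n\|_{L^2}^2 .\end{aligned}$$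
   Context: Setting. $d\in\{2,3\}$; $\Omega\subset\mathbb{R}^d$ is a bounded, simply connected, convex polygon/polyhedron; $T>0$. Constants: $L>0$, $\varepsilon_1>0$, $\varepsilon_2,\varepsilon_3\in\mathbb{R}$, $a,b,A_0\in\mathbb{R}$, $c>0$, $R>0$, and $\beta_1\ge\max\{|b|,a\}$, $\beta_2\ge\max\{|b|,c\}$. Notation: $|\cdot|$ is the Euclidean/Frobenius norm, $A:B=\operatorname{tr}(A^\top B)$ (and the analogous full contraction for $\nabla A:\nabla B$), $(A\odot B)_{ij}=A_{ij}B_{ij}$, $(A)_S=\frac12(A+A^\top)$, $(\operatorname{div}Q)_i=\sum_j\partial_jQ_{ij}$. $L^2$ norms are over $\Omega$. Truncation. $\mathcal{T}_R:\mathbb{R}^{d\times d}\to\mathbb{R}^{d\times d}$ is twice continuously differentiable, acts entrywise ($\mathcal{T}_R(Q)_{ij}$ depends only on $Q_{ij}$), maps symmetric matrices to symmetric matrices, and satisfies $\mathcal{T}_R(Q)_{ij}\in[-R/d,R/d]$ with first and second derivatives of each $\mathcal{T}_R(Q)_{ij}$ bounded by a finite constant $C_{\mathcal{T}_R}>0$. For $A,B\in\mathbb{R}^{d\times d}$, $\tilde{\mathcal{P}}(A,B)_{ij}=\frac{\mathcal{T}_R(A)_{ij}-\mathcal{T}_R(B)_{ij}}{A_{ij}-B_{ij}}$ if $A_{ij}\ne B_{ij}$, and $\tilde{\mathcal{P}}(A,B)_{ij}=\frac{\partial\mathcal{T}_R(B)_{ij}}{\partial Q_{ij}}$ otherwise.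 Bulk terms. $\mathcal{F}_B(Q)=\frac a2\operatorname{tr}(Q^2)-\frac b3\operatorname{tr}(Q^3)+\frac c4(\operatorname{tr}(Q^2))^2+A_0$ for symmetric $Q$, with $A_0$ such that $\mathcal{F}_B\ge0$. $\frac{\partial\mathcal{F}_1(Q)}{\partial Q}=\beta_1Q-\frac b3\big(M(Q)-\frac1d\operatorname{tr}(M(Q))I\big)+\beta_2|Q|^2Q$ with $M(Q)=QQ^\top+Q^\top Q+Q^2$ (for symmetric $Q$ this is $\beta_1Q-b(Q^2-\frac1d\operatorname{tr}(Q^2)I)+\beta_2\operatorname{tr}(Q^2)Q$), and $\frac{\partial\mathcal{F}_2(Q)}{\partial Q}=(\beta_1-a)Q+(\beta_2-c)|Q|^2Q$. Discretization. $\Delta t>0$, $t^n=n\Delta t$, $T=t^N=N\Delta t$. $\mathfrak{T}_h$ is a quasi-uniform triangulation of $\Omega$ (triangles/tetrahedra) of mesh size $h$. $\mathbb{X}_h$ (resp. $\mathbb{Y}_h$) is the space of functions in $H_0^1(\Omega;\mathbb{R}^{d\times d})$ (resp. $H_0^1(\Omega)$) that are (componentwise) affine on each element. The boundary data have extensions $\tilde g\in L^\infty(0,T;H^1(\Omega))\cap W^{1,2}(0,T;H^1(\Omega))$ and $\tilde q\in H^1(\Omega;\mathbb{R}^{d\times d})$, $\tilde q$ symmetric and trace-free; $\tilde g_h^n$ and $\tilde q_h$ are the $L^2(\Omega)$-orthogonal projections of $\tilde g(t^n)$ and $\tilde q$ onto continuous piecewise linear functions on $\mathfrak{T}_h$.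 $D_t^+f^n=(f^{n+1}-f^n)/\Delta t$, $f^{n+1/2}=(f^n+f^{n+1})/2$. The scheme. $Q_h^n\in\tilde q_h+\mathbb{X}_h$ and $u_h^n\in\tilde g_h^n+\mathbb{Y}_h$, $n=0,\dots,N$, where $Q_h^0$ is a given symmetric, trace-free initial datum, satisfy for all $\Phi_h\in\mathbb{X}_h$, $\psi_h\in\mathbb{Y}_h$, with $\tilde{\mathcal{P}}_h^n=\tilde{\mathcal{P}}(Q_h^{n+1},Q_h^n)$: for $n=0,\dots,N-1$, $$\begin{aligned}-\int_\Omega D_t^+Q_h^n:\Phi_h\,dx={}&L\int_\Omega\nabla Q_h^{n+1/2}:\nabla\Phi_h\,dx+\int_\Omega\Big(\frac{\partial\mathcal{F}_1(Q_h^{n+1})}{\partial Q}-\frac{\partial\mathcal{F}_2(Q_h^n)}{\partial Q}\Big):\Phi_h\,dx\\&-\frac{\varepsilon_2}{2}\int_\Omega\Big((\tilde{\mathcal{P}}_h^n\odot\nabla u_h^n(\nabla u_h^{n+1})^\top)_S-\frac1d\operatorname{tr}(\tilde{\mathcal{P}}_h^n\odot\nabla u_h^n(\nabla u_h^{n+1})^\top)I\Big):\Phi_h\,dx\\&-\varepsilon_3\int_\Omega\Big(\nabla u_h^{n+1/2}\cdot\operatorname{div}((\Phi_h)_S)-\frac1d\nabla u_h^{n+1/2}\cdot\nabla\operatorname{tr}\Phi_h\Big)dx,\end{aligned}$$ and for $n=0,\dots,N$, $\int_\Omega(\varepsilon_1\nabla u_h^n+\varepsilon_2\mathcal{T}_R(Q_h^n)\nabla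 u_h^n+\varepsilon_3\operatorname{div}(Q_h^n))\cdot\nabla\psi_h\,dx=0$. *)

theory Defs
  imports "HOL-Analysis.Analysis"
begin

section \<open>Domain and triangulation\<close>

definition polyhedral_domain :: "'a::euclidean_space set \<Rightarrow> bool" where
  "polyhedral_domain \<Omega> \<longleftrightarrow>
     open \<Omega> \<and> \<Omega> \<noteq> {} \<and> bounded \<Omega> \<and> simply_connected \<Omega> \<and> convex \<Omega> \<and> polytope (closure \<Omega>)"

text \<open>The elements of a mesh are closed simplices of full dimension.\<close>

definition mesh_of :: "'a::euclidean_space set \<Rightarrow> 'a set set \<Rightarrow> bool" where
  "mesh_of \<Omega> Th \<longleftrightarrow>
     triangulation Th \<and> (\<forall>K\<in>Th. int DIM('a) simplex K) \<and> \<Union>Th = closure \<Omega>"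

definition mesh_size :: "'a::euclidean_space set set \<Rightarrow> real" where
  "mesh_size Th = Max (diameter ` Th)"

text \<open>Quasi-uniformity is a property of a family of meshes; \<open>\<gamma>\<close> is the constant common to the
  family, which bounds the inradius of every element from below by \<open>\<gamma>\<close> times the mesh size.\<close>

definition quasi_uniform :: "real \<Rightarrow> 'a::euclidean_space set set \<Rightarrow> bool" where
  "quasi_uniform \<gamma> Th \<longleftrightarrow> (\<forall>K\<in>Th. \<exists>x. ball x (\<gamma> * mesh_size Th) \<subseteq> K)"


section \<open>Derivatives and Sobolev spaces\<close>

text \<open>The classical gradient. A continuous piecewise affine function is differentiable off the
  null set of element boundaries, and there this is also its weak gradient, so that \<open>grad\<close> is the
  gradient of finite element functions under integrals.\<close>

definition grad :: "(real^'n \<Rightarrow> real) \<Rightarrow> real^'n \<Rightarrow> real^'n" where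
  "grad f x = (\<chi> k. frechet_derivative f (at x) (axis k 1))"

definition mat_grad :: "(real^'n \<Rightarrow> real^'n^'n) \<Rightarrow> real^'n \<Rightarrow> real^'n^'n^'n" where
  "mat_grad F x = (\<chi> i j. grad (\<lambda>y. F y $ i $ j) x)"

definition mat_div :: "(real^'n \<Rightarrow> real^'n^'n) \<Rightarrow> real^'n \<Rightarrow> real^'n" where
  "mat_div F x = (\<chi> i. \<Sum>j\<in>UNIV. grad (\<lambda>y. F y $ i $ j) x $ j)"

fun C_k :: "nat \<Rightarrow> ('a::euclidean_space \<Rightarrow> real) \<Rightarrow> bool" where
  "C_k 0 f \<longleftrightarrow> continuous_on UNIV f"
| "C_k (Suc k) f \<longleftrightarrow>
     (\<forall>x. f differentiable (at x)) \<and> (\<forall>b\<in>Basis. C_k k (\<lambda>x. frechet_derivative f (at x) b))"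

text \<open>\<open>C\<^sub>c\<^sup>\<infinity>(\<Omega>)\<close>, extended by zero.\<close>

definition test_function :: "'a::euclidean_space set \<Rightarrow> ('a \<Rightarrow> real) \<Rightarrow> bool" where
  "test_function \<Omega> \<phi> \<longleftrightarrow> (\<forall>k. C_k k \<phi>) \<and> (\<exists>K. compact K \<and> K \<subseteq> \<Omega> \<and> (\<forall>x. x \<notin> K \<longrightarrow> \<phi> x = 0))"

definition L2 :: "'a::euclidean_space set \<Rightarrow> ('a \<Rightarrow> 'b::euclidean_space) set" where
  "L2 \<Omega> = {f. set_borel_measurable lebesgue \<Omega> f \<and> set_integrable lebesgue \<Omega> (\<lambda>x. (norm (f x))\<^sup>2)}"

definition L2_norm :: "'a::euclidean_space set \<Rightarrow> ('a \<Rightarrow> 'b::euclidean_space) \<Rightarrow> real" where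
  "L2_norm \<Omega> f = sqrt (LINT x:\<Omega>|lebesgue. (norm (f x))\<^sup>2)"

definition has_weak_gradient ::
    "(real^'n) set \<Rightarrow> (real^'n \<Rightarrow> real) \<Rightarrow> (real^'n \<Rightarrow> real^'n) \<Rightarrow> bool" where
  "has_weak_gradient \<Omega> u G \<longleftrightarrow> u \<in> L2 \<Omega> \<and> G \<in> L2 \<Omega> \<and>
     (\<forall>\<phi>. test_function \<Omega> \<phi> \<longrightarrow>
        (\<forall>k. (LINT x:\<Omega>|lebesgue. u x * grad \<phi> x $ k) = - (LINT x:\<Omega>|lebesgue. G x $ k * \<phi> x)))"

definition H1 :: "(real^'n) set \<Rightarrow> (real^'n \<Rightarrow> real) set" where
  "H1 \<Omega> = {u. \<exists>G. has_weak_gradient \<Omega> u G}"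

text \<open>The closure of the test functions in the norm of \<open>H\<^sup>1(\<Omega>)\<close>.\<close>

definition H10 :: "(real^'n) set \<Rightarrow> (real^'n \<Rightarrow> real) set" where
  "H10 \<Omega> = {u. \<exists>G \<phi>. has_weak_gradient \<Omega> u G \<and> (\<forall>m. test_function \<Omega> (\<phi> m)) \<and>
     (\<lambda>m::nat. (L2_norm \<Omega> (\<lambda>x. u x - \<phi> m x))\<^sup>2 + (L2_norm \<Omega> (\<lambda>x. G x - grad (\<phi> m) x))\<^sup>2)
       \<longlonglongrightarrow> 0}"

text \<open>Weak gradients are unique up to null sets, so the choice does not matter.\<close>

definition H1_norm :: "(real^'n) set \<Rightarrow> (real^'n \<Rightarrow> real) \<Rightarrow> real" where
  "H1_norm \<Omega> u = sqrt ((L2_norm \<Omega> u)\<^sup>2 + (L2_norm \<Omega> (SOME G. has_weak_gradient \<Omega> u G))\<^sup>2)"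


section \<open>Bochner spaces of functions on \<open>(0,T)\<close> with values in \<open>H\<^sup>1(\<Omega>)\<close>\<close>

text \<open>\<open>s\<close> is a simple function and \<open>J\<close> its integral.\<close>

definition H1_simple_integral ::
    "real \<Rightarrow> (real^'n) set \<Rightarrow> (real \<Rightarrow> real^'n \<Rightarrow> real) \<Rightarrow> (real^'n \<Rightarrow> real) \<Rightarrow> bool" where
  "H1_simple_integral T \<Omega> s J \<longleftrightarrow> (\<exists>(m::nat) A v.
     (\<forall>j<m. A j \<in> sets lebesgue \<and> A j \<subseteq> {0<..<T} \<and> v j \<in> H1 \<Omega>) \<and>
     s = (\<lambda>t x. \<Sum>j<m. indicator (A j) t * v j x) \<and>
     J = (\<lambda>x. \<Sum>j<m. measure lebesgue (A j) * v j x))"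

definition H1_measurable :: "real \<Rightarrow> (real^'n) set \<Rightarrow> (real \<Rightarrow> real^'n \<Rightarrow> real) \<Rightarrow> bool" where
  "H1_measurable T \<Omega> f \<longleftrightarrow>
     (AE t\<in>{0<..<T} in lebesgue. f t \<in> H1 \<Omega>) \<and>
     (\<exists>s J. (\<forall>m::nat. H1_simple_integral T \<Omega> (s m) (J m)) \<and>
        (AE t\<in>{0<..<T} in lebesgue. (\<lambda>m. H1_norm \<Omega> (\<lambda>x. s m t x - f t x)) \<longlonglongrightarrow> 0))"

definition has_H1_integral ::
    "real \<Rightarrow> (real^'n) set \<Rightarrow> (real \<Rightarrow> real^'n \<Rightarrow> real) \<Rightarrow> (real^'n \<Rightarrow> real) \<Rightarrow> bool" where
  "has_H1_integral T \<Omega> f I \<longleftrightarrow> H1_measurable T \<Omega> f \<and> I \<in> H1 \<Omega> \<and>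
     (\<exists>s J. (\<forall>m::nat. H1_simple_integral T \<Omega> (s m) (J m)) \<and>
        (\<lambda>m. \<integral>\<^sup>+t\<in>{0<..<T}. ennreal (H1_norm \<Omega> (\<lambda>x. s m t x - f t x)) \<partial>lebesgue) \<longlonglongrightarrow> 0 \<and>
        (\<lambda>m. H1_norm \<Omega> (\<lambda>x. J m x - I x)) \<longlonglongrightarrow> 0)"

definition Linf_H1 :: "real \<Rightarrow> (real^'n) set \<Rightarrow> (real \<Rightarrow> real^'n \<Rightarrow> real) set" where
  "Linf_H1 T \<Omega> = {f. H1_measurable T \<Omega> f \<and>
     (\<exists>M. AE t\<in>{0<..<T} in lebesgue. H1_norm \<Omega> (f t) \<le> M)}"

definition L2_H1 :: "real \<Rightarrow> (real^'n) set \<Rightarrow> (real \<Rightarrow> real^'n \<Rightarrow> real) set" where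
  "L2_H1 T \<Omega> = {f. H1_measurable T \<Omega> f \<and>
     (\<integral>\<^sup>+t\<in>{0<..<T}. ennreal ((H1_norm \<Omega> (f t))\<^sup>2) \<partial>lebesgue) < \<infinity>}"

definition W12_H1 :: "real \<Rightarrow> (real^'n) set \<Rightarrow> (real \<Rightarrow> real^'n \<Rightarrow> real) set" where
  "W12_H1 T \<Omega> = {f \<in> L2_H1 T \<Omega>. \<exists>f'\<in>L2_H1 T \<Omega>. \<forall>\<psi>. test_function {0<..<T} \<psi> \<longrightarrow>
     (\<exists>I. has_H1_integral T \<Omega> (\<lambda>t x. deriv \<psi> t * f t x) I \<and>
          has_H1_integral T \<Omega> (\<lambda>t x. \<psi> t * f' t x) (\<lambda>x. - I x))}"

text \<open>An element of \<open>W\<^sup>1\<^sup>,\<^sup>2(0,T;H\<^sup>1(\<Omega>))\<close> has a representative that is continuous on \<open>[0,T]\<close>; the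
  point values of the boundary data are those of this representative.\<close>

definition H1_continuous :: "real \<Rightarrow> (real^'n) set \<Rightarrow> (real \<Rightarrow> real^'n \<Rightarrow> real) \<Rightarrow> bool" where
  "H1_continuous T \<Omega> f \<longleftrightarrow> (\<forall>t\<in>{0..T}. f t \<in> H1 \<Omega> \<and>
     ((\<lambda>s. H1_norm \<Omega> (\<lambda>x. f s x - f t x)) \<longlongrightarrow> 0) (at t within {0..T}))"


section \<open>Finite element spaces\<close>

definition affine_fun_on :: "(real^'n) set \<Rightarrow> (real^'n \<Rightarrow> real) \<Rightarrow> bool" where
  "affine_fun_on K f \<longleftrightarrow> (\<exists>p r. \<forall>x\<in>K. f x = p \<bullet> x + r)"

text \<open>Finite element functions are represented by their continuous representatives on the closure
  of \<open>\<Omega>\<close>; their values elsewhere are irrelevant.\<close>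

definition P1 :: "(real^'n) set \<Rightarrow> (real^'n) set set \<Rightarrow> (real^'n \<Rightarrow> real) set" where
  "P1 \<Omega> Th = {f. continuous_on (closure \<Omega>) f \<and> (\<forall>K\<in>Th. affine_fun_on K f)}"

definition P1_mat :: "(real^'n) set \<Rightarrow> (real^'n) set set \<Rightarrow> (real^'n \<Rightarrow> real^'n^'n) set" where
  "P1_mat \<Omega> Th = {F. \<forall>i j. (\<lambda>x. F x $ i $ j) \<in> P1 \<Omega> Th}"

definition Y_h :: "(real^'n) set \<Rightarrow> (real^'n) set set \<Rightarrow> (real^'n \<Rightarrow> real) set" where
  "Y_h \<Omega> Th = {f \<in> H10 \<Omega>. \<forall>K\<in>Th. affine_fun_on K f}"

definition X_h :: "(real^'n) set \<Rightarrow> (real^'n) set set \<Rightarrow> (real^'n \<Rightarrow> real^'n^'n) set" where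
  "X_h \<Omega> Th = {F. \<forall>i j. (\<lambda>x. F x $ i $ j) \<in> Y_h \<Omega> Th}"

text \<open>\<open>fh\<close> is the \<open>L\<^sup>2(\<Omega>)\<close>-orthogonal projection of \<open>f\<close> onto the linear space \<open>S\<close>.\<close>

definition L2_projection ::
    "'a::euclidean_space set \<Rightarrow> ('a \<Rightarrow> 'b::euclidean_space) set \<Rightarrow> ('a \<Rightarrow> 'b) \<Rightarrow> ('a \<Rightarrow> 'b) \<Rightarrow> bool"
  where
  "L2_projection \<Omega> S f fh \<longleftrightarrow>
     fh \<in> S \<and> (\<forall>v\<in>S. (LINT x:\<Omega>|lebesgue. (f x - fh x) \<bullet> v x) = 0)"

definition D_plus :: "real \<Rightarrow> (nat \<Rightarrow> 'a::real_vector) \<Rightarrow> nat \<Rightarrow> 'a" where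
  "D_plus dt f n = (1 / dt) *\<^sub>R (f (Suc n) - f n)"

definition midpt :: "(nat \<Rightarrow> 'a::real_vector) \<Rightarrow> nat \<Rightarrow> 'a" where
  "midpt f n = (1 / 2) *\<^sub>R (f n + f (Suc n))"


section \<open>Matrices, truncation and bulk terms\<close>

text \<open>The library's inner product \<open>\<bullet>\<close> and norm on iterated vectors are the full contraction and
  the Frobenius norm.\<close>

definition sym_part :: "real^'n^'n \<Rightarrow> real^'n^'n" where
  "sym_part A = (1 / 2) *\<^sub>R (A + transpose A)"

definition hadamard :: "real^'n^'n \<Rightarrow> real^'n^'n \<Rightarrow> real^'n^'n" where
  "hadamard A B = (\<chi> i j. A $ i $ j * B $ i $ j)"

definition outer :: "real^'n \<Rightarrow> real^'n \<Rightarrow> real^'n^'n" where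
  "outer v w = (\<chi> i j. v $ i * w $ j)"

text \<open>Since \<open>\<T>\<close> acts entrywise, through the functions \<open>\<tau> i j\<close>, it is twice continuously
  differentiable iff these are, and all derivatives with respect to other entries vanish.\<close>

definition truncation :: "real \<Rightarrow> real \<Rightarrow> (real^'n^'n \<Rightarrow> real^'n^'n) \<Rightarrow> bool" where
  "truncation R CT \<T> \<longleftrightarrow>
     (\<exists>\<tau> \<tau>' \<tau>'' :: 'n \<Rightarrow> 'n \<Rightarrow> real \<Rightarrow> real. \<forall>i j.
        (\<forall>A. \<T> A $ i $ j = \<tau> i j (A $ i $ j)) \<and>
        (\<forall>s. (\<tau> i j has_real_derivative \<tau>' i j s) (at s)) \<and>
        (\<forall>s. (\<tau>' i j has_real_derivative \<tau>'' i j s) (at s)) \<and>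
        continuous_on UNIV (\<tau>'' i j) \<and>
        (\<forall>s. \<bar>\<tau>' i j s\<bar> \<le> CT \<and> \<bar>\<tau>'' i j s\<bar> \<le> CT)) \<and>
     (\<forall>A. transpose A = A \<longrightarrow> transpose (\<T> A) = \<T> A) \<and>
     (\<forall>A i j. \<T> A $ i $ j \<in> {- R / real CARD('n) .. R / real CARD('n)})"

definition set_entry :: "'a^'n^'n \<Rightarrow> 'n \<Rightarrow> 'n \<Rightarrow> 'a \<Rightarrow> 'a^'n^'n" where
  "set_entry A i j s = (\<chi> k l. if k = i \<and> l = j then s else A $ k $ l)"

definition P_tilde :: "(real^'n^'n \<Rightarrow> real^'n^'n) \<Rightarrow> real^'n^'n \<Rightarrow> real^'n^'n \<Rightarrow> real^'n^'n" where
  "P_tilde \<T> A B = (\<chi> i j.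
     if A $ i $ j \<noteq> B $ i $ j
     then (\<T> A $ i $ j - \<T> B $ i $ j) / (A $ i $ j - B $ i $ j)
     else deriv (\<lambda>s. \<T> (set_entry B i j s) $ i $ j) (B $ i $ j))"

definition F_B :: "real \<Rightarrow> real \<Rightarrow> real \<Rightarrow> real \<Rightarrow> real^'n^'n \<Rightarrow> real" where
  "F_B a b c A0 Q =
     a / 2 * trace (Q ** Q) - b / 3 * trace (Q ** Q ** Q) + c / 4 * (trace (Q ** Q))\<^sup>2 + A0"

definition dF1 :: "real \<Rightarrow> real \<Rightarrow> real \<Rightarrow> real^'n^'n \<Rightarrow> real^'n^'n" where
  "dF1 b \<beta>1 \<beta>2 Q =
     (let M = Q ** transpose Q + transpose Q ** Q + Q ** Q
      in \<beta>1 *\<^sub>R Q - (b / 3) *\<^sub>R (M - (1 / real CARD('n) * trace M) *\<^sub>R mat 1)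
         + (\<beta>2 * (norm Q)\<^sup>2) *\<^sub>R Q)"

definition dF2 :: "real \<Rightarrow> real \<Rightarrow> real \<Rightarrow> real \<Rightarrow> real^'n^'n \<Rightarrow> real^'n^'n" where
  "dF2 a c \<beta>1 \<beta>2 Q = (\<beta>1 - a) *\<^sub>R Q + ((\<beta>2 - c) * (norm Q)\<^sup>2) *\<^sub>R Q"


section \<open>The scheme\<close>

definition Q_equation ::
    "(real^'n) set \<Rightarrow> real \<Rightarrow> real \<Rightarrow> real \<Rightarrow> real \<Rightarrow> real \<Rightarrow> real \<Rightarrow> real \<Rightarrow> real \<Rightarrow>
     (real^'n^'n \<Rightarrow> real^'n^'n) \<Rightarrow> real \<Rightarrow> (nat \<Rightarrow> real^'n \<Rightarrow> real^'n^'n) \<Rightarrow>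
     (nat \<Rightarrow> real^'n \<Rightarrow> real) \<Rightarrow> nat \<Rightarrow> (real^'n \<Rightarrow> real^'n^'n) \<Rightarrow> bool" where
  "Q_equation \<Omega> L \<epsilon>2 \<epsilon>3 a b c \<beta>1 \<beta>2 \<T> dt Q u n \<Phi> \<longleftrightarrow>
     - (LINT x:\<Omega>|lebesgue. D_plus dt (\<lambda>m. Q m x) n \<bullet> \<Phi> x) =
       L * (LINT x:\<Omega>|lebesgue. mat_grad (\<lambda>y. midpt (\<lambda>m. Q m y) n) x \<bullet> mat_grad \<Phi> x)
     + (LINT x:\<Omega>|lebesgue. (dF1 b \<beta>1 \<beta>2 (Q (Suc n) x) - dF2 a c \<beta>1 \<beta>2 (Q n x)) \<bullet> \<Phi> x)
     - \<epsilon>2 / 2 * (LINT x:\<Omega>|lebesgue.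
         (let S = hadamard (P_tilde \<T> (Q (Suc n) x) (Q n x))
                    (outer (grad (u n) x) (grad (u (Suc n)) x))
          in (sym_part S - (1 / real CARD('n) * trace S) *\<^sub>R mat 1) \<bullet> \<Phi> x))
     - \<epsilon>3 * (LINT x:\<Omega>|lebesgue.
         (let p = grad (\<lambda>y. midpt (\<lambda>m. u m y) n) x
          in p \<bullet> mat_div (\<lambda>y. sym_part (\<Phi> y)) x
             - 1 / real CARD('n) * (p \<bullet> grad (\<lambda>y. trace (\<Phi> y)) x)))"

definition u_equation ::
    "(real^'n) set \<Rightarrow> real \<Rightarrow> real \<Rightarrow> real \<Rightarrow> (real^'n^'n \<Rightarrow> real^'n^'n) \<Rightarrow>
     (nat \<Rightarrow> real^'n \<Rightarrow> real^'n^'n) \<Rightarrow> (nat \<Rightarrow> real^'n \<Rightarrow> real) \<Rightarrow> nat \<Rightarrow> (real^'n \<Rightarrow> real) \<Rightarrow> bool"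
  where
  "u_equation \<Omega> \<epsilon>1 \<epsilon>2 \<epsilon>3 \<T> Q u n \<psi> \<longleftrightarrow>
     (LINT x:\<Omega>|lebesgue.
        (\<epsilon>1 *\<^sub>R grad (u n) x + \<epsilon>2 *\<^sub>R (\<T> (Q n x) *v grad (u n) x) + \<epsilon>3 *\<^sub>R mat_div (Q n) x)
          \<bullet> grad \<psi> x) = 0"

definition discrete_solution ::
    "(real^'n) set \<Rightarrow> (real^'n) set set \<Rightarrow> real \<Rightarrow> real \<Rightarrow> real \<Rightarrow> real \<Rightarrow> real \<Rightarrow> real \<Rightarrow> real \<Rightarrow>
     real \<Rightarrow> real \<Rightarrow> (real^'n^'n \<Rightarrow> real^'n^'n) \<Rightarrow> real \<Rightarrow> nat \<Rightarrow> (real^'n \<Rightarrow> real^'n^'n) \<Rightarrow>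
     (nat \<Rightarrow> real^'n \<Rightarrow> real) \<Rightarrow> (nat \<Rightarrow> real^'n \<Rightarrow> real^'n^'n) \<Rightarrow>
     (nat \<Rightarrow> real^'n \<Rightarrow> real) \<Rightarrow> bool" where
  "discrete_solution \<Omega> Th L \<epsilon>1 \<epsilon>2 \<epsilon>3 a b c \<beta>1 \<beta>2 \<T> dt N qh gh Q u \<longleftrightarrow>
     (\<forall>n\<le>N. (\<lambda>x. Q n x - qh x) \<in> X_h \<Omega> Th) \<and>
     (\<forall>n\<le>N. (\<lambda>x. u n x - gh n x) \<in> Y_h \<Omega> Th) \<and>
     (\<forall>x\<in>\<Omega>. transpose (Q 0 x) = Q 0 x \<and> trace (Q 0 x) = 0) \<and>
     (\<forall>n<N. \<forall>\<Phi>\<in>X_h \<Omega> Th. Q_equation \<Omega> L \<epsilon>2 \<epsilon>3 a b c \<beta>1 \<beta>2 \<T> dt Q u n \<Phi>) \<and>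
     (\<forall>n\<le>N. \<forall>\<psi>\<in>Y_h \<Omega> Th. u_equation \<Omega> \<epsilon>1 \<epsilon>2 \<epsilon>3 \<T> Q u n \<psi>)"

end

theory Submission
  imports Defs
begin

text \<open>Testing the equation for \<open>Q\<close> with \<open>D\<^sub>t\<^sup>+ Q\<close> and the difference of the equations for
  \<open>u\<close> at two consecutive times with \<open>u - g\<close> at the midpoint, all coupling terms cancel exactly.
  Since \<open>F\<^sub>1\<close> and \<open>F\<^sub>2\<close> are convex, what remains bounds the increment of
  \<open>\<integral> F\<^sub>B(Q) + L/2 |\<nabla>Q|\<^sup>2 + 1/2 \<nabla>u \<bullet> (\<epsilon>\<^sub>1 + \<epsilon>\<^sub>2 \<T>(Q)) \<nabla>u\<close> by the pairing of the increment of
  the flux \<open>\<epsilon>\<^sub>1 \<nabla>u + \<epsilon>\<^sub>2 \<T>(Q) \<nabla>u + \<epsilon>\<^sub>3 div Q\<close> with the midpoint of \<open>\<nabla>g\<close>. Summation by parts,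
  Young's inequality and the discrete Gronwall lemma conclude; the step size enters only through
  the upper bound that follows from its restriction. The cancellation needs \<open>Q\<close> to be symmetric
  and trace-free, which the scheme preserves: the equation for \<open>Q\<close> may be tested with the skew
  part of \<open>Q\<close> and with \<open>tr(Q) I\<close>.\<close>

section \<open>Matrices and the bulk terms\<close>

text \<open>The equation for \<open>u\<close> holds at each time level separately, so the flux of
  one level may be tested with the potential of the other; the four pairings of two consecutive
  levels make up the midpoint test. Their mixed terms leave grad u^n . (\<T>(Q^{n+1}) - \<T>(Q^n))
  grad u^{n+1}. The divided difference \<open>P_tilde\<close>, multiplied by the mixed product of
  the two gradients, is designed so that the equation for \<open>Q\<close> produces the same
  expression without remainder. The obstacle is pointwise information. Finite element functions have
  a classical gradient only off the element boundaries, and integral identities give symmetry and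
  zero trace only almost everywhere, whereas gradients and divergences need them in a neighbourhood.
  The work therefore takes place on an open subset of full measure, on which all functions are
  affine element by element, and a vanishing integral is turned into vanishing at each of its
  points. Admissibility of the test functions is a separate matter, since the spaces are defined
  through limits of smooth functions.\<close>

lemma inner_matrix: "(A :: real^'n^'m) \<bullet> B = (\<Sum>i\<in>UNIV. \<Sum>j\<in>UNIV. A $ i $ j * B $ i $ j)"
  by (simp add: inner_vec_def)

lemma inner_transpose: "transpose (A :: real^'n^'m) \<bullet> transpose B = A \<bullet> B"
  unfolding inner_matrix transpose_def by (subst sum.swap) simp

lemma norm_transpose: "norm (transpose (A :: real^'n^'m)) = norm A"
  by (simp add: norm_eq_sqrt_inner inner_transpose)

text \<open>Cauchy-Schwarz in each row: for the Frobenius norm the squared row norms add up to the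
  squared norm of \<open>A\<close>.\<close>

lemma norm_matrix_vector_mult_le: "norm ((A :: real^'n^'m) *v x) \<le> norm A * norm x"
proof -
  have "(norm (A *v x))\<^sup>2 = (\<Sum>i\<in>UNIV. (A $ i \<bullet> x)\<^sup>2)"
    unfolding power2_norm_eq_inner by (simp add: inner_vec_def matrix_vector_mult_def power2_eq_square)
  also have "\<dots> \<le> (\<Sum>i\<in>UNIV. (norm (A $ i))\<^sup>2 * (norm x)\<^sup>2)"
    by (intro sum_mono) (metis Cauchy_Schwarz_ineq power2_norm_eq_inner)
  also have "\<dots> = (norm A * norm x)\<^sup>2"
    by (simp add: power_mult_distrib sum_distrib_right [symmetric])
       (simp add: power2_norm_eq_inner inner_vec_def)
  finally show ?thesis by (rule power2_le_imp_le) simp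
qed

lemma norm_matrix_mult_le: "norm ((A :: real^'n^'m) ** (B :: real^'k^'n)) \<le> norm A * norm B"
proof -
  have "(norm (A ** B))\<^sup>2 = (\<Sum>j\<in>UNIV. (norm (A *v column j B))\<^sup>2)"
    unfolding power2_norm_eq_inner inner_matrix
    by (subst sum.swap)
       (simp add: inner_vec_def matrix_vector_mult_def matrix_matrix_mult_def column_def)
  also have "\<dots> \<le> (\<Sum>j\<in>UNIV. (norm A * norm (column j B))\<^sup>2)"
    by (intro sum_mono power_mono norm_matrix_vector_mult_le) simp
  also have "\<dots> = (norm A)\<^sup>2 * (\<Sum>j\<in>UNIV. (norm (transpose B $ j))\<^sup>2)"
    by (simp add: power_mult_distrib sum_distrib_left transpose_def column_def)
  also have "\<dots> = (norm A * norm B)\<^sup>2"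
    unfolding power_mult_distrib norm_transpose [of B, symmetric]
    by (simp add: power2_norm_eq_inner inner_vec_def)
  finally show ?thesis by (rule power2_le_imp_le) simp
qed

lemma trace_mult_eq_inner: "trace ((A :: real^'n^'n) ** B) = transpose A \<bullet> B"
  unfolding inner_matrix trace_def matrix_matrix_mult_def transpose_def
  by (subst sum.swap) simp

lemma inner_mat_1: "(A :: real^'n^'n) \<bullet> mat 1 = trace A" "mat 1 \<bullet> A = trace A"
  by (simp_all add: inner_matrix trace_def mat_def if_distrib if_distribR cong: if_cong)

lemma inner_sym_skew:
  assumes "transpose (A :: real^'n^'n) = A" "transpose B = - B"
  shows "A \<bullet> B = 0"
  using inner_transpose [of A B] assms by simp

lemma transpose_add: "transpose (A + B) = transpose A + transpose (B :: real^'n^'m)"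
  and transpose_diff: "transpose (A - B) = transpose A - transpose (B :: real^'n^'m)"
  by (simp_all add: transpose_def vec_eq_iff)

lemma trace_scaleR: "trace (r *\<^sub>R (A :: real^'n^'n)) = r * trace A"
  by (simp add: trace_def sum_distrib_left)

lemma trace_transpose_real: "trace (transpose (A :: real^'n^'n)) = trace A"
  by (simp add: trace_def transpose_def)

lemma matrix_mult_scaleR:
  "(r *\<^sub>R (A :: real^'n^'m)) ** (B :: real^'k^'n) = r *\<^sub>R (A ** B)"
  "A ** (r *\<^sub>R B) = r *\<^sub>R (A ** B)"
  by (simp_all add: vec_eq_iff matrix_matrix_mult_def sum_distrib_left mult_ac)

lemma matrix_mult_diff:
  "((A :: real^'n^'m) - B) ** (C :: real^'k^'n) = A ** C - B ** C"
  "D ** (C - E) = D ** C - D ** (E :: real^'k^'n)"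
  by (simp_all add: vec_eq_iff matrix_matrix_mult_def sum_subtractf algebra_simps)

lemma matrix_mult_add_rdistrib: "((A :: real^'n^'m) + B) ** (C :: real^'k^'n) = A ** C + B ** C"
  by (simp add: vec_eq_iff matrix_matrix_mult_def sum.distrib algebra_simps)

lemma inner_matrix_mult_bound:
  "\<bar>(A ** B) \<bullet> (C :: real^'n^'n)\<bar> \<le> norm A * norm B * norm C"
  by (meson Cauchy_Schwarz_ineq2 norm_matrix_mult_le mult_right_mono norm_ge_zero order_trans)

text \<open>The form in which the bulk term is tested: the trace correction becomes a product of
  traces and disappears against trace-free matrices.\<close>

lemma dF1_inner:
  "dF1 b \<beta>1 \<beta>2 Q \<bullet> \<Phi> = \<beta>1 * (Q \<bullet> \<Phi>)
     - b / 3 * ((Q ** transpose Q + transpose Q ** Q + Q ** Q) \<bullet> \<Phi>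
         - trace (Q ** transpose Q + transpose Q ** Q + Q ** Q) / real CARD('n) * trace \<Phi>)
     + \<beta>2 * (norm Q)\<^sup>2 * (Q \<bullet> \<Phi>)"
  for Q \<Phi> :: "real^'n^'n"
  by (simp add: dF1_def Let_def inner_add_left inner_diff_left inner_mat_1)

lemma dF2_inner:
  "dF2 a c \<beta>1 \<beta>2 Q \<bullet> \<Phi> = (\<beta>1 - a) * (Q \<bullet> \<Phi>) + (\<beta>2 - c) * (norm Q)\<^sup>2 * (Q \<bullet> \<Phi>)"
  by (simp add: dF2_def inner_add_left)

text \<open>Symmetric matrices are orthogonal to the skew matrix \<Phi>, so besides the two positive
  terms \<open>\<beta>1 * (norm \<Phi>)\<^sup>2\<close> and
  \<open>\<beta>2 * (norm Q)\<^sup>2 * (norm \<Phi>)\<^sup>2\<close> only the contribution of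
  \<open>Q ** Q\<close> survives. It is at most a multiple of |b| |Q| |\<Phi>|^2, which the lower
  bounds on \<beta>1 and \<beta>2 absorb.\<close>

lemma bulk_skew_nonneg:
  fixes Q P :: "real^'n^'n"
  assumes P: "transpose P = P" and b: "\<beta>1 \<ge> \<bar>b\<bar>" "\<beta>2 \<ge> \<bar>b\<bar>"
    and \<Phi>: "\<Phi> = (1 / 2) *\<^sub>R (Q - transpose Q)"
  shows "(dF1 b \<beta>1 \<beta>2 Q - dF2 a c \<beta>1 \<beta>2 P) \<bullet> \<Phi> \<ge> 0"
proof -
  have skew: "transpose \<Phi> = - \<Phi>"
    by (simp add: \<Phi> transpose_scalar transpose_diff scaleR_diff_right)
  have tr0: "trace \<Phi> = 0"
    using trace_transpose_real [of \<Phi>] skew by (simp add: trace_def sum_negf)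
  have QQt: "(Q ** transpose Q) \<bullet> \<Phi> = 0" "(transpose Q ** Q) \<bullet> \<Phi> = 0"
    by (rule inner_sym_skew; simp add: matrix_transpose_mul skew)+
  have P0: "P \<bullet> \<Phi> = 0"
    by (rule inner_sym_skew [OF P skew])
  have swap: "transpose A \<bullet> \<Phi> = - (A \<bullet> \<Phi>)" for A
    using inner_transpose [of A \<Phi>] skew by simp
  have half: "A \<bullet> \<Phi> = ((1/2) *\<^sub>R (A - transpose A)) \<bullet> \<Phi>" for A
    by (simp add: inner_diff_left swap)
  have Q\<Phi>: "Q \<bullet> \<Phi> = (norm \<Phi>)\<^sup>2"
    using half [of Q] unfolding \<Phi> [symmetric] by (simp add: power2_norm_eq_inner)
  \<comment> \<open>The skew part of \<open>Q ** Q\<close> is linear in the skew part \<Phi> of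
    \<open>Q\<close>. Hence its contraction with \<Phi> is quadratic in \<Phi>, comparable with the
    positive terms.\<close>
  have "(1/2) *\<^sub>R (Q ** Q - transpose (Q ** Q)) = Q ** \<Phi> + \<Phi> ** transpose Q"
    by (simp add: matrix_transpose_mul \<Phi> matrix_mult_scaleR matrix_mult_diff scaleR_diff_right)
  then have "(Q ** Q) \<bullet> \<Phi> = (Q ** \<Phi>) \<bullet> \<Phi> + (\<Phi> ** transpose Q) \<bullet> \<Phi>"
    using half [of "Q ** Q"] by (simp add: inner_add_left)
  moreover have "\<bar>(Q ** \<Phi>) \<bullet> \<Phi>\<bar> \<le> norm Q * (norm \<Phi>)\<^sup>2"
    using inner_matrix_mult_bound [of Q \<Phi> \<Phi>] by (simp add: power2_eq_square mult_ac)
  moreover have "\<bar>(\<Phi> ** transpose Q) \<bullet> \<Phi>\<bar> \<le> norm Q * (norm \<Phi>)\<^sup>2"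
    using inner_matrix_mult_bound [of \<Phi> "transpose Q" \<Phi>]
    by (simp add: power2_eq_square mult_ac norm_transpose)
  ultimately have QQ: "\<bar>(Q ** Q) \<bullet> \<Phi>\<bar> \<le> 2 * (norm Q * (norm \<Phi>)\<^sup>2)"
    by linarith
  have "b / 3 * ((Q ** Q) \<bullet> \<Phi>) \<le> \<bar>b\<bar> / 3 * (2 * (norm Q * (norm \<Phi>)\<^sup>2))"
    using mult_left_mono [OF QQ, of "\<bar>b\<bar> / 3"] abs_ge_self [of "b / 3 * ((Q ** Q) \<bullet> \<Phi>)"]
    by (simp add: abs_mult)
  also have "\<dots> = (\<bar>b\<bar> * (2 / 3 * norm Q)) * (norm \<Phi>)\<^sup>2" by simp
  also have "\<dots> \<le> (\<beta>1 + \<beta>2 * (norm Q)\<^sup>2) * (norm \<Phi>)\<^sup>2"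
  proof (rule mult_right_mono)
    have "2 / 3 * norm Q \<le> 1 + (norm Q)\<^sup>2"
      using sum_squares_bound [of 1 "norm Q"] norm_ge_zero [of Q] by (simp del: norm_ge_zero)
    then have "\<bar>b\<bar> * (2 / 3 * norm Q) \<le> \<bar>b\<bar> * (1 + (norm Q)\<^sup>2)"
      by (intro mult_left_mono) auto
    also have "\<dots> \<le> \<beta>1 + \<beta>2 * (norm Q)\<^sup>2"
      using b mult_right_mono [OF b(2), of "(norm Q)\<^sup>2"] by (simp add: algebra_simps)
    finally show "\<bar>b\<bar> * (2 / 3 * norm Q) \<le> \<beta>1 + \<beta>2 * (norm Q)\<^sup>2" .
  qed simp
  finally show ?thesis
    by (simp add: inner_diff_left dF1_inner dF2_inner QQt tr0 P0 Q\<Phi> inner_add_left algebra_simps)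
qed

text \<open>The cubic part of the energy enters \<open>dF1\<close> through a trace-free matrix and
  \<open>dF2\<close> at \<open>P\<close> is a multiple of the trace-free \<open>P\<close>; both are
  orthogonal to the identity. What remains is a nonnegative multiple of the squared trace.\<close>

lemma bulk_trace_nonneg:
  fixes Q P :: "real^'n^'n"
  assumes P: "trace P = 0" and b: "\<beta>1 \<ge> \<bar>b\<bar>" "\<beta>2 \<ge> \<bar>b\<bar>"
  shows "(dF1 b \<beta>1 \<beta>2 Q - dF2 a c \<beta>1 \<beta>2 P) \<bullet> (trace Q *\<^sub>R mat 1) \<ge> 0"
proof -
  have tr: "trace (mat 1 :: real^'n^'n) = real CARD('n)"
    by (simp add: trace_def mat_def)
  have "dF1 b \<beta>1 \<beta>2 Q \<bullet> (t *\<^sub>R mat 1) = t * (\<beta>1 * trace Q + \<beta>2 * (norm Q)\<^sup>2 * trace Q)" for t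
    unfolding dF1_inner by (simp add: inner_mat_1 trace_scaleR tr algebra_simps)
  moreover have "dF2 a c \<beta>1 \<beta>2 P \<bullet> (t *\<^sub>R mat 1) = 0" for t
    unfolding dF2_inner by (simp add: inner_mat_1 P)
  ultimately have "(dF1 b \<beta>1 \<beta>2 Q - dF2 a c \<beta>1 \<beta>2 P) \<bullet> (trace Q *\<^sub>R mat 1)
      = (\<beta>1 + \<beta>2 * (norm Q)\<^sup>2) * (trace Q)\<^sup>2"
    unfolding inner_diff_left by (simp add: power2_eq_square algebra_simps)
  moreover have "\<beta>1 \<ge> 0" "\<beta>2 \<ge> 0" using b by linarith+
  ultimately show ?thesis by simp
qed

lemma trace_sym_square: "transpose Q = Q \<Longrightarrow> trace (Q ** Q) = (norm Q)\<^sup>2" for Q :: "real^'n^'n"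
  by (simp add: trace_mult_eq_inner power2_norm_eq_inner)

text \<open>On symmetric trace-free matrices \<open>F_B\<close> is, up to the constant
  \<open>A0\<close>, a difference F1 - F2 of convex functions with gradients \<open>dF1\<close> and
  \<open>dF2\<close>. Taking F1 implicitly (tangent at the new value \<open>A\<close>) and F2
  explicitly (tangent at the old value \<open>B\<close>) gives both convexity inequalities the
  favourable sign, for any step size.\<close>

lemma bulk_convex_splitting:
  fixes A B :: "real^'n^'n"
  assumes A: "transpose A = A" "trace A = 0" and B: "transpose B = B" "trace B = 0"
    and \<beta>: "\<beta>1 \<ge> max \<bar>b\<bar> a" "\<beta>2 \<ge> max \<bar>b\<bar> c"
  shows "F_B a b c A0 A - F_B a b c A0 B \<le> (dF1 b \<beta>1 \<beta>2 A - dF2 a c \<beta>1 \<beta>2 B) \<bullet> (A - B)"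
proof -
  define H where "H = B - A"
  have B_eq: "B = A + H" by (simp add: H_def)
  have H: "transpose H = H" "trace H = 0"
    using A B by (simp_all add: H_def transpose_diff trace_sub)
  define h p where "h = (norm H)\<^sup>2" and "p = A \<bullet> H"
  have h0: "h \<ge> 0" by (simp add: h_def)
  have nB: "(norm B)\<^sup>2 = (norm A)\<^sup>2 + 2 * p + h"
    unfolding B_eq h_def p_def power2_norm_eq_inner
    by (simp add: inner_add_left inner_add_right inner_commute)
  have pB: "B \<bullet> H = p + h"
    by (simp add: B_eq p_def h_def inner_add_left power2_norm_eq_inner)
  have cubeA: "trace (A ** A ** A) = (A ** A) \<bullet> A"
    using A by (simp add: trace_mult_eq_inner matrix_transpose_mul)
  \<comment> \<open>Invariance of the trace of a triple product under cyclic shifts. It collects the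
    eight terms of the expanded cube with binomial coefficients although the matrices need not
    commute.\<close>
  have comm: "(X ** Y) \<bullet> Z = (Y ** Z) \<bullet> X"
    if "transpose X = X" "transpose Y = Y" "transpose Z = Z" for X Y Z :: "real^'n^'n"
  proof -
    have "(X ** Y) \<bullet> Z = trace (X ** Y ** Z)"
      using that by (metis inner_commute matrix_mul_assoc trace_mul_sym trace_mult_eq_inner)
    also have "\<dots> = trace (Y ** Z ** X)"
      by (metis matrix_mul_assoc trace_mul_sym)
    also have "\<dots> = (Y ** Z) \<bullet> X"
      using that by (metis inner_commute matrix_mul_assoc trace_mul_sym trace_mult_eq_inner)
    finally show ?thesis .
  qed
  have cubeB: "trace (B ** B ** B) = (A ** A) \<bullet> A + 3 * ((A ** A) \<bullet> H) + 3 * ((A ** H) \<bullet> H) + (H ** H) \<bullet> H"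
  proof -
    have "trace (B ** B ** B) = (B ** B) \<bullet> B"
      using B by (simp add: trace_mult_eq_inner matrix_transpose_mul)
    also have "\<dots> = (A ** A) \<bullet> A + (A ** A) \<bullet> H + (A ** H) \<bullet> A + (H ** A) \<bullet> A
        + (A ** H) \<bullet> H + (H ** A) \<bullet> H + (H ** H) \<bullet> A + (H ** H) \<bullet> H"
      unfolding B_eq
      by (simp add: matrix_add_ldistrib matrix_mult_add_rdistrib inner_add_left inner_add_right)
    also have "\<dots> = (A ** A) \<bullet> A + 3 * ((A ** A) \<bullet> H) + 3 * ((A ** H) \<bullet> H) + (H ** H) \<bullet> H"
      using comm [of A H A] comm [of H A A] comm [of A A H] comm [of H A H] comm [of A H H]
        comm [of H H A] A H by simp
    finally show ?thesis .
  qed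
  \<comment> \<open>The second-order Taylor remainder of tr(Q^3)/3 at \<open>A\<close> is the
    contraction of \<open>K ** H\<close> with \<open>H\<close>: the point \<open>K\<close> is the
    mean of \<open>A + t H\<close> over t in [0,1] with weight 2(1 - t), which gives the factor
    1/3.\<close>
  define K where "K = A + (1/3) *\<^sub>R H"
  define k where "k = norm K"
  have k2: "k\<^sup>2 = (norm A)\<^sup>2 + 2 / 3 * p + h / 9"
    unfolding k_def K_def h_def p_def power2_norm_eq_inner
    by (simp add: inner_add_left inner_add_right inner_commute)
  have cubic: "\<bar>(A ** H) \<bullet> H + (H ** H) \<bullet> H / 3\<bar> \<le> k * h"
  proof -
    have "(A ** H) \<bullet> H + (H ** H) \<bullet> H / 3 = (K ** H) \<bullet> H"
      by (simp add: K_def matrix_mult_add_rdistrib inner_add_left matrix_mult_scaleR)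
    then show ?thesis
      using inner_matrix_mult_bound [of K H H] by (simp add: k_def h_def power2_eq_square mult_ac)
  qed
  have dF1: "dF1 b \<beta>1 \<beta>2 A \<bullet> H = \<beta>1 * p - b * ((A ** A) \<bullet> H) + \<beta>2 * (norm A)\<^sup>2 * p"
    unfolding dF1_inner A H inner_add_left p_def by (simp add: algebra_simps)
  have dF2: "dF2 a c \<beta>1 \<beta>2 B \<bullet> H = (\<beta>1 - a) * (p + h) + (\<beta>2 - c) * (norm B)\<^sup>2 * (p + h)"
    by (simp add: dF2_inner pB)
  have FA: "F_B a b c A0 A = a / 2 * (norm A)\<^sup>2 - b / 3 * ((A ** A) \<bullet> A) + c / 4 * ((norm A)\<^sup>2)\<^sup>2 + A0"
    by (simp add: F_B_def cubeA trace_sym_square A)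
  have FB: "F_B a b c A0 B = a / 2 * (norm B)\<^sup>2
      - b / 3 * ((A ** A) \<bullet> A + 3 * ((A ** A) \<bullet> H) + 3 * ((A ** H) \<bullet> H) + (H ** H) \<bullet> H)
      + c / 4 * ((norm B)\<^sup>2)\<^sup>2 + A0"
    by (simp add: F_B_def cubeB trace_sym_square B)
  define m where "m = (norm A)\<^sup>2"
  define q n where "q = (A ** H) \<bullet> H + (H ** H) \<bullet> H / 3" and "n = (norm B)\<^sup>2"
  have AB: "A - B = - H" by (simp add: H_def)
  \<comment> \<open>The right-hand side adds up the excess of the convex parts \<open>F1\<close> and \<open>F2\<close> over their tangents
    at \<open>A\<close> and \<open>B\<close>.\<close>
  have "(dF1 b \<beta>1 \<beta>2 A - dF2 a c \<beta>1 \<beta>2 B) \<bullet> (A - B) - (F_B a b c A0 A - F_B a b c A0 B)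
     = (\<beta>1 / 2 * h - b * q + \<beta>2 / 4 * (4 * p\<^sup>2 + h\<^sup>2 + 2 * m * h + 4 * p * h))
       + ((\<beta>1 - a) / 2 * h + (\<beta>2 - c) / 4 * ((2 * p + h)\<^sup>2 + 2 * n * h))"
    unfolding FA FB AB inner_diff_left inner_minus_right dF1 dF2 n_def nB m_def q_def
    by (simp add: field_simps power2_eq_square)
  also have "\<dots> \<ge> 0"
  proof (rule add_nonneg_nonneg)
    have "\<beta>2 \<ge> 0" using \<beta> by linarith
    have "k \<ge> 0" by (simp add: k_def)
    have "b * q \<le> \<bar>b\<bar> * (k * h)"
      using cubic mult_left_mono [of "\<bar>q\<bar>" "k * h" "\<bar>b\<bar>"] abs_ge_self [of "b * q"]
      by (simp add: q_def abs_mult)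
    \<comment> \<open>The right-hand side is the quartic excess |B|^4 - |A|^4 - 4 |A|^2 (A : H). It
      dominates the same size of \<open>K\<close> that controls the cubic remainder, by completing
      the square in \<open>p\<close>.\<close>
    moreover have "2 * k\<^sup>2 * h \<le> 4 * p\<^sup>2 + h\<^sup>2 + 2 * m * h + 4 * p * h"
    proof -
      have "4 * p\<^sup>2 + h\<^sup>2 + 2 * m * h + 4 * p * h - 2 * k\<^sup>2 * h = (2 * p + 2 / 3 * h)\<^sup>2 + h\<^sup>2 / 3"
        unfolding k2 m_def
          by (simp add: field_simps power2_eq_square)
      also have "\<dots> \<ge> 0" by simp
      finally show ?thesis by simp
    qed
    then have "\<beta>2 / 4 * (2 * k\<^sup>2 * h) \<le> \<beta>2 / 4 * (4 * p\<^sup>2 + h\<^sup>2 + 2 * m * h + 4 * p * h)"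
      using \<open>\<beta>2 \<ge> 0\<close> by (intro mult_left_mono) auto
    \<comment> \<open>From 2k \<le> 1 + k^2: one half of the cubic remainder is charged to the
      quadratic excess, the other to the quartic one.\<close>
    moreover have "\<bar>b\<bar> * (k * h) \<le> \<beta>1 / 2 * h + \<beta>2 / 4 * (2 * k\<^sup>2 * h)"
    proof -
      have "\<bar>b\<bar> * h \<le> \<beta>1 * h" "\<bar>b\<bar> * (k\<^sup>2 * h) \<le> \<beta>2 * (k\<^sup>2 * h)"
        using \<beta> h0 by (intro mult_right_mono; simp)+
      moreover have "0 \<le> \<bar>b\<bar> * ((1 - k)\<^sup>2 * h)" using h0 by simp
      moreover have "\<bar>b\<bar> * ((1 - k)\<^sup>2 * h) = \<bar>b\<bar> * h + \<bar>b\<bar> * (k\<^sup>2 * h) - 2 * (\<bar>b\<bar> * (k * h))"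
        by (simp add: power2_eq_square algebra_simps)
      moreover have "\<beta>2 / 4 * (2 * k\<^sup>2 * h) = \<beta>2 * (k\<^sup>2 * h) / 2" by simp
      moreover have "\<beta>1 / 2 * h = \<beta>1 * h / 2" by simp
      ultimately show ?thesis by linarith
    qed
    ultimately show "0 \<le> \<beta>1 / 2 * h - b * q + \<beta>2 / 4 * (4 * p\<^sup>2 + h\<^sup>2 + 2 * m * h + 4 * p * h)"
      by linarith
    show "0 \<le> (\<beta>1 - a) / 2 * h + (\<beta>2 - c) / 4 * ((2 * p + h)\<^sup>2 + 2 * n * h)"
      using \<beta> h0 by (intro add_nonneg_nonneg mult_nonneg_nonneg) (auto simp: n_def)
  qed
  finally show ?thesis by simp
qed

text \<open>The terms for (i, j) and (j, i) add up to a square, because the symmetric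
  \<open>f\<close> cancels. In the elastic term \<open>f\<close> is the gradient at the old time and
  \<open>g\<close> the one at the new time, so the midpoint rule does not spoil the sign.\<close>

lemma sum_sym_skew_nonneg:
  fixes f g :: "'n::finite \<Rightarrow> 'n \<Rightarrow> 'v::real_inner"
  assumes "\<And>i j. f i j = f j i"
  shows "(\<Sum>i\<in>UNIV. \<Sum>j\<in>UNIV. (f i j + g i j) \<bullet> (g i j - g j i)) \<ge> 0"
proof -
  let ?h = "\<lambda>i j. (f i j + g i j) \<bullet> (g i j - g j i)"
  have "2 * (\<Sum>i\<in>UNIV. \<Sum>j\<in>UNIV. ?h i j) = (\<Sum>i\<in>UNIV. \<Sum>j\<in>UNIV. ?h i j + ?h j i)"
    by (simp add: sum.distrib) (rule sum.swap)
  also have "\<dots> = (\<Sum>i\<in>UNIV. \<Sum>j\<in>UNIV. (g i j - g j i) \<bullet> (g i j - g j i))"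
  proof (intro sum.cong refl)
    fix i j
    have "?h j i = - ((f i j + g j i) \<bullet> (g i j - g j i))"
      using assms [of j i] by (simp add: inner_diff_right)
    then show "?h i j + ?h j i = (g i j - g j i) \<bullet> (g i j - g j i)"
      by (simp add: inner_add_left inner_diff_left)
  qed
  also have "\<dots> \<ge> 0" by (intro sum_nonneg) auto
  finally show ?thesis by simp
qed

section \<open>Pointwise estimates for the truncation and the divergence\<close>

lemma truncationE:
  fixes \<T> :: "real^'n^'n \<Rightarrow> real^'n^'n"
  assumes "truncation R CT \<T>"
  obtains \<tau> :: "'n \<Rightarrow> 'n \<Rightarrow> real \<Rightarrow> real"
  where "\<And>i j A. \<T> A $ i $ j = \<tau> i j (A $ i $ j)" "\<And>i j. continuous_on UNIV (\<tau> i j)"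
proof -
  obtain \<tau> \<tau>' \<tau>'' :: "'n \<Rightarrow> 'n \<Rightarrow> real \<Rightarrow> real" where \<tau>: "\<forall>i j.
        (\<forall>A. \<T> A $ i $ j = \<tau> i j (A $ i $ j)) \<and>
        (\<forall>s. (\<tau> i j has_real_derivative \<tau>' i j s) (at s)) \<and>
        (\<forall>s. (\<tau>' i j has_real_derivative \<tau>'' i j s) (at s)) \<and>
        continuous_on UNIV (\<tau>'' i j) \<and>
        (\<forall>s. \<bar>\<tau>' i j s\<bar> \<le> CT \<and> \<bar>\<tau>'' i j s\<bar> \<le> CT)"
    using assms unfolding truncation_def by (elim conjE exE)
  show ?thesis
  proof (rule that [of \<tau>])
    show "continuous_on UNIV (\<tau> i j)" for i j
      using \<tau> by (blast intro: continuous_at_imp_continuous_on DERIV_isCont)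
  qed (use \<tau> in blast)
qed

text \<open>A discrete chain rule: entrywise, \<open>P_tilde\<close> times the increment of its
  argument is exactly the increment of \<open>\<T>\<close>. Where two entries coincide both sides
  are zero, whatever the derivative there. Taking the symmetric part and subtracting any multiple
  \<open>r\<close> of the identity changes nothing, as \<open>A - B\<close> is symmetric and
  trace-free.\<close>

lemma P_tilde_contraction:
  fixes A B :: "real^'n^'n"
  assumes tr: "truncation R CT \<T>" and A: "transpose A = A" "trace A = 0"
    and B: "transpose B = B" "trace B = 0"
  shows "(sym_part (hadamard (P_tilde \<T> A B) (outer v w)) - r *\<^sub>R mat 1) \<bullet> (A - B)
     = v \<bullet> ((\<T> A - \<T> B) *v w)"
proof -
  have AB: "transpose (A - B) = A - B" "trace (A - B) = 0"
    using A B by (simp_all add: transpose_diff trace_sub)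
  have half: "sym_part S \<bullet> (A - B) = S \<bullet> (A - B)" for S :: "real^'n^'n"
    using inner_transpose [of S "A - B"] AB by (simp add: sym_part_def inner_add_left)
  obtain \<tau> :: "'n \<Rightarrow> 'n \<Rightarrow> real \<Rightarrow> real" where \<tau>: "\<And>i j A. \<T> A $ i $ j = \<tau> i j (A $ i $ j)"
    using truncationE [OF tr] by metis
  have entry: "P_tilde \<T> A B $ i $ j * (A $ i $ j - B $ i $ j) = \<T> A $ i $ j - \<T> B $ i $ j" for i j
    by (simp add: P_tilde_def \<tau>)
  have "hadamard (P_tilde \<T> A B) (outer v w) \<bullet> (A - B)
      = (\<Sum>i\<in>UNIV. \<Sum>j\<in>UNIV. v $ i * ((\<T> A $ i $ j - \<T> B $ i $ j) * w $ j))"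
    unfolding inner_matrix by (simp add: hadamard_def outer_def entry [symmetric] mult_ac)
  also have "\<dots> = v \<bullet> ((\<T> A - \<T> B) *v w)"
    by (simp add: inner_vec_def matrix_vector_mult_def sum_distrib_left)
  finally show ?thesis
    unfolding inner_diff_left half inner_scaleR_left inner_mat_1 AB by simp
qed

text \<open>There are d^2 entries of size at most R/d; this is the purpose of the factor 1/d in the
  range of the truncation.\<close>

lemma norm_truncation_le:
  fixes \<T> :: "real^'n^'n \<Rightarrow> real^'n^'n"
  assumes "truncation R CT \<T>" "R > 0"
  shows "norm (\<T> A) \<le> R"
proof -
  have "(\<T> A $ i $ j)\<^sup>2 \<le> (R / real CARD('n))\<^sup>2" for i j
  proof -
    have "\<T> A $ i $ j \<in> {- R / real CARD('n) .. R / real CARD('n)}"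
      using assms(1) [unfolded truncation_def, THEN conjunct2, THEN conjunct2] by (elim allE)
    then have "\<bar>\<T> A $ i $ j\<bar> \<le> R / real CARD('n)" by auto
    then show ?thesis using abs_le_square_iff [of "\<T> A $ i $ j" "R / real CARD('n)"] assms(2) by simp
  qed
  then have "(norm (\<T> A))\<^sup>2 \<le> (\<Sum>i::'n\<in>UNIV. \<Sum>j::'n\<in>UNIV. (R / real CARD('n))\<^sup>2)"
    unfolding power2_norm_eq_inner inner_matrix power2_eq_square [symmetric] by (intro sum_mono)
  also have "\<dots> = R\<^sup>2" by (simp add: power2_eq_square)
  finally show ?thesis by (rule power2_le_imp_le) (use assms(2) in simp)
qed

text \<open>Each component of the divergence is a sum of d partial derivatives; Cauchy-Schwarz costs
  the factor d.\<close>

lemma norm_mat_div_le: "(norm (mat_div F x))\<^sup>2 \<le> real CARD('n) * (norm (mat_grad F x))\<^sup>2"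
  for F :: "real^'n \<Rightarrow> real^'n^'n"
proof -
  let ?g = "\<lambda>i j. grad (\<lambda>y. F y $ i $ j) x"
  have "(norm (mat_div F x))\<^sup>2 = (\<Sum>i\<in>UNIV. (\<Sum>j\<in>UNIV. ?g i j $ j)\<^sup>2)"
    unfolding power2_norm_eq_inner by (simp add: inner_vec_def mat_div_def power2_eq_square)
  also have "\<dots> \<le> (\<Sum>i\<in>UNIV. real CARD('n) * (\<Sum>j\<in>UNIV. (norm (?g i j))\<^sup>2))"
  proof (rule sum_mono)
    fix i
    have "(\<Sum>j\<in>UNIV. ?g i j $ j)\<^sup>2 \<le> real CARD('n) * (\<Sum>j\<in>UNIV. (?g i j $ j)\<^sup>2)"
      using sum_squared_le_sum_of_squares [of "\<lambda>j. ?g i j $ j" "UNIV :: 'n set"]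
      by (simp add: mult.commute)
    also have "\<dots> \<le> real CARD('n) * (\<Sum>j\<in>UNIV. (norm (?g i j))\<^sup>2)"
      using component_le_norm_cart
      by (intro mult_left_mono sum_mono) (auto simp: abs_le_square_iff [symmetric])
    finally show "(\<Sum>j\<in>UNIV. ?g i j $ j)\<^sup>2 \<le> real CARD('n) * (\<Sum>j\<in>UNIV. (norm (?g i j))\<^sup>2)" .
  qed
  also have "\<dots> = real CARD('n) * (norm (mat_grad F x))\<^sup>2"
    unfolding power2_norm_eq_inner by (simp add: inner_vec_def mat_grad_def sum_distrib_left)
  finally show ?thesis .
qed

lemma L2_norm_power2: "(L2_norm \<Omega> f)\<^sup>2 = (LINT x:\<Omega>|lebesgue. (norm (f x))\<^sup>2)"
  by (simp add: L2_norm_def set_lebesgue_integral_def)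

section \<open>Continuity of the nonlinearities\<close>

lemma continuous_on_matrix_mult:
  fixes f :: "'a::topological_space \<Rightarrow> real^'n^'m" and g :: "'a \<Rightarrow> real^'k^'n"
  assumes "continuous_on S f" "continuous_on S g"
  shows "continuous_on S (\<lambda>x. f x ** g x)"
  unfolding matrix_matrix_mult_def
  by (intro continuous_on_vec_lambda continuous_on_sum continuous_on_mult continuous_on_component assms)

lemma continuous_on_trace:
  fixes f :: "'a::topological_space \<Rightarrow> real^'n^'n"
  assumes "continuous_on S f"
  shows "continuous_on S (\<lambda>x. trace (f x))"
  unfolding trace_def by (intro continuous_on_sum continuous_on_component assms)

lemma continuous_on_F_B: "continuous_on UNIV (F_B a b c A0 :: real^'n^'n \<Rightarrow> real)"
  unfolding F_B_def
  by (intro continuous_on_add continuous_on_diff continuous_on_mult continuous_on_power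
      continuous_on_const continuous_on_trace continuous_on_matrix_mult continuous_on_id)

lemma continuous_on_truncation:
  assumes "truncation R CT (\<T> :: real^'n^'n \<Rightarrow> real^'n^'n)"
  shows "continuous_on UNIV \<T>"
proof -
  obtain \<tau> :: "'n \<Rightarrow> 'n \<Rightarrow> real \<Rightarrow> real" where \<tau>: "\<And>i j A. \<T> A $ i $ j = \<tau> i j (A $ i $ j)"
    and cont: "\<And>i j. continuous_on UNIV (\<tau> i j)"
    using truncationE [OF assms] by metis
  have "continuous_on UNIV (\<lambda>A. \<chi> i j. \<tau> i j (A $ i $ j))"
    by (intro continuous_on_vec_lambda continuous_on_compose2 [OF cont] continuous_intros) auto
  moreover have "\<T> = (\<lambda>A. \<chi> i j. \<tau> i j (A $ i $ j))"
    by (simp add: fun_eq_iff vec_eq_iff \<tau>)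
  ultimately show ?thesis by simp
qed

lemma transpose_truncation: "truncation R CT \<T> \<Longrightarrow> transpose A = A \<Longrightarrow> transpose (\<T> A) = \<T> A"
  unfolding truncation_def by (drule conjunct2, drule conjunct1, erule allE, erule mp)

lemma continuous_on_transpose:
  fixes f :: "'a::topological_space \<Rightarrow> real^'n^'m"
  assumes "continuous_on S f"
  shows "continuous_on S (\<lambda>x. transpose (f x))"
  unfolding transpose_def
  by (intro continuous_on_vec_lambda continuous_on_component assms)

lemma continuous_on_dF1: "continuous_on UNIV (dF1 b \<beta>1 \<beta>2 :: real^'n^'n \<Rightarrow> real^'n^'n)"
  unfolding dF1_def Let_def
  by (intro continuous_on_add continuous_on_diff continuous_on_scaleR continuous_on_mult
      continuous_on_power continuous_on_const continuous_on_trace continuous_on_matrix_mult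
      continuous_on_transpose continuous_on_norm continuous_on_id)

lemma continuous_on_dF2: "continuous_on UNIV (dF2 a c \<beta>1 \<beta>2 :: real^'n^'n \<Rightarrow> real^'n^'n)"
  unfolding dF2_def
  by (intro continuous_on_add continuous_on_scaleR continuous_on_mult
      continuous_on_power continuous_on_const continuous_on_norm continuous_on_id)

section \<open>Discrete Gronwall argument\<close>

text \<open>The sum on the right stops before \<open>n\<close>, so \<open>k\<close> may be any
  nonnegative number. The bound is iterated for the partial sums instead of \<open>y\<close> itself:
  this leaves the last value \<open>A N\<close> outside the exponential, as required for the
  boundary data at the final time.\<close>

lemma discrete_gronwall:
  fixes y A :: "nat \<Rightarrow> real"
  assumes k: "k \<ge> 0" and A: "\<And>n. n \<le> N \<Longrightarrow> A n \<ge> 0"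
    and y: "\<And>n. n \<le> N \<Longrightarrow> y n \<le> A n + k * (\<Sum>i<n. y i)"
  shows "y N \<le> A N + k * exp (k * real N) * (\<Sum>i<N. A i)"
proof -
  have "(\<Sum>i<n. y i) \<le> (1 + k) ^ n * (\<Sum>i<n. A i)" if "n \<le> N" for n
    using that
  proof (induction n)
    case (Suc n)
    have "(\<Sum>i<Suc n. y i) \<le> (1 + k) * (\<Sum>i<n. y i) + A n"
      using y [of n] Suc.prems by (simp add: algebra_simps)
    also have "\<dots> \<le> (1 + k) * ((1 + k) ^ n * (\<Sum>i<n. A i)) + (1 + k) ^ Suc n * A n"
      using Suc k A [of n] one_le_power [of "1 + k" "Suc n"]
        mult_right_mono [of 1 "(1 + k) ^ Suc n" "A n"]
      by (intro add_mono mult_left_mono) auto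
    finally show ?case by (simp add: algebra_simps)
  qed simp
  then have "k * (\<Sum>i<N. y i) \<le> k * ((1 + k) ^ N * (\<Sum>i<N. A i))"
    using k by (intro mult_left_mono) auto
  also have "\<dots> \<le> k * (exp (k * real N) * (\<Sum>i<N. A i))"
  proof (intro mult_left_mono mult_right_mono)
    have "(1 + k) ^ N \<le> exp k ^ N"
      using k exp_ge_add_one_self [of k] by (intro power_mono) auto
    then show "(1 + k) ^ N \<le> exp (k * real N)"
      by (simp add: exp_of_nat_mult mult.commute [of k])
  qed (use k A in \<open>auto intro!: sum_nonneg\<close>)
  finally show ?thesis
    using y [of N] by (simp add: mult.assoc)
qed

text \<open>The energy argument reduced to real sequences, with \<open>C\<close> chosen before the
  step size, \<open>N\<close> and the sequences, hence independent of the mesh. Here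
  \<open>F\<close> stands for the bulk energy, \<open>k\<close> and \<open>p\<close> for the squared
  norms of the gradients of Q and u, \<open>E\<close> for the dielectric energy, \<open>j\<close>
  and \<open>r\<close> for the pairings of the flux with the boundary data and with their time
  difference, \<gamma> and \<open>s\<close> for the squared norms of these two. The parameter \<eta>
  of Young's inequality is left free and fixed inside.\<close>

lemma discrete_energy_bound:
  fixes L lam Lam B dmax :: real
  assumes pos: "L > 0" "lam > 0" "Lam > 0" "B > 0" "dmax > 0"
  shows "\<exists>C>0. \<forall>dt N F k p E j r (\<gamma> :: nat \<Rightarrow> real) s.
    0 < dt \<longrightarrow> dt \<le> dmax \<longrightarrow>
    (\<forall>n\<le>N. F n \<ge> 0 \<and> k n \<ge> 0 \<and> p n \<ge> 0 \<and> \<gamma> n \<ge> 0 \<and> s n \<ge> 0 \<and>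
       lam * p n \<le> E n \<and> E n \<le> Lam * p n) \<longrightarrow>
    (\<forall>n\<le>N. \<forall>\<eta>>0. \<bar>j n\<bar> \<le> \<eta> * (k n + p n) + B / \<eta> * \<gamma> n) \<longrightarrow>
    (\<forall>n<N. \<forall>\<eta>>0. \<bar>r n\<bar> \<le> \<eta> * (k n + p n + (k (Suc n) + p (Suc n))) + B / \<eta> * s n) \<longrightarrow>
    (\<forall>n<N. F (Suc n) + L / 2 * k (Suc n) + E (Suc n) / 2 - (F n + L / 2 * k n + E n / 2)
       \<le> j (Suc n) - j n - dt * r n) \<longrightarrow>
    F N + L / 4 * k N + lam / 4 * p N
      \<le> C * (1 + real N * dt * exp (C * (real N * dt))) * (k 0 + F 0 + p 0 + \<gamma> 0)
        + C * (1 + real N * dt * exp (C * (real N * dt))) * dt * (\<Sum>n<N. s n)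
        + C * \<gamma> N + C * exp (C * (real N * dt)) * dt * (\<Sum>n<N. \<gamma> n)"
proof -
  define \<mu> where "\<mu> = min L lam / 2"
  have \<mu>: "\<mu> > 0" using pos by (simp add: \<mu>_def)
  \<comment> \<open>With this value \<open>dt * \<theta> \<le> 1 / 4\<close>, so the share of the
    last time level in the sum of the \<open>r i\<close> can be absorbed on the left. The upper
    bound on the step size is used only for this.\<close>
  define \<theta> where "\<theta> = 1 / (4 * dmax)"
  have \<theta>: "\<theta> > 0" using pos by (simp add: \<theta>_def)
  define c1 c2 where "c1 = B / (\<mu> / 4)" and "c2 = B / (\<theta> * \<mu>)"
  have c12: "c1 > 0" "c2 > 0" using pos \<mu> \<theta> by (simp_all add: c1_def c2_def)
  define \<kappa> where "\<kappa> = 4 * \<theta>"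
  have \<kappa>: "\<kappa> > 0" using \<theta> by (simp add: \<kappa>_def)
  \<comment> \<open>\<open>C1\<close> dominates every coefficient of the data in the inequality to
    which Gronwall is applied, and \<open>C\<close> also covers the Gronwall rate \<kappa> and its
    product with \<open>C1\<close>.\<close>
  define C1 where "C1 = 1 + L + Lam + \<mu> + c1 + c2"
  have C1: "C1 > 0" using pos \<mu> c12 by (simp add: C1_def)
  define C where "C = C1 + \<kappa> * C1 + \<kappa>"
  have C: "C > 0" "C1 \<le> C" "\<kappa> * C1 \<le> C" "\<kappa> \<le> C"
    using C1 \<kappa> by (simp_all add: C_def add_pos_pos)
  show ?thesis
  proof (intro exI [of _ C] conjI allI impI)
    show "C > 0" by (rule C)
    fix dt :: real and N :: nat and F k p E j r \<gamma> s :: "nat \<Rightarrow> real"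
    assume dt: "0 < dt" "dt \<le> dmax"
      and nn: "\<forall>n\<le>N. F n \<ge> 0 \<and> k n \<ge> 0 \<and> p n \<ge> 0 \<and> \<gamma> n \<ge> 0 \<and> s n \<ge> 0 \<and>
          lam * p n \<le> E n \<and> E n \<le> Lam * p n"
      and j: "\<forall>n\<le>N. \<forall>\<eta>>0. \<bar>j n\<bar> \<le> \<eta> * (k n + p n) + B / \<eta> * \<gamma> n"
      and r: "\<forall>n<N. \<forall>\<eta>>0. \<bar>r n\<bar> \<le> \<eta> * (k n + p n + (k (Suc n) + p (Suc n))) + B / \<eta> * s n"
      and step: "\<forall>n<N. F (Suc n) + L / 2 * k (Suc n) + E (Suc n) / 2 - (F n + L / 2 * k n + E n / 2)
       \<le> j (Suc n) - j n - dt * r n"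
    define w where "w n = L / 2 * k n + lam / 2 * p n" for n
    define X where "X n = F n + L / 2 * k n + E n / 2" for n
    \<comment> \<open>Half of \<open>w\<close> is what remains on the left: one quarter pays for the
      pairing \<open>j n\<close>, another for the last level in the sum of the \<open>r i\<close>.
      This is the origin of the coefficients L/4 and \<open>lam / 4\<close>.\<close>
    define y where "y n = F n + w n / 2" for n
    define S where "S = dt * (\<Sum>n<N. s n)"
    have S: "S \<ge> 0" using nn dt by (auto simp: S_def intro!: sum_nonneg mult_nonneg_nonneg)
    have w: "\<mu> * (k n + p n) \<le> w n" "w n \<ge> 0" if "n \<le> N" for n
    proof -
      have "\<mu> * k n \<le> L / 2 * k n" "\<mu> * p n \<le> lam / 2 * p n"
        using nn that by (intro mult_right_mono; simp add: \<mu>_def)+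
      then show "\<mu> * (k n + p n) \<le> w n" by (simp add: w_def algebra_simps)
      show "w n \<ge> 0" using nn that pos by (simp add: w_def)
    qed
    have jw: "\<bar>j n\<bar> \<le> w n / 4 + c1 * \<gamma> n" if "n \<le> N" for n
      using j [rule_format, OF that, of "\<mu> / 4"] \<mu> w [OF that] by (simp add: c1_def)
    have rw: "\<bar>r n\<bar> \<le> \<theta> * (w n + w (Suc n)) + c2 * s n" if "n < N" for n
    proof -
      have "\<bar>r n\<bar> \<le> \<theta> * \<mu> * (k n + p n + (k (Suc n) + p (Suc n))) + c2 * s n"
        using r [rule_format, OF that, of "\<theta> * \<mu>"] \<mu> \<theta> by (simp add: c2_def)
      also have "\<theta> * \<mu> * (k n + p n + (k (Suc n) + p (Suc n)))
          = \<theta> * (\<mu> * (k n + p n) + \<mu> * (k (Suc n) + p (Suc n)))"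
        by (simp add: algebra_simps)
      also have "\<dots> \<le> \<theta> * (w n + w (Suc n))"
        using w(1) [of n] w(1) [of "Suc n"] \<theta> that by (intro mult_left_mono add_mono) auto
      finally show ?thesis by simp
    qed
    have tele: "X n \<le> X 0 + j n - j 0 - dt * (\<Sum>i<n. r i)" if "n \<le> N" for n
      using that
    proof (induction n)
      case (Suc n)
      then show ?case
        using step [rule_format, of n] by (simp add: X_def algebra_simps)
    qed simp
    \<comment> \<open>Every intermediate \<open>w i\<close> belongs to two adjacent steps, whereas
      \<open>w 0\<close> and \<open>w n\<close> belong to one. Only the single occurrence of
      \<open>w n\<close> has to be absorbed; the earlier ones go into the Gronwall sum.\<close>
    have rsum: "\<bar>dt * (\<Sum>i<n. r i)\<bar> \<le> w n / 4 + 2 * \<theta> * dt * (\<Sum>i<n. w i) + c2 * S" if "n \<le> N" for n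
    proof -
      have "\<bar>\<Sum>i<n. r i\<bar> \<le> (\<Sum>i<n. \<theta> * (w i + w (Suc i)) + c2 * s i)"
        using rw that by (intro order_trans [OF sum_abs] sum_mono) auto
      also have "\<dots> = \<theta> * (2 * (\<Sum>i<n. w i) + w n - w 0) + c2 * (\<Sum>i<n. s i)"
      proof -
        have "(\<Sum>i<n. w (Suc i)) = (\<Sum>i<n. w i) + w n - w 0"
          by (induction n) auto
        then show ?thesis
          by (simp add: sum.distrib sum_distrib_left [symmetric])
      qed
      also have "\<dots> \<le> \<theta> * (2 * (\<Sum>i<n. w i) + w n) + c2 * (\<Sum>i<N. s i)"
        using w(2) [of 0] \<theta> c12 nn that
        by (intro add_mono mult_left_mono sum_mono2) auto
      finally have "dt * \<bar>\<Sum>i<n. r i\<bar> \<le> dt * (\<theta> * (2 * (\<Sum>i<n. w i) + w n) + c2 * (\<Sum>i<N. s i))"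
        using dt by (intro mult_left_mono) auto
      also have "\<dots> = 2 * \<theta> * dt * (\<Sum>i<n. w i) + dt * \<theta> * w n + c2 * S"
        by (simp add: S_def algebra_simps)
      also have "dt * \<theta> * w n \<le> 1 / 4 * w n"
        using dt pos w(2) [OF that] by (intro mult_right_mono) (auto simp: \<theta>_def field_simps)
      finally show ?thesis using dt by (simp add: abs_mult)
    qed
    \<comment> \<open>\<open>S\<close> is the sum over all steps up to \<open>N\<close>, so that
      \<open>A n\<close> varies with \<open>n\<close> through \<gamma> alone and can be summed
      explicitly.\<close>
    define A where "A n = C1 * (k 0 + F 0 + p 0 + \<gamma> 0 + S) + C1 * \<gamma> n" for n
    have y: "y n \<le> A n + \<kappa> * dt * (\<Sum>i<n. y i)" if n: "n \<le> N" for n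
    proof -
      have "F n + w n \<le> X n"
        using nn n by (auto simp: X_def w_def)
      then have "y n \<le> X 0 + \<bar>j 0\<bar> + c1 * \<gamma> n + 2 * \<theta> * dt * (\<Sum>i<n. w i) + c2 * S"
        using tele [OF n] jw [OF n] rsum [OF n] unfolding y_def by linarith
      also have "X 0 \<le> F 0 + L * k 0 + Lam * p 0"
      proof -
        have "L / 2 * k 0 \<le> L * k 0" "E 0 / 2 \<le> Lam * p 0"
          using nn pos by (auto intro: order_trans)
        then show ?thesis by (simp add: X_def)
      qed
      also have "\<bar>j 0\<bar> \<le> \<mu> * (k 0 + p 0) + c1 * \<gamma> 0"
      proof -
        have "\<mu> / 4 * (k 0 + p 0) \<le> \<mu> * (k 0 + p 0)"
          using nn \<mu> by (intro mult_right_mono) auto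
        moreover have "\<bar>j 0\<bar> \<le> \<mu> / 4 * (k 0 + p 0) + c1 * \<gamma> 0"
          unfolding c1_def using \<mu> by (intro j [rule_format]) auto
        ultimately show ?thesis by linarith
      qed
      also have "2 * \<theta> * dt * (\<Sum>i<n. w i) \<le> \<kappa> * dt * (\<Sum>i<n. y i)"
      proof -
        have "(\<Sum>i<n. w i) \<le> (\<Sum>i<n. 2 * y i)"
          using nn n by (intro sum_mono) (auto simp: y_def)
        then have "2 * \<theta> * dt * (\<Sum>i<n. w i) \<le> 2 * \<theta> * dt * (\<Sum>i<n. 2 * y i)"
          using \<theta> dt by (intro mult_left_mono) auto
        then show ?thesis by (simp add: \<kappa>_def sum_distrib_left [symmetric])
      qed
      finally have "y n \<le> F 0 + (L + \<mu>) * k 0 + (Lam + \<mu>) * p 0 + c1 * \<gamma> 0 + c2 * S + c1 * \<gamma> n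
          + \<kappa> * dt * (\<Sum>i<n. y i)"
        by (simp add: algebra_simps)
      also have "F 0 + (L + \<mu>) * k 0 + (Lam + \<mu>) * p 0 + c1 * \<gamma> 0 + c2 * S + c1 * \<gamma> n \<le> A n"
      proof -
        have "1 * F 0 \<le> C1 * F 0" "(L + \<mu>) * k 0 \<le> C1 * k 0" "(Lam + \<mu>) * p 0 \<le> C1 * p 0"
          "c1 * \<gamma> 0 \<le> C1 * \<gamma> 0" "c2 * S \<le> C1 * S" "c1 * \<gamma> n \<le> C1 * \<gamma> n"
          using nn n pos \<mu> c12 S by (intro mult_right_mono; simp add: C1_def)+
        then show ?thesis unfolding A_def distrib_left by linarith
      qed
      finally show ?thesis by simp
    qed
    have A: "A n \<ge> 0" if "n \<le> N" for n
      using nn that C1 S by (simp add: A_def)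
    define t where "t = real N * dt"
    have t: "t \<ge> 0" using dt by (simp add: t_def)
    define M where "M = k 0 + F 0 + p 0 + \<gamma> 0 + S"
    have M: "M \<ge> 0" using nn S by (simp add: M_def)
    have \<gamma>sum: "(\<Sum>i<N. \<gamma> i) \<ge> 0" using nn by (intro sum_nonneg) auto
    have "y N \<le> A N + \<kappa> * dt * exp (\<kappa> * dt * real N) * (\<Sum>i<N. A i)"
      using \<kappa> dt by (intro discrete_gronwall A y) auto
    \<comment> \<open>Summing the constant part of \<open>A\<close> over \<open>N\<close> steps
      turns \<open>dt\<close> into t = N dt, which gives the factor t exp(C t); the \<gamma> part
      stays a time-weighted sum.\<close>
    also have "\<dots> = C1 * M + C1 * \<gamma> N + (\<kappa> * C1) * (t * exp (\<kappa> * t)) * M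
        + (\<kappa> * C1) * exp (\<kappa> * t) * dt * (\<Sum>i<N. \<gamma> i)"
    proof -
      have "A n = C1 * M + C1 * \<gamma> n" for n
        by (simp add: A_def M_def)
      then show ?thesis
        by (simp add: t_def sum.distrib sum_distrib_left [symmetric] algebra_simps)
    qed
    also have "\<dots> \<le> C * M + C * \<gamma> N + C * (t * exp (C * t)) * M
        + C * exp (C * t) * dt * (\<Sum>i<N. \<gamma> i)"
    proof -
      have e: "exp (\<kappa> * t) \<le> exp (C * t)" "0 \<le> exp (\<kappa> * t)"
        using C(4) t by (auto intro: mult_right_mono)
      have "C1 * M \<le> C * M" "C1 * \<gamma> N \<le> C * \<gamma> N"
        using C(2) M nn by (auto intro: mult_right_mono)
      moreover have "(\<kappa> * C1) * (t * exp (\<kappa> * t)) * M \<le> C * (t * exp (C * t)) * M"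
        using C(1,3) e t M \<kappa> C1
        by (intro mult_right_mono [OF _ M] mult_mono mult_left_mono) auto
      moreover have "(\<kappa> * C1) * exp (\<kappa> * t) * (dt * (\<Sum>i<N. \<gamma> i))
          \<le> C * exp (C * t) * (dt * (\<Sum>i<N. \<gamma> i))"
        using C(1,3) e dt \<kappa> C1 \<gamma>sum
        by (intro mult_right_mono [of "(\<kappa> * C1) * exp (\<kappa> * t)"] mult_mono [of "\<kappa> * C1"]) auto
      ultimately show ?thesis by (simp add: mult.assoc)
    qed
    also have "\<dots> = C * (1 + t * exp (C * t)) * (k 0 + F 0 + p 0 + \<gamma> 0)
        + C * (1 + t * exp (C * t)) * dt * (\<Sum>n<N. s n)
        + C * \<gamma> N + C * exp (C * t) * dt * (\<Sum>n<N. \<gamma> n)"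
      unfolding M_def S_def by (simp add: algebra_simps)
    finally have "y N \<le> C * (1 + t * exp (C * t)) * (k 0 + F 0 + p 0 + \<gamma> 0)
        + C * (1 + t * exp (C * t)) * dt * (\<Sum>n<N. s n)
        + C * \<gamma> N + C * exp (C * t) * dt * (\<Sum>n<N. \<gamma> n)" .
    moreover have "y N = F N + L / 4 * k N + lam / 4 * p N"
      by (simp add: y_def w_def)
    ultimately show "F N + L / 4 * k N + lam / 4 * p N
      \<le> C * (1 + real N * dt * exp (C * (real N * dt))) * (k 0 + F 0 + p 0 + \<gamma> 0)
        + C * (1 + real N * dt * exp (C * (real N * dt))) * dt * (\<Sum>n<N. s n)
        + C * \<gamma> N + C * exp (C * (real N * dt)) * dt * (\<Sum>n<N. \<gamma> n)"
      unfolding t_def by simp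
  qed
qed

section \<open>Piecewise continuous functions on a mesh\<close>

text \<open>If one of the functions is not integrable, neither is the other, and both integrals are
  0 by convention. Integrands can thus be rewritten off a null set without checking
  integrability.\<close>

lemma set_lebesgue_integral_spike:
  fixes f g :: "'a::euclidean_space \<Rightarrow> 'b::euclidean_space"
  assumes "negligible N" "\<And>x. x \<in> A - N \<Longrightarrow> f x = g x"
  shows "(LINT x:A|lebesgue. f x) = (LINT x:A|lebesgue. g x)"
proof (cases "f absolutely_integrable_on A")
  case True
  then have "g absolutely_integrable_on A"
    using absolutely_integrable_spike_eq [of N A g f] assms by auto
  with True show ?thesis
    using integral_spike [of N A g f] assms by (simp add: set_lebesgue_integral_eq_integral)
next
  case False
  then have "\<not> g absolutely_integrable_on A"
    using absolutely_integrable_spike_eq [of N A g f] assms by auto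
  with False show ?thesis
    by (simp add: set_integrable_def set_lebesgue_integral_def not_integrable_integral_eq)
qed

lemma absolutely_integrable_continuous_bounded:
  fixes f :: "'a::euclidean_space \<Rightarrow> 'b::euclidean_space"
  assumes "continuous_on UNIV f" "bounded A" "A \<in> sets lebesgue"
  shows "f absolutely_integrable_on A"
proof -
  obtain l r where "A \<subseteq> cbox l r"
    using bounded_subset_cbox_symmetric [OF assms(2)] by blast
  moreover have "f absolutely_integrable_on cbox l r"
    using assms(1) by (intro absolutely_integrable_continuous) (rule continuous_on_subset, auto)
  ultimately show ?thesis
    using assms(3) by (metis set_integrable_subset)
qed

locale mesh =
  fixes \<Omega> :: "(real^'n) set" and Th :: "(real^'n) set set"
  assumes open_domain: "open \<Omega>" and bounded_domain: "bounded \<Omega>" and mesh: "mesh_of \<Omega> Th"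
begin

text \<open>An open set that exhausts \<Omega> up to a null set and each of whose points is interior
  to an element: the place where classical gradients of finite element functions may be
  computed.\<close>

definition regular :: "(real^'n) set" where
  "regular = \<Omega> - (\<Union>K\<in>Th. frontier K)"

text \<open>The continuous representative is required on the whole space, not just on the open
  element. This makes it bounded there, hence integrable, and keeps the class closed under
  composition with arbitrary continuous maps; values on element boundaries are left open.\<close>

definition piecewise :: "(real^'n \<Rightarrow> 'b::topological_space) \<Rightarrow> bool" where
  "piecewise f \<longleftrightarrow> (\<forall>K\<in>Th. \<exists>g. continuous_on UNIV g \<and> (\<forall>x\<in>interior K. f x = g x))"

text \<open>A common superset of \<open>P1\<close> and \<open>Y_h\<close>, so that data, test
  functions and solutions share one calculus of gradients.\<close>

definition pw_affine :: "(real^'n \<Rightarrow> real) set" where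
  "pw_affine = {f. \<forall>K\<in>Th. affine_fun_on K f}"

lemma finite_mesh: "finite Th"
  using mesh by (simp add: mesh_of_def triangulation_def)

lemma convex_element: "K \<in> Th \<Longrightarrow> convex K"
  using mesh by (auto simp: mesh_of_def intro: convex_simplex)

lemma open_regular: "open regular"
  unfolding regular_def using finite_mesh open_domain
  by (intro open_Diff closed_UN) (auto simp: frontier_closed)

lemma regular_subset: "regular \<subseteq> \<Omega>"
  by (auto simp: regular_def)

lemma regularE:
  assumes "x \<in> regular"
  obtains K where "K \<in> Th" "x \<in> interior K"
proof -
  have "x \<in> \<Union>Th"
    using assms mesh closure_subset by (auto simp: regular_def mesh_of_def)
  then obtain K where K: "K \<in> Th" "x \<in> K" by blast
  moreover have "x \<notin> frontier K"
    using assms K by (auto simp: regular_def)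
  ultimately have "x \<in> interior K"
    using closure_subset by (auto simp: frontier_def)
  with K that show ?thesis by blast
qed

lemma negligible_skeleton: "negligible (\<Union>K\<in>Th. frontier K)"
  using finite_mesh by (intro negligible_Union) (auto simp: negligible_convex_frontier convex_element)

lemma AE_regular: "AE x in lebesgue. x \<in> \<Omega> \<longrightarrow> x \<in> regular"
  using negligible_skeleton negligible_iff_null_sets
  by (intro AE_I' [of "\<Union>K\<in>Th. frontier K"]) (auto simp: regular_def)

lemma integral_cong_regular:
  fixes f g :: "real^'n \<Rightarrow> 'b::euclidean_space"
  assumes "\<And>x. x \<in> regular \<Longrightarrow> f x = g x"
  shows "(LINT x:\<Omega>|lebesgue. f x) = (LINT x:\<Omega>|lebesgue. g x)"
  using assms by (intro set_lebesgue_integral_spike [OF negligible_skeleton]) (auto simp: regular_def)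

text \<open>The integrand is replaced by 0 off \<open>regular\<close>; the integral of a nonnegative
  function is nonnegative even without integrability, by the convention for the latter case.\<close>

lemma integral_nonneg_regular:
  fixes f :: "real^'n \<Rightarrow> real"
  assumes "\<And>x. x \<in> regular \<Longrightarrow> f x \<ge> 0"
  shows "(LINT x:\<Omega>|lebesgue. f x) \<ge> 0"
proof -
  have "(LINT x:\<Omega>|lebesgue. f x) = (LINT x:\<Omega>|lebesgue. if x \<in> regular then f x else 0)"
    by (rule integral_cong_regular) simp
  also have "\<dots> \<ge> 0"
    unfolding set_lebesgue_integral_def using assms
    by (intro Bochner_Integration.integral_nonneg) (auto simp: indicator_def)
  finally show ?thesis .
qed

lemma integral_zero_regular:
  fixes f :: "real^'n \<Rightarrow> real"
  assumes "\<And>x. x \<in> regular \<Longrightarrow> f x = 0"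
  shows "(LINT x:\<Omega>|lebesgue. f x) = 0"
  using integral_cong_regular [of f "\<lambda>_. 0"] assms by simp

lemma piecewise_compose:
  assumes "piecewise f" "continuous_on UNIV h"
  shows "piecewise (\<lambda>x. h (f x))"
  unfolding piecewise_def
proof
  fix K assume "K \<in> Th"
  with assms(1) obtain g where "continuous_on UNIV g" "\<forall>x\<in>interior K. f x = g x"
    by (auto simp: piecewise_def)
  with assms(2) show "\<exists>g. continuous_on UNIV g \<and> (\<forall>x\<in>interior K. h (f x) = g x)"
    by (intro exI [of _ "\<lambda>x. h (g x)"]) (auto intro: continuous_on_compose2)
qed

lemma piecewise_Pair:
  assumes "piecewise f" "piecewise g"
  shows "piecewise (\<lambda>x. (f x, g x))"
  unfolding piecewise_def
proof
  fix K assume "K \<in> Th"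
  with assms obtain f' g' where "continuous_on UNIV f'" "\<forall>x\<in>interior K. f x = f' x"
    "continuous_on UNIV g'" "\<forall>x\<in>interior K. g x = g' x"
    unfolding piecewise_def by metis
  then show "\<exists>h. continuous_on UNIV h \<and> (\<forall>x\<in>interior K. (f x, g x) = h x)"
    by (intro exI [of _ "\<lambda>x. (f' x, g' x)"]) (auto intro!: continuous_intros)
qed

lemma piecewise_compose2:
  assumes "piecewise f" "piecewise g" "continuous_on UNIV (\<lambda>z. h (fst z) (snd z))"
  shows "piecewise (\<lambda>x. h (f x) (g x))"
  using piecewise_compose [OF piecewise_Pair [OF assms(1,2)] assms(3)] by simp

lemma piecewise_const: "piecewise (\<lambda>x. c)"
  unfolding piecewise_def by (auto intro!: exI [of _ "\<lambda>x. c"])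

lemma piecewise_vec:
  assumes "\<And>i. piecewise (\<lambda>x. f x $ i)"
  shows "piecewise f"
  unfolding piecewise_def
proof
  fix K assume "K \<in> Th"
  with assms have "\<forall>i. \<exists>g. continuous_on UNIV g \<and> (\<forall>x\<in>interior K. f x $ i = g x)"
    by (simp add: piecewise_def)
  then obtain g where "\<And>i. continuous_on UNIV (g i)" "\<And>i. \<forall>x\<in>interior K. f x $ i = g i x"
    by metis
  then show "\<exists>h. continuous_on UNIV h \<and> (\<forall>x\<in>interior K. f x = h x)"
    by (intro exI [of _ "\<lambda>x. \<chi> i. g i x"]) (auto simp: vec_eq_iff intro: continuous_on_vec_lambda)
qed

lemma piecewise_nth: "piecewise f \<Longrightarrow> piecewise (\<lambda>x. f x $ i)"
  by (rule piecewise_compose [where h = "\<lambda>v. v $ i"]) (auto intro!: continuous_intros)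

lemma piecewise_sum: "(\<And>i. i \<in> I \<Longrightarrow> piecewise (f i)) \<Longrightarrow> piecewise (\<lambda>x. \<Sum>i\<in>I. f i x)"
  for f :: "'i \<Rightarrow> real^'n \<Rightarrow> 'b::topological_comm_monoid_add"
proof (induction I rule: infinite_finite_induct)
  case (insert i I)
  then have "piecewise (\<lambda>x. f i x + (\<Sum>i\<in>I. f i x))"
    by (intro piecewise_compose2 [where h = "(+)"]) (auto intro!: continuous_intros)
  with insert show ?case by simp
qed (simp_all add: piecewise_const)

lemma piecewise_add: "piecewise f \<Longrightarrow> piecewise g \<Longrightarrow> piecewise (\<lambda>x. f x + g x)"
  and piecewise_diff: "piecewise f \<Longrightarrow> piecewise g \<Longrightarrow> piecewise (\<lambda>x. f x - g x)"
  and piecewise_scaleR: "piecewise f \<Longrightarrow> piecewise (\<lambda>x. r *\<^sub>R f x)"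
  for f g :: "real^'n \<Rightarrow> 'b::real_normed_vector"
  subgoal by (rule piecewise_compose2 [where h = "(+)"]) (auto intro!: continuous_intros)
  subgoal by (rule piecewise_compose2 [where h = "(-)"]) (auto intro!: continuous_intros)
  subgoal by (rule piecewise_compose [where h = "\<lambda>v. r *\<^sub>R v"]) (auto intro!: continuous_intros)
  done

lemma piecewise_inner: "piecewise f \<Longrightarrow> piecewise g \<Longrightarrow> piecewise (\<lambda>x. f x \<bullet> g x)"
  for f g :: "real^'n \<Rightarrow> 'b::real_inner"
  by (rule piecewise_compose2 [where h = "(\<bullet>)"]) (auto intro!: continuous_intros)

lemma piecewise_mult: "piecewise f \<Longrightarrow> piecewise g \<Longrightarrow> piecewise (\<lambda>x. f x * g x)"
  for f g :: "real^'n \<Rightarrow> real"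
  by (rule piecewise_compose2 [where h = "(*)"]) (auto intro!: continuous_intros)

lemma piecewise_norm_power2: "piecewise f \<Longrightarrow> piecewise (\<lambda>x. (norm (f x))\<^sup>2)"
  for f :: "real^'n \<Rightarrow> 'b::real_normed_vector"
  by (rule piecewise_compose [where h = "\<lambda>v. (norm v)\<^sup>2"]) (auto intro!: continuous_intros)

lemma piecewise_integrable:
  fixes f :: "real^'n \<Rightarrow> 'b::euclidean_space"
  assumes "piecewise f"
  shows "set_integrable lebesgue \<Omega> f"
proof -
  have "set_integrable lebesgue (\<Omega> \<inter> interior K) f" if K: "K \<in> Th" for K
  proof -
    obtain g where g: "continuous_on UNIV g" "\<forall>x\<in>interior K. f x = g x"
      using assms K by (auto simp: piecewise_def)
    have "set_integrable lebesgue (\<Omega> \<inter> interior K) g"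
      using g(1) bounded_domain open_domain by (intro absolutely_integrable_continuous_bounded) auto
    then show ?thesis
        by (rule set_integrable_cong [THEN iffD2, rotated -1]) (use g(2) in auto)
  qed
  then have "set_integrable lebesgue (\<Union>K\<in>Th. \<Omega> \<inter> interior K) f"
    using finite_mesh open_domain by (intro set_integrable_UN) auto
  moreover have "negligible {x \<in> \<Omega> - (\<Union>K\<in>Th. \<Omega> \<inter> interior K). f x \<noteq> 0}"
  proof (rule negligible_subset [OF negligible_skeleton], rule subsetI)
    fix x assume "x \<in> {x \<in> \<Omega> - (\<Union>K\<in>Th. \<Omega> \<inter> interior K). f x \<noteq> 0}"
    then have "x \<in> \<Omega>" "\<forall>K\<in>Th. x \<notin> interior K" by auto
    then have "x \<notin> regular" by (meson regularE)
    with \<open>x \<in> \<Omega>\<close> show "x \<in> (\<Union>K\<in>Th. frontier K)" by (simp add: regular_def)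
  qed
  moreover have "negligible {x \<in> (\<Union>K\<in>Th. \<Omega> \<inter> interior K) - \<Omega>. f x \<noteq> 0}"
    by (rule negligible_subset [OF negligible_empty]) auto
  ultimately show ?thesis
    using absolutely_integrable_spike_set_eq by blast
qed

lemma piecewise_integral_add:
  fixes f g :: "real^'n \<Rightarrow> real"
  assumes "piecewise f" "piecewise g"
  shows "(LINT x:\<Omega>|lebesgue. f x + g x) = (LINT x:\<Omega>|lebesgue. f x) + (LINT x:\<Omega>|lebesgue. g x)"
    and "(LINT x:\<Omega>|lebesgue. f x - g x) = (LINT x:\<Omega>|lebesgue. f x) - (LINT x:\<Omega>|lebesgue. g x)"
  using assms by (auto intro: set_integral_add set_integral_diff piecewise_integrable)

lemma integral_mono_regular:
  fixes f g :: "real^'n \<Rightarrow> real"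
  assumes "piecewise f" "piecewise g" "\<And>x. x \<in> regular \<Longrightarrow> f x \<le> g x"
  shows "(LINT x:\<Omega>|lebesgue. f x) \<le> (LINT x:\<Omega>|lebesgue. g x)"
  using integral_nonneg_regular [of "\<lambda>x. g x - f x"] assms
  by (simp add: piecewise_integral_add)

text \<open>A zero integral gives vanishing almost everywhere. If the function were nonzero at a
  regular point, continuity would make it nonzero on an open neighbourhood, and nonempty open sets
  are not negligible. Vanishing at every regular point is what permits differentiation
  afterwards.\<close>

lemma piecewise_eq_zero:
  fixes f :: "real^'n \<Rightarrow> real"
  assumes f: "piecewise f" "\<And>x. x \<in> regular \<Longrightarrow> f x \<ge> 0" and "(LINT x:\<Omega>|lebesgue. f x) = 0"
    and x: "x \<in> regular"
  shows "f x = 0"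
proof (rule ccontr)
  assume "f x \<noteq> 0"
  obtain K where K: "K \<in> Th" "x \<in> interior K"
    using regularE [OF x] by blast
  obtain g where g: "continuous_on UNIV g" "\<forall>x\<in>interior K. f x = g x"
    using f K by (auto simp: piecewise_def)
  define U where "U = g -` (- {0}) \<inter> interior K \<inter> regular"
  have "open U"
    unfolding U_def using g(1) open_regular
    by (intro open_Int) (auto intro!: open_vimage simp: continuous_on_eq_continuous_at)
  moreover have "x \<in> U"
    using \<open>f x \<noteq> 0\<close> g(2) K x by (auto simp: U_def)
  moreover have "negligible U"
  proof -
    have "AE x in lebesgue. indicator \<Omega> x *\<^sub>R f x = 0"
    proof (subst integral_nonneg_eq_0_iff_AE [symmetric])
      show "integrable lebesgue (\<lambda>x. indicator \<Omega> x *\<^sub>R f x)"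
        using piecewise_integrable [OF f(1)] by (simp add: set_integrable_def)
      show "AE x in lebesgue. 0 \<le> indicator \<Omega> x *\<^sub>R f x"
        using AE_regular by eventually_elim (use f(2) in \<open>auto simp: indicator_def\<close>)
    qed (use assms(3) in \<open>simp add: set_lebesgue_integral_def\<close>)
    then have "AE x in lebesgue. x \<notin> U"
      by eventually_elim (use g(2) regular_subset in \<open>auto simp: U_def\<close>)
    moreover have "U \<in> sets lebesgue"
      using \<open>open U\<close> by auto
    ultimately have "U \<in> null_sets lebesgue"
      using AE_iff_null_sets by blast
    then show ?thesis
      by (simp add: negligible_iff_null_sets)
  qed
  ultimately show False
    using open_not_negligible by blast
qed

section \<open>Gradients of piecewise affine functions\<close>

lemma pw_affine_lincomb: "f \<in> pw_affine \<Longrightarrow> g \<in> pw_affine \<Longrightarrow> (\<lambda>x. r * f x + s * g x) \<in> pw_affine"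
  unfolding pw_affine_def affine_fun_on_def
proof safe
  fix K assume "K \<in> Th" "\<forall>K\<in>Th. \<exists>p r. \<forall>x\<in>K. f x = p \<bullet> x + r" "\<forall>K\<in>Th. \<exists>p r. \<forall>x\<in>K. g x = p \<bullet> x + r"
  then obtain p c q d where "\<forall>x\<in>K. f x = p \<bullet> x + c" "\<forall>x\<in>K. g x = q \<bullet> x + d" by metis
  then show "\<exists>p' c'. \<forall>x\<in>K. r * f x + s * g x = p' \<bullet> x + c'"
    by (intro exI [of _ "r *\<^sub>R p + s *\<^sub>R q"] exI [of _ "r * c + s * d"])
       (simp add: inner_add_left algebra_simps)
qed

lemma pw_affine_add: "f \<in> pw_affine \<Longrightarrow> g \<in> pw_affine \<Longrightarrow> (\<lambda>x. f x + g x) \<in> pw_affine"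
  and pw_affine_diff: "f \<in> pw_affine \<Longrightarrow> g \<in> pw_affine \<Longrightarrow> (\<lambda>x. f x - g x) \<in> pw_affine"
  using pw_affine_lincomb [of f g 1 1] pw_affine_lincomb [of f g 1 "-1"] by simp_all

lemma pw_affine_zero: "(\<lambda>x. 0) \<in> pw_affine"
  unfolding pw_affine_def affine_fun_on_def by (auto intro!: exI [of _ 0])

lemma pw_affine_sum: "(\<And>i. i \<in> I \<Longrightarrow> f i \<in> pw_affine) \<Longrightarrow> (\<lambda>x. \<Sum>i\<in>I. f i x) \<in> pw_affine"
  by (induction I rule: infinite_finite_induct) (simp_all add: pw_affine_zero pw_affine_add)

lemma grad_eqI:
  assumes "(f has_derivative (\<lambda>h. p \<bullet> h)) (at x)"
  shows "grad f x = p"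
  using frechet_derivative_at [OF assms, symmetric]
  by (simp add: grad_def vec_eq_iff inner_axis)

lemma pw_affine_local:
  assumes "f \<in> pw_affine" "K \<in> Th"
  obtains p r where "\<And>x. x \<in> interior K \<Longrightarrow> f x = p \<bullet> x + r" "\<And>x. x \<in> interior K \<Longrightarrow> grad f x = p"
    "\<And>x. x \<in> interior K \<Longrightarrow> (f has_derivative (\<lambda>h. p \<bullet> h)) (at x)"
proof -
  obtain p r where pr: "\<And>x. x \<in> K \<Longrightarrow> f x = p \<bullet> x + r"
    using assms unfolding pw_affine_def affine_fun_on_def by blast
  have "(f has_derivative (\<lambda>h. p \<bullet> h)) (at x)" if "x \<in> interior K" for x
  proof (rule has_derivative_transform_within_open [of "\<lambda>x. p \<bullet> x + r"])
    show "((\<lambda>x. p \<bullet> x + r) has_derivative (\<bullet>) p) (at x)"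
      by (auto intro!: derivative_eq_intros)
  qed (use that pr interior_subset [of K] in \<open>auto simp: subset_iff\<close>)
  then show ?thesis
    using that pr interior_subset by (blast intro: grad_eqI)
qed

lemma has_derivative_pw_affine:
  assumes "f \<in> pw_affine" "x \<in> regular"
  shows "(f has_derivative (\<lambda>h. grad f x \<bullet> h)) (at x)"
  using assms by (metis pw_affine_local regularE)

lemma piecewise_pw_affine: "f \<in> pw_affine \<Longrightarrow> piecewise f"
  unfolding piecewise_def
proof
  fix K assume "f \<in> pw_affine" "K \<in> Th"
  then obtain p r where "\<And>x. x \<in> interior K \<Longrightarrow> f x = p \<bullet> x + r"
    using pw_affine_local by metis
  then show "\<exists>g. continuous_on UNIV g \<and> (\<forall>x\<in>interior K. f x = g x)"
    by (intro exI [of _ "\<lambda>x. p \<bullet> x + r"]) (auto intro!: continuous_intros)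
qed

lemma piecewise_grad: "f \<in> pw_affine \<Longrightarrow> piecewise (grad f)"
  unfolding piecewise_def by (metis pw_affine_local continuous_on_const)

lemma grad_lincomb:
  assumes "f \<in> pw_affine" "g \<in> pw_affine" "x \<in> regular"
  shows "grad (\<lambda>y. r * f y + s * g y) x = r *\<^sub>R grad f x + s *\<^sub>R grad g x"
  by (rule grad_eqI)
     (auto intro!: derivative_eq_intros has_derivative_pw_affine assms simp: inner_add_left)

lemma grad_add: "f \<in> pw_affine \<Longrightarrow> g \<in> pw_affine \<Longrightarrow> x \<in> regular \<Longrightarrow> grad (\<lambda>y. f y + g y) x = grad f x + grad g x"
  and grad_diff: "f \<in> pw_affine \<Longrightarrow> g \<in> pw_affine \<Longrightarrow> x \<in> regular \<Longrightarrow> grad (\<lambda>y. f y - g y) x = grad f x - grad g x"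
  and grad_mult: "f \<in> pw_affine \<Longrightarrow> x \<in> regular \<Longrightarrow> grad (\<lambda>y. r * f y) x = r *\<^sub>R grad f x"
  using grad_lincomb [of f g x 1 1] grad_lincomb [of f g x 1 "-1"] grad_lincomb [of f f x r 0]
  by simp_all

lemma grad_zero: "grad (\<lambda>y. 0) x = 0"
  by (rule grad_eqI) simp

lemma grad_sum:
  assumes "\<And>i. i \<in> I \<Longrightarrow> f i \<in> pw_affine" "x \<in> regular"
  shows "grad (\<lambda>y. \<Sum>i\<in>I. f i y) x = (\<Sum>i\<in>I. grad (f i) x)"
  using assms
  by (induction I rule: infinite_finite_induct) (simp_all add: grad_zero grad_add pw_affine_sum)

text \<open>As \<open>regular\<close> is open, the two functions agree near \<open>x\<close> and
  have the same derivatives there. This is how pointwise symmetry and zero trace pass to gradients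
  and divergences.\<close>

lemma grad_cong_regular:
  assumes "\<And>y. y \<in> regular \<Longrightarrow> f y = g y" "x \<in> regular"
  shows "grad f x = grad g x"
proof -
  have "(f has_derivative D) (at x) \<longleftrightarrow> (g has_derivative D) (at x)" for D
    using has_derivative_transform_within_open [of _ D x UNIV regular] open_regular assms
    by metis
  then show ?thesis by (simp add: grad_def frechet_derivative_def)
qed

end

section \<open>Linearity of the finite element spaces\<close>

lemma C_k_lincomb: "C_k k f \<Longrightarrow> C_k k g \<Longrightarrow> C_k k (\<lambda>x. r * f x + s * g x)"
  for f g :: "'a::euclidean_space \<Rightarrow> real"
proof (induction k arbitrary: f g)
  case (Suc k)
  have "frechet_derivative (\<lambda>x. r * f x + s * g x) (at x) =
      (\<lambda>h. r * frechet_derivative f (at x) h + s * frechet_derivative g (at x) h)" for x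
    using Suc.prems frechet_derivative_works
    by (intro frechet_derivative_at [symmetric]) (auto intro!: derivative_eq_intros)
  with Suc show ?case by auto
qed (auto intro!: continuous_intros)

lemma test_function_lincomb:
  assumes "test_function \<Omega> f" "test_function \<Omega> g"
  shows "test_function \<Omega> (\<lambda>x. r * f x + s * g x)"
proof -
  obtain K L where "compact K" "K \<subseteq> \<Omega>" "\<And>x. x \<notin> K \<Longrightarrow> f x = 0"
    "compact L" "L \<subseteq> \<Omega>" "\<And>x. x \<notin> L \<Longrightarrow> g x = 0"
    using assms unfolding test_function_def by metis
  then have "compact (K \<union> L) \<and> K \<union> L \<subseteq> \<Omega> \<and> (\<forall>x. x \<notin> K \<union> L \<longrightarrow> r * f x + s * g x = 0)"
    by auto
  then show ?thesis
    using assms C_k_lincomb unfolding test_function_def by blast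
qed

lemma test_function_smooth:
  fixes \<phi> :: "real^'n \<Rightarrow> real"
  assumes "test_function \<Omega> \<phi>"
  shows "\<phi> differentiable (at x)" "continuous_on UNIV \<phi>" "continuous_on UNIV (grad \<phi>)"
proof -
  have C1: "C_k (Suc 0) \<phi>" and C0: "C_k 0 \<phi>"
    using assms unfolding test_function_def by blast+
  from C1 show "\<phi> differentiable (at x)" by simp
  from C0 show "continuous_on UNIV \<phi>" by simp
  show "continuous_on UNIV (grad \<phi>)"
    unfolding grad_def using C1 by (intro continuous_on_vec_lambda) (auto simp: axis_in_Basis_iff)
qed

lemma grad_lincomb_differentiable:
  fixes f g :: "real^'n \<Rightarrow> real"
  assumes "f differentiable (at x)" "g differentiable (at x)"
  shows "grad (\<lambda>x. r * f x + s * g x) x = r *\<^sub>R grad f x + s *\<^sub>R grad g x"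
proof -
  have "frechet_derivative (\<lambda>x. r * f x + s * g x) (at x) =
      (\<lambda>h. r * frechet_derivative f (at x) h + s * frechet_derivative g (at x) h)"
    using assms frechet_derivative_works
    by (intro frechet_derivative_at [symmetric]) (auto intro!: derivative_eq_intros)
  then show ?thesis by (simp add: grad_def vec_eq_iff)
qed

text \<open>The quantitative part carries the error of approximating sequences over to linear
  combinations; the factor 2 is that of (s + t)^2 \<le> 2 s^2 + 2 t^2.\<close>

lemma L2_lincomb:
  fixes f g :: "'a::euclidean_space \<Rightarrow> 'b::euclidean_space"
  assumes f: "f \<in> L2 \<Omega>" and g: "g \<in> L2 \<Omega>"
  shows "(\<lambda>x. r *\<^sub>R f x + s *\<^sub>R g x) \<in> L2 \<Omega>"
    and "(L2_norm \<Omega> (\<lambda>x. r *\<^sub>R f x + s *\<^sub>R g x))\<^sup>2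
       \<le> 2 * r\<^sup>2 * (L2_norm \<Omega> f)\<^sup>2 + 2 * s\<^sup>2 * (L2_norm \<Omega> g)\<^sup>2"
proof -
  let ?h = "\<lambda>x. r *\<^sub>R f x + s *\<^sub>R g x"
  let ?b = "\<lambda>x. 2 * r\<^sup>2 * (norm (f x))\<^sup>2 + 2 * s\<^sup>2 * (norm (g x))\<^sup>2"
  have bound: "(norm (?h x))\<^sup>2 \<le> ?b x" for x
  proof -
    have "(norm (?h x))\<^sup>2 \<le> (\<bar>r\<bar> * norm (f x) + \<bar>s\<bar> * norm (g x))\<^sup>2"
      using norm_triangle_ineq [of "r *\<^sub>R f x" "s *\<^sub>R g x"] by (intro power_mono) auto
    also have "\<dots> \<le> 2 * (\<bar>r\<bar> * norm (f x))\<^sup>2 + 2 * (\<bar>s\<bar> * norm (g x))\<^sup>2"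
      using sum_squares_bound [of "\<bar>r\<bar> * norm (f x)" "\<bar>s\<bar> * norm (g x)"]
      unfolding power2_sum by linarith
    finally show ?thesis by (simp add: power_mult_distrib)
  qed
  have meas: "set_borel_measurable lebesgue \<Omega> ?h"
  proof -
    have "(\<lambda>x. r *\<^sub>R (indicat_real \<Omega> x *\<^sub>R f x) + s *\<^sub>R (indicat_real \<Omega> x *\<^sub>R g x))
        \<in> borel_measurable lebesgue"
      using f g by (auto simp only: L2_def set_borel_measurable_def mem_Collect_eq
          intro!: borel_measurable_add borel_measurable_scaleR borel_measurable_const)
    then show ?thesis
      by (simp add: set_borel_measurable_def scaleR_add_right mult.commute)
  qed
  have int_b: "set_integrable lebesgue \<Omega> ?b"
    using f g by (auto simp: L2_def)
  have int_h: "set_integrable lebesgue \<Omega> (\<lambda>x. (norm (?h x))\<^sup>2)"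
    unfolding set_integrable_def
  proof (rule Bochner_Integration.integrable_bound)
    show "integrable lebesgue (\<lambda>x. indicat_real \<Omega> x *\<^sub>R ?b x)"
      using int_b by (simp add: set_integrable_def)
    have "(\<lambda>x. (norm (indicator \<Omega> x *\<^sub>R ?h x))\<^sup>2) \<in> borel_measurable lebesgue"
      using meas unfolding set_borel_measurable_def by measurable
    moreover have "(\<lambda>x. (norm (indicator \<Omega> x *\<^sub>R ?h x))\<^sup>2)
        = (\<lambda>x. indicat_real \<Omega> x *\<^sub>R (norm (?h x))\<^sup>2)"
      by (auto simp: indicator_def)
    ultimately show "(\<lambda>x. indicat_real \<Omega> x *\<^sub>R (norm (?h x))\<^sup>2) \<in> borel_measurable lebesgue"
      by simp
    show "AE x in lebesgue. norm (indicat_real \<Omega> x *\<^sub>R (norm (?h x))\<^sup>2)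
        \<le> norm (indicat_real \<Omega> x *\<^sub>R ?b x)"
      using bound by (auto simp: indicator_def)
  qed
  show "?h \<in> L2 \<Omega>"
    using meas int_h by (simp add: L2_def)
  have "(LINT x:\<Omega>|lebesgue. (norm (?h x))\<^sup>2) \<le> (LINT x:\<Omega>|lebesgue. ?b x)"
    by (rule set_integral_mono [OF int_h int_b bound])
  also have "\<dots> = 2 * r\<^sup>2 * (LINT x:\<Omega>|lebesgue. (norm (f x))\<^sup>2)
      + 2 * s\<^sup>2 * (LINT x:\<Omega>|lebesgue. (norm (g x))\<^sup>2)"
    using f g by (subst set_integral_add(2)) (auto simp: L2_def)
  finally show "(L2_norm \<Omega> ?h)\<^sup>2 \<le> 2 * r\<^sup>2 * (L2_norm \<Omega> f)\<^sup>2 + 2 * s\<^sup>2 * (L2_norm \<Omega> g)\<^sup>2"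
    by (simp add: L2_norm_def set_lebesgue_integral_def)
qed

lemma L2_mult_integrable:
  fixes f g :: "'a::euclidean_space \<Rightarrow> real"
  assumes f: "f \<in> L2 \<Omega>" and g: "g \<in> L2 \<Omega>"
  shows "set_integrable lebesgue \<Omega> (\<lambda>x. f x * g x)"
  unfolding set_integrable_def
proof (rule Bochner_Integration.integrable_bound)
  show "integrable lebesgue (\<lambda>x. indicator \<Omega> x *\<^sub>R ((norm (f x))\<^sup>2 + (norm (g x))\<^sup>2))"
    using set_integral_add(1) [of lebesgue \<Omega> "\<lambda>x. (norm (f x))\<^sup>2" "\<lambda>x. (norm (g x))\<^sup>2"] f g
    by (simp add: L2_def set_integrable_def)
  have "(\<lambda>x. (indicator \<Omega> x *\<^sub>R f x) * (indicator \<Omega> x *\<^sub>R g x)) \<in> borel_measurable lebesgue"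
    using f g by (auto simp: L2_def set_borel_measurable_def intro!: borel_measurable_times)
  moreover have "(\<lambda>x. (indicator \<Omega> x *\<^sub>R f x) * (indicator \<Omega> x *\<^sub>R g x))
      = (\<lambda>x. indicator \<Omega> x *\<^sub>R (f x * g x))"
    by (auto simp: indicator_def)
  ultimately show "(\<lambda>x. indicator \<Omega> x *\<^sub>R (f x * g x)) \<in> borel_measurable lebesgue"
    by simp
  have "\<bar>f x\<bar> * \<bar>g x\<bar> \<le> (f x)\<^sup>2 + (g x)\<^sup>2" for x
  proof -
    have "2 * (\<bar>f x\<bar> * \<bar>g x\<bar>) \<le> (f x)\<^sup>2 + (g x)\<^sup>2"
      using sum_squares_bound [of "\<bar>f x\<bar>" "\<bar>g x\<bar>"] by (simp add: mult.assoc)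
    moreover have "0 \<le> \<bar>f x\<bar> * \<bar>g x\<bar>" by simp
    ultimately show ?thesis by linarith
  qed
  then show "AE x in lebesgue. norm (indicator \<Omega> x *\<^sub>R (f x * g x))
      \<le> norm (indicator \<Omega> x *\<^sub>R ((norm (f x))\<^sup>2 + (norm (g x))\<^sup>2))"
    by (auto simp: indicator_def abs_mult)
qed

lemma continuous_L2:
  fixes f :: "'a::euclidean_space \<Rightarrow> 'b::euclidean_space"
  assumes f: "continuous_on UNIV f" and \<Omega>: "bounded \<Omega>" "\<Omega> \<in> sets lebesgue"
  shows "f \<in> L2 \<Omega>"
proof -
  have "set_integrable lebesgue \<Omega> f" "set_integrable lebesgue \<Omega> (\<lambda>x. (norm (f x))\<^sup>2)"
    using f \<Omega> by (auto intro!: absolutely_integrable_continuous_bounded continuous_intros)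
  then show ?thesis
    by (auto simp: L2_def set_integrable_def set_borel_measurable_def)
qed

lemma L2_nth: "G \<in> L2 \<Omega> \<Longrightarrow> (\<lambda>x. G x $ k) \<in> L2 \<Omega>" for G :: "'a::euclidean_space \<Rightarrow> real^'n"
proof -
  assume G: "G \<in> L2 \<Omega>"
  have "(\<lambda>x. (indicator \<Omega> x *\<^sub>R G x) $ k) \<in> borel_measurable lebesgue"
  proof -
    have "(\<lambda>x. indicator \<Omega> x *\<^sub>R G x) \<in> borel_measurable lebesgue"
      using G by (simp add: L2_def set_borel_measurable_def)
    moreover have "(\<lambda>v :: real^'n. v $ k) \<in> borel_measurable borel"
      by (intro borel_measurable_continuous_onI continuous_intros)
    ultimately show ?thesis by (rule measurable_compose)
  qed
  then have m: "(\<lambda>x. indicator \<Omega> x *\<^sub>R (G x $ k)) \<in> borel_measurable lebesgue"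
    by simp
  have "set_integrable lebesgue \<Omega> (\<lambda>x. (norm (G x $ k))\<^sup>2)"
    unfolding set_integrable_def
  proof (rule Bochner_Integration.integrable_bound)
    show "integrable lebesgue (\<lambda>x. indicator \<Omega> x *\<^sub>R (norm (G x))\<^sup>2)"
      using G by (simp add: L2_def set_integrable_def)
    have "(\<lambda>x. (norm (indicator \<Omega> x *\<^sub>R (G x $ k)))\<^sup>2) \<in> borel_measurable lebesgue"
      using m by measurable
    moreover have "(\<lambda>x. (norm (indicator \<Omega> x *\<^sub>R (G x $ k)))\<^sup>2)
        = (\<lambda>x. indicator \<Omega> x *\<^sub>R (norm (G x $ k))\<^sup>2)"
      by (auto simp: indicator_def)
    ultimately show "(\<lambda>x. indicator \<Omega> x *\<^sub>R (norm (G x $ k))\<^sup>2) \<in> borel_measurable lebesgue"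
      by simp
    have "(G x $ k)\<^sup>2 \<le> (norm (G x))\<^sup>2" for x
      using component_le_norm_cart [of "G x" k] by (simp add: abs_le_square_iff [symmetric])
    then show "AE x in lebesgue. norm (indicator \<Omega> x *\<^sub>R (norm (G x $ k))\<^sup>2)
        \<le> norm (indicator \<Omega> x *\<^sub>R (norm (G x))\<^sup>2)"
      by (auto simp: indicator_def)
  qed
  with m show ?thesis
    by (simp add: L2_def set_borel_measurable_def)
qed

text \<open>The defining identity is linear once the integrals may be split. On a bounded domain
  test functions and their derivatives are square integrable, so every product involved is
  integrable.\<close>

lemma has_weak_gradient_lincomb:
  fixes u v :: "real^'n \<Rightarrow> real"
  assumes u: "has_weak_gradient \<Omega> u G" and v: "has_weak_gradient \<Omega> v H"
    and \<Omega>: "bounded \<Omega>" "\<Omega> \<in> sets lebesgue"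
  shows "has_weak_gradient \<Omega> (\<lambda>x. r * u x + s * v x) (\<lambda>x. r *\<^sub>R G x + s *\<^sub>R H x)"
proof -
  have L2: "u \<in> L2 \<Omega>" "G \<in> L2 \<Omega>" "v \<in> L2 \<Omega>" "H \<in> L2 \<Omega>"
    using u v by (auto simp: has_weak_gradient_def)
  have "(LINT x:\<Omega>|lebesgue. (r * u x + s * v x) * grad \<phi> x $ k)
      = - (LINT x:\<Omega>|lebesgue. (r *\<^sub>R G x + s *\<^sub>R H x) $ k * \<phi> x)"
    if \<phi>: "test_function \<Omega> \<phi>" for \<phi> k
  proof -
    have \<phi>L2: "\<phi> \<in> L2 \<Omega>" "(\<lambda>x. grad \<phi> x $ k) \<in> L2 \<Omega>"
      using test_function_smooth [OF \<phi>] \<Omega> by (auto intro: continuous_L2 L2_nth)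
    have "(LINT x:\<Omega>|lebesgue. (r * u x + s * v x) * grad \<phi> x $ k)
        = (LINT x:\<Omega>|lebesgue. r * (u x * grad \<phi> x $ k) + s * (v x * grad \<phi> x $ k))"
      by (simp add: algebra_simps)
    also have "\<dots> = r * (LINT x:\<Omega>|lebesgue. u x * grad \<phi> x $ k)
        + s * (LINT x:\<Omega>|lebesgue. v x * grad \<phi> x $ k)"
      using L2 \<phi>L2 by (subst set_integral_add(2)) (auto intro: L2_mult_integrable)
    also have "\<dots> = - (r * (LINT x:\<Omega>|lebesgue. G x $ k * \<phi> x)
        + s * (LINT x:\<Omega>|lebesgue. H x $ k * \<phi> x))"
      using u v \<phi> by (simp add: has_weak_gradient_def)
    also have "r * (LINT x:\<Omega>|lebesgue. G x $ k * \<phi> x) + s * (LINT x:\<Omega>|lebesgue. H x $ k * \<phi> x)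
        = (LINT x:\<Omega>|lebesgue. r * (G x $ k * \<phi> x) + s * (H x $ k * \<phi> x))"
      by (subst set_integral_add(2))
         (use L2_mult_integrable [OF L2_nth [OF L2(2)] \<phi>L2(1), of k]
            L2_mult_integrable [OF L2_nth [OF L2(4)] \<phi>L2(1), of k] in auto)
    finally show ?thesis by (simp add: algebra_simps)
  qed
  then show ?thesis
    using L2_lincomb(1) [OF L2(1,3), of r s] L2_lincomb(1) [OF L2(2,4), of r s]
    by (simp add: has_weak_gradient_def)
qed

text \<open>The same linear combination of the two approximating sequences converges. The test
  functions built from the solution are admissible for this reason.\<close>

lemma H10_lincomb:
  fixes u v :: "real^'n \<Rightarrow> real"
  assumes u: "u \<in> H10 \<Omega>" and v: "v \<in> H10 \<Omega>"
    and \<Omega>: "bounded \<Omega>" "\<Omega> \<in> sets lebesgue"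
  shows "(\<lambda>x. r * u x + s * v x) \<in> H10 \<Omega>"
proof -
  obtain G \<phi> where G: "has_weak_gradient \<Omega> u G" and \<phi>: "\<And>m. test_function \<Omega> (\<phi> m)"
    and lim_u: "(\<lambda>m::nat. (L2_norm \<Omega> (\<lambda>x. u x - \<phi> m x))\<^sup>2 + (L2_norm \<Omega> (\<lambda>x. G x - grad (\<phi> m) x))\<^sup>2)
       \<longlonglongrightarrow> 0"
    using u by (auto simp: H10_def)
  obtain H \<psi> where H: "has_weak_gradient \<Omega> v H" and \<psi>: "\<And>m. test_function \<Omega> (\<psi> m)"
    and lim_v: "(\<lambda>m::nat. (L2_norm \<Omega> (\<lambda>x. v x - \<psi> m x))\<^sup>2 + (L2_norm \<Omega> (\<lambda>x. H x - grad (\<psi> m) x))\<^sup>2)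
       \<longlonglongrightarrow> 0"
    using v by (auto simp: H10_def)
  define w where "w m x = r * \<phi> m x + s * \<psi> m x" for m x
  let ?eu = "\<lambda>m. (L2_norm \<Omega> (\<lambda>x. u x - \<phi> m x))\<^sup>2 + (L2_norm \<Omega> (\<lambda>x. G x - grad (\<phi> m) x))\<^sup>2"
  let ?ev = "\<lambda>m. (L2_norm \<Omega> (\<lambda>x. v x - \<psi> m x))\<^sup>2 + (L2_norm \<Omega> (\<lambda>x. H x - grad (\<psi> m) x))\<^sup>2"
  let ?e = "\<lambda>m. (L2_norm \<Omega> (\<lambda>x. r * u x + s * v x - w m x))\<^sup>2
      + (L2_norm \<Omega> (\<lambda>x. r *\<^sub>R G x + s *\<^sub>R H x - grad (w m) x))\<^sup>2"
  have diff_L2: "(\<lambda>x. f x - g x) \<in> L2 \<Omega>" if "f \<in> L2 \<Omega>" "continuous_on UNIV g"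
    for f g :: "real^'n \<Rightarrow> 'b::euclidean_space"
    using L2_lincomb(1) [of f \<Omega> g 1 "-1"] that continuous_L2 [OF that(2) \<Omega>] by simp
  have le: "?e m \<le> 2 * r\<^sup>2 * ?eu m + 2 * s\<^sup>2 * ?ev m" for m
  proof -
    note smooth = test_function_smooth [OF \<phi> [of m]] test_function_smooth [OF \<psi> [of m]]
    have "grad (w m) x = r *\<^sub>R grad (\<phi> m) x + s *\<^sub>R grad (\<psi> m) x" for x
      unfolding w_def by (rule grad_lincomb_differentiable [OF smooth(1,4)])
    then have e2: "(\<lambda>x. r *\<^sub>R G x + s *\<^sub>R H x - grad (w m) x)
        = (\<lambda>x. r *\<^sub>R (G x - grad (\<phi> m) x) + s *\<^sub>R (H x - grad (\<psi> m) x))"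
      by (simp add: algebra_simps)
    have e1: "(\<lambda>x. r * u x + s * v x - w m x) = (\<lambda>x. r *\<^sub>R (u x - \<phi> m x) + s *\<^sub>R (v x - \<psi> m x))"
      by (simp add: w_def algebra_simps)
    have "(\<lambda>x. u x - \<phi> m x) \<in> L2 \<Omega>" "(\<lambda>x. v x - \<psi> m x) \<in> L2 \<Omega>"
      "(\<lambda>x. G x - grad (\<phi> m) x) \<in> L2 \<Omega>" "(\<lambda>x. H x - grad (\<psi> m) x) \<in> L2 \<Omega>"
      using G H smooth by (auto intro!: diff_L2 simp: has_weak_gradient_def)
    from L2_lincomb(2) [OF this(1,2), of r s] L2_lincomb(2) [OF this(3,4), of r s]
    show ?thesis
      unfolding e1 e2 by (simp add: algebra_simps)
  qed
  have "?e \<longlonglongrightarrow> 0"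
  proof (rule tendsto_sandwich [where f = "\<lambda>_. 0"])
    show "(\<lambda>m. 2 * r\<^sup>2 * ?eu m + 2 * s\<^sup>2 * ?ev m) \<longlonglongrightarrow> 0"
      using tendsto_add [OF tendsto_mult_left [OF lim_u, of "2 * r\<^sup>2"]
          tendsto_mult_left [OF lim_v, of "2 * s\<^sup>2"]] by simp
    show "(\<lambda>m. 0) \<longlonglongrightarrow> (0::real)" by simp
  qed (use le in auto)
  moreover have "test_function \<Omega> (w m)" for m
    unfolding w_def by (intro test_function_lincomb \<phi> \<psi>)
  ultimately show ?thesis
    using has_weak_gradient_lincomb [OF G H \<Omega>, of r s] unfolding H10_def by blast
qed

context mesh
begin

lemma Y_h_pw_affine: "f \<in> Y_h \<Omega> Th \<Longrightarrow> f \<in> pw_affine"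
  by (simp add: Y_h_def pw_affine_def)

lemma Y_h_lincomb: "f \<in> Y_h \<Omega> Th \<Longrightarrow> g \<in> Y_h \<Omega> Th \<Longrightarrow> (\<lambda>x. r * f x + s * g x) \<in> Y_h \<Omega> Th"
  using pw_affine_lincomb [of f g r s] H10_lincomb [of f \<Omega> g r s] open_domain bounded_domain
  by (auto simp: Y_h_def pw_affine_def)

end

section \<open>Piecewise affine matrix fields and the projected boundary datum\<close>

context mesh
begin

definition pw_affine_mat :: "(real^'n \<Rightarrow> real^'n^'n) set" where
  "pw_affine_mat = {F. \<forall>i j. (\<lambda>x. F x $ i $ j) \<in> pw_affine}"

lemma pw_affine_mat_nth: "F \<in> pw_affine_mat \<Longrightarrow> (\<lambda>x. F x $ i $ j) \<in> pw_affine"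
  by (simp add: pw_affine_mat_def)

lemma X_h_pw_affine_mat: "F \<in> X_h \<Omega> Th \<Longrightarrow> F \<in> pw_affine_mat"
  by (simp add: X_h_def pw_affine_mat_def Y_h_pw_affine)

lemma P1_pw_affine: "f \<in> P1 \<Omega> Th \<Longrightarrow> f \<in> pw_affine" and P1_mat_pw_affine_mat: "F \<in> P1_mat \<Omega> Th \<Longrightarrow> F \<in> pw_affine_mat"
  by (simp_all add: P1_mat_def P1_def pw_affine_mat_def pw_affine_def)

lemma pw_affine_mat_add: "F \<in> pw_affine_mat \<Longrightarrow> G \<in> pw_affine_mat \<Longrightarrow> (\<lambda>x. F x + G x) \<in> pw_affine_mat"
  by (simp add: pw_affine_mat_def pw_affine_add)

lemma piecewise_pw_affine_mat: "F \<in> pw_affine_mat \<Longrightarrow> piecewise F"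
  by (intro piecewise_vec piecewise_pw_affine pw_affine_mat_nth)

lemma piecewise_mat_grad: "F \<in> pw_affine_mat \<Longrightarrow> piecewise (mat_grad F)"
  by (intro piecewise_vec) (simp add: mat_grad_def piecewise_nth piecewise_grad pw_affine_mat_nth)

lemma piecewise_mat_div: "F \<in> pw_affine_mat \<Longrightarrow> piecewise (mat_div F)"
  by (rule piecewise_vec)
    (auto simp: mat_div_def intro!: piecewise_sum piecewise_nth piecewise_grad pw_affine_mat_nth)

lemma mat_grad_lincomb:
  assumes "F \<in> pw_affine_mat" "G \<in> pw_affine_mat" "x \<in> regular"
  shows "mat_grad (\<lambda>y. r *\<^sub>R F y + s *\<^sub>R G y) x = r *\<^sub>R mat_grad F x + s *\<^sub>R mat_grad G x"
  using assms by (simp add: mat_grad_def vec_eq_iff grad_lincomb pw_affine_mat_nth)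

lemma mat_div_lincomb:
  assumes "F \<in> pw_affine_mat" "G \<in> pw_affine_mat" "x \<in> regular"
  shows "mat_div (\<lambda>y. r *\<^sub>R F y + s *\<^sub>R G y) x = r *\<^sub>R mat_div F x + s *\<^sub>R mat_div G x"
  using assms by (simp add: mat_div_def vec_eq_iff grad_lincomb pw_affine_mat_nth sum.distrib sum_distrib_left)

lemma mat_grad_cong_regular:
  assumes "\<And>y. y \<in> regular \<Longrightarrow> F y = G y" "x \<in> regular"
  shows "mat_grad F x = mat_grad G x" "mat_div F x = mat_div G x"
proof -
  have "grad (\<lambda>y. F y $ i $ j) x = grad (\<lambda>y. G y $ i $ j) x" for i j
    using assms by (intro grad_cong_regular) auto
  then show "mat_grad F x = mat_grad G x" "mat_div F x = mat_div G x"
    by (simp_all add: mat_grad_def mat_div_def)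
qed

lemma mat_div_zero: "mat_div (\<lambda>y. 0) x = 0"
  by (simp add: mat_div_def vec_eq_iff grad_zero)

lemma piecewise_inner_zero:
  fixes f :: "real^'n \<Rightarrow> 'b::real_inner"
  assumes "piecewise f" "(LINT x:\<Omega>|lebesgue. f x \<bullet> f x) = 0" "x \<in> regular"
  shows "f x = 0"
  using piecewise_eq_zero [of "\<lambda>x. f x \<bullet> f x" x] assms by (simp add: piecewise_inner)

text \<open>Uniqueness of the projection, tested with the skew part and the trace of \<open>qh\<close>.\<close>

lemma L2_projection_sym_tracefree:
  assumes q: "AE x\<in>\<Omega> in lebesgue. transpose (q x) = q x \<and> trace (q x) = 0"
    and proj: "L2_projection \<Omega> (P1_mat \<Omega> Th) q qh" and x: "x \<in> regular"
  shows "transpose (qh x) = qh x" "trace (qh x) = 0"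
proof -
  obtain N where N: "{x \<in> space lebesgue. \<not> (x \<in> \<Omega> \<longrightarrow> transpose (q x) = q x \<and> trace (q x) = 0)} \<subseteq> N"
    "emeasure lebesgue N = 0" "N \<in> sets lebesgue"
    using q by (rule AE_E)
  then have negl: "negligible N"
    by (simp add: negligible_iff_null_sets null_sets_def)
  have qN: "transpose (q x) = q x \<and> trace (q x) = 0" if "x \<in> \<Omega> - N" for x
    using N(1) that by auto
  have qh: "qh \<in> P1_mat \<Omega> Th" and orth: "\<And>v. v \<in> P1_mat \<Omega> Th \<Longrightarrow>
      (LINT x:\<Omega>|lebesgue. (q x - qh x) \<bullet> v x) = 0"
    using proj by (auto simp: L2_projection_def)
  have qhP: "continuous_on (closure \<Omega>) (\<lambda>x. qh x $ i $ j)" "(\<lambda>x. qh x $ i $ j) \<in> pw_affine" for i j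
    using qh by (auto simp: P1_mat_def P1_def pw_affine_def)
  define v where "v x = qh x - transpose (qh x)" for x
  have v: "v \<in> P1_mat \<Omega> Th"
  proof -
    have vij: "(\<lambda>x. v x $ i $ j) = (\<lambda>x. qh x $ i $ j - qh x $ j $ i)" for i j
      by (simp add: v_def transpose_def)
    have "(\<lambda>x. v x $ i $ j) \<in> pw_affine \<and> continuous_on (closure \<Omega>) (\<lambda>x. v x $ i $ j)" for i j
      unfolding vij by (intro conjI continuous_on_diff pw_affine_diff qhP)
    then show ?thesis
      by (simp add: P1_mat_def P1_def pw_affine_def)
  qed
  \<comment> \<open>Off the null set the symmetric \<open>q\<close> is orthogonal to the skew
    \<open>v\<close>, while \<open>qh\<close> contracted with \<open>v\<close> is half of
    \<open>v \<bullet> v\<close>. Orthogonality of the projection error thus forces \<open>v\<close>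
    to vanish.\<close>
  have "0 = (LINT x:\<Omega>|lebesgue. (- 1 / 2) * (v x \<bullet> v x))"
    unfolding orth [OF v, symmetric]
  proof (rule set_lebesgue_integral_spike [OF negl])
    fix x assume "x \<in> \<Omega> - N"
    have skew: "transpose (v x) = - v x"
      by (simp add: v_def transpose_diff)
    then have "q x \<bullet> v x = 0"
      using qN [OF \<open>x \<in> \<Omega> - N\<close>] by (intro inner_sym_skew) auto
    moreover have "transpose (qh x) \<bullet> v x = - (qh x \<bullet> v x)"
      using inner_transpose [of "qh x" "v x"] skew by simp
    then have "v x \<bullet> v x = 2 * (qh x \<bullet> v x)"
      by (subst (1) v_def) (simp add: inner_diff_left)
    ultimately show "(q x - qh x) \<bullet> v x = (- 1 / 2) * (v x \<bullet> v x)"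
      by (simp add: inner_diff_left)
  qed
  also have "\<dots> = (- 1 / 2) * (LINT x:\<Omega>|lebesgue. v x \<bullet> v x)"
    by (rule set_integral_mult_right)
  finally have "(LINT x:\<Omega>|lebesgue. v x \<bullet> v x) = 0" by simp
  then have "v x = 0"
    by (intro piecewise_inner_zero [OF piecewise_pw_affine_mat [OF P1_mat_pw_affine_mat [OF v]] _ x])
  then have "qh x = transpose (qh x)" unfolding v_def by (rule right_minus_eq [THEN iffD1])
  then show "transpose (qh x) = qh x" by (rule sym)
  define t where "t x = trace (qh x)" for x
  define w where "w x = t x *\<^sub>R (mat 1 :: real^'n^'n)" for x
  have tPA: "t \<in> pw_affine"
    unfolding t_def trace_def by (intro pw_affine_sum qhP)
  have tc: "continuous_on (closure \<Omega>) t"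
    unfolding t_def trace_def by (intro continuous_on_sum qhP)
  have w: "w \<in> P1_mat \<Omega> Th"
  proof -
    have wij: "(\<lambda>x. w x $ i $ j) = (if i = j then t else (\<lambda>x. 0))" for i j
      by (simp add: w_def mat_def fun_eq_iff)
    have "(\<lambda>x. w x $ i $ j) \<in> pw_affine \<and> continuous_on (closure \<Omega>) (\<lambda>x. w x $ i $ j)" for i j
      unfolding wij using tPA tc pw_affine_zero by simp
    then show ?thesis
      by (simp add: P1_mat_def P1_def pw_affine_def)
  qed
  have "0 = (LINT x:\<Omega>|lebesgue. (- 1) * (t x \<bullet> t x))"
    unfolding orth [OF w, symmetric]
  proof (rule set_lebesgue_integral_spike [OF negl])
    fix x assume "x \<in> \<Omega> - N"
    then show "(q x - qh x) \<bullet> w x = (- 1) * (t x \<bullet> t x)"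
      using qN [of x] unfolding w_def inner_scaleR_right inner_mat_1 trace_sub t_def by simp
  qed
  also have "\<dots> = (- 1) * (LINT x:\<Omega>|lebesgue. t x \<bullet> t x)"
    by (rule set_integral_mult_right)
  finally have "(LINT x:\<Omega>|lebesgue. t x \<bullet> t x) = 0" by simp
  then have "t x = 0"
    by (intro piecewise_inner_zero [OF piecewise_pw_affine [OF tPA] _ x])
  then show "trace (qh x) = 0" by (simp add: t_def)
qed

end

context mesh
begin

abbreviation integ :: "(real^'n \<Rightarrow> real) \<Rightarrow> real" where
  "integ f \<equiv> (LINT x:\<Omega>|lebesgue. f x)"

lemma Y_h_sum:
  assumes "\<And>i. i \<in> I \<Longrightarrow> f i \<in> Y_h \<Omega> Th" "(\<lambda>x. 0) \<in> Y_h \<Omega> Th"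
  shows "(\<lambda>x. \<Sum>i\<in>I. f i x) \<in> Y_h \<Omega> Th"
  using assms(1)
proof (induction I rule: infinite_finite_induct)
  case (insert i I)
  then show ?case
    using Y_h_lincomb [of "f i" "\<lambda>x. \<Sum>i\<in>I. f i x" 1 1] by simp
qed (simp_all add: assms(2))

lemma X_h_lincomb:
  "F \<in> X_h \<Omega> Th \<Longrightarrow> G \<in> X_h \<Omega> Th \<Longrightarrow> (\<lambda>x. r *\<^sub>R F x + s *\<^sub>R G x) \<in> X_h \<Omega> Th"
  by (simp add: X_h_def Y_h_lincomb)

lemma X_h_transpose: "F \<in> X_h \<Omega> Th \<Longrightarrow> (\<lambda>x. transpose (F x)) \<in> X_h \<Omega> Th"
  by (simp add: X_h_def transpose_def)

lemma X_h_trace_mat_1: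
  assumes "F \<in> X_h \<Omega> Th"
  shows "(\<lambda>x. trace (F x) *\<^sub>R mat 1) \<in> X_h \<Omega> Th"
proof -
  have F: "(\<lambda>x. F x $ i $ j) \<in> Y_h \<Omega> Th" for i j
    using assms by (simp add: X_h_def)
  \<comment> \<open>A trivial combination of entries of \<open>F\<close> shows that the space
    contains 0.\<close>
  have zero: "(\<lambda>x. 0) \<in> Y_h \<Omega> Th"
    using Y_h_lincomb [OF F F, of 0 _ _ 0] by simp
  have entry: "(\<lambda>x. (trace (F x) *\<^sub>R (mat 1 :: real^'n^'n)) $ i $ j)
      = (if i = j then (\<lambda>x. trace (F x)) else (\<lambda>x. 0))" for i j
    by (simp add: mat_def fun_eq_iff)
  have "(\<lambda>x. trace (F x)) \<in> Y_h \<Omega> Th"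
    unfolding trace_def by (intro Y_h_sum F zero)
  then have "(\<lambda>x. (trace (F x) *\<^sub>R (mat 1 :: real^'n^'n)) $ i $ j) \<in> Y_h \<Omega> Th" for i j
    unfolding entry using zero by simp
  then show ?thesis
    unfolding X_h_def by blast
qed

lemma pw_affine_mat_transpose: "F \<in> pw_affine_mat \<Longrightarrow> (\<lambda>x. transpose (F x)) \<in> pw_affine_mat"
  by (simp add: pw_affine_mat_def transpose_def)

lemma pw_affine_trace: "F \<in> pw_affine_mat \<Longrightarrow> (\<lambda>x. trace (F x)) \<in> pw_affine"
  unfolding trace_def by (intro pw_affine_sum pw_affine_mat_nth)

lemma mat_grad_transpose: "mat_grad (\<lambda>y. transpose (F y)) x $ i $ j = mat_grad F x $ j $ i"
  by (simp add: mat_grad_def transpose_def)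

lemma grad_trace: "F \<in> pw_affine_mat \<Longrightarrow> x \<in> regular \<Longrightarrow> grad (\<lambda>y. trace (F y)) x = (\<Sum>i\<in>UNIV. mat_grad F x $ i $ i)"
  by (simp add: trace_def grad_sum pw_affine_mat_nth mat_grad_def)

lemma mat_grad_midpt:
  assumes "F n \<in> pw_affine_mat" "F (Suc n) \<in> pw_affine_mat" "x \<in> regular"
  shows "mat_grad (\<lambda>y. midpt (\<lambda>m. F m y) n) x = (1/2) *\<^sub>R (mat_grad (F n) x + mat_grad (F (Suc n)) x)"
  using mat_grad_lincomb [OF assms, of "1/2" "1/2"] by (simp add: midpt_def scaleR_add_right)

lemma grad_midpt:
  assumes "f n \<in> pw_affine" "f (Suc n) \<in> pw_affine" "x \<in> regular"
  shows "grad (\<lambda>y. midpt (\<lambda>m. f m y) n) x = (1/2) *\<^sub>R (grad (f n) x + grad (f (Suc n)) x)"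
  using grad_lincomb [OF assms, of "1/2" "1/2"] by (simp add: midpt_def distrib_left scaleR_add_right)

end

section \<open>Symmetry and trace of the discrete solution\<close>

text \<open>One fixed discretization. The final constant is chosen before this locale is
  interpreted, which is how its uniformity in the mesh and the step size is secured.\<close>

locale scheme = mesh \<Omega> Th for \<Omega> :: "(real^'n) set" and Th +
  fixes L \<epsilon>1 \<epsilon>2 \<epsilon>3 a b c A0 R CT \<beta>1 \<beta>2 dt :: real
    and \<T> :: "real^'n^'n \<Rightarrow> real^'n^'n" and N :: nat
    and q qh :: "real^'n \<Rightarrow> real^'n^'n" and gh :: "nat \<Rightarrow> real^'n \<Rightarrow> real"
    and Q :: "nat \<Rightarrow> real^'n \<Rightarrow> real^'n^'n" and u :: "nat \<Rightarrow> real^'n \<Rightarrow> real"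
  assumes L: "L > 0" and R: "R > 0" and dt: "dt > 0"
    and beta: "\<beta>1 \<ge> max \<bar>b\<bar> a" "\<beta>2 \<ge> max \<bar>b\<bar> c"
    and trunc: "truncation R CT \<T>"
    and bulk: "\<And>A :: real^'n^'n. transpose A = A \<Longrightarrow> F_B a b c A0 A \<ge> 0"
    and q_sym: "AE x\<in>\<Omega> in lebesgue. transpose (q x) = q x \<and> trace (q x) = 0"
    and proj: "L2_projection \<Omega> (P1_mat \<Omega> Th) q qh"
    and gh_pw_affine: "\<And>n. n \<le> N \<Longrightarrow> gh n \<in> pw_affine"
    and solution: "discrete_solution \<Omega> Th L \<epsilon>1 \<epsilon>2 \<epsilon>3 a b c \<beta>1 \<beta>2 \<T> dt N qh gh Q u"
begin

lemma qh_pw_affine_mat: "qh \<in> pw_affine_mat"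
  using proj by (simp add: L2_projection_def P1_mat_pw_affine_mat)

lemma qh_sym: "x \<in> regular \<Longrightarrow> transpose (qh x) = qh x" "x \<in> regular \<Longrightarrow> trace (qh x) = 0"
  using L2_projection_sym_tracefree [OF q_sym proj] by blast+

lemma Q_diff_X_h: "n \<le> N \<Longrightarrow> (\<lambda>x. Q n x - qh x) \<in> X_h \<Omega> Th"
  using solution by (simp add: discrete_solution_def)

lemma u_diff_Y_h: "n \<le> N \<Longrightarrow> (\<lambda>x. u n x - gh n x) \<in> Y_h \<Omega> Th"
  using solution by (simp add: discrete_solution_def)

lemma Q_pw_affine_mat: "n \<le> N \<Longrightarrow> Q n \<in> pw_affine_mat"
  using pw_affine_mat_add [OF X_h_pw_affine_mat [OF Q_diff_X_h] qh_pw_affine_mat, of n] by simp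

lemma u_pw_affine: "n \<le> N \<Longrightarrow> u n \<in> pw_affine"
  using pw_affine_add [OF Y_h_pw_affine [OF u_diff_Y_h] gh_pw_affine, of n n] by simp

lemma Q_eq:
  assumes "n < N" "\<Phi> \<in> X_h \<Omega> Th"
  shows "Q_equation \<Omega> L \<epsilon>2 \<epsilon>3 a b c \<beta>1 \<beta>2 \<T> dt Q u n \<Phi>"
  using solution assms by (simp add: discrete_solution_def)

lemma u_eq:
  assumes "n \<le> N" "\<psi> \<in> Y_h \<Omega> Th"
  shows "u_equation \<Omega> \<epsilon>1 \<epsilon>2 \<epsilon>3 \<T> Q u n \<psi>"
  using solution assms by (simp add: discrete_solution_def)

text \<open>Testing with the skew part of \<open>Q (Suc n)\<close>, which vanishes on the boundary.\<close>

lemma Q_Suc_sym: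
  assumes n: "n < N" and sym: "\<And>x. x \<in> regular \<Longrightarrow> transpose (Q n x) = Q n x"
    and x: "x \<in> regular"
  shows "transpose (Q (Suc n) x) = Q (Suc n) x"
proof -
  \<comment> \<open>A test function has to vanish on the boundary, so \<open>qh\<close> is
    subtracted first. Since \<open>qh\<close> is symmetric on \<open>regular\<close>, the skew part
    of the difference there is that of \<open>Q (Suc n)\<close> itself.\<close>
  define V where "V = (\<lambda>x. Q (Suc n) x - qh x)"
  define \<Phi> where "\<Phi> = (\<lambda>x. (1/2) *\<^sub>R V x + (-1/2) *\<^sub>R transpose (V x))"
  have V: "V \<in> X_h \<Omega> Th"
    unfolding V_def using n by (intro Q_diff_X_h) simp
  have \<Phi>: "\<Phi> \<in> X_h \<Omega> Th"
    unfolding \<Phi>_def by (intro X_h_lincomb X_h_transpose V)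
  have Q1: "Q (Suc n) \<in> pw_affine_mat" and Q0: "Q n \<in> pw_affine_mat"
    using n by (auto intro: Q_pw_affine_mat)
  have skew: "transpose (\<Phi> x) = - \<Phi> x" for x
    by (simp add: \<Phi>_def transpose_diff transpose_scalar)
  have \<Phi>_eq: "\<Phi> x = (1/2) *\<^sub>R (Q (Suc n) x - transpose (Q (Suc n) x))" if "x \<in> regular" for x
    using qh_sym(1) [OF that] by (simp add: \<Phi>_def V_def transpose_diff scaleR_diff_right)
  have time: "integ (\<lambda>x. D_plus dt (\<lambda>m. Q m x) n \<bullet> \<Phi> x) = (1 / dt) * integ (\<lambda>x. \<Phi> x \<bullet> \<Phi> x)"
    unfolding set_integral_mult_right [symmetric]
  proof (rule integral_cong_regular)
    fix x assume x: "x \<in> regular"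
    have "Q n x \<bullet> \<Phi> x = 0"
      using inner_sym_skew [OF sym [OF x] skew] .
    moreover have "transpose (Q (Suc n) x) \<bullet> \<Phi> x = - (Q (Suc n) x \<bullet> \<Phi> x)"
      using inner_transpose [of "Q (Suc n) x" "\<Phi> x"] skew by simp
    then have "\<Phi> x \<bullet> \<Phi> x = Q (Suc n) x \<bullet> \<Phi> x"
      by (subst (1) \<Phi>_eq [OF x]) (simp add: inner_diff_left)
    ultimately show "D_plus dt (\<lambda>m. Q m x) n \<bullet> \<Phi> x = (1 / dt) * (\<Phi> x \<bullet> \<Phi> x)"
      by (simp add: D_plus_def inner_diff_left)
  qed
  have elastic: "integ (\<lambda>x. mat_grad (\<lambda>y. midpt (\<lambda>m. Q m y) n) x \<bullet> mat_grad \<Phi> x) \<ge> 0"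
  proof (rule integral_nonneg_regular)
    fix x assume x: "x \<in> regular"
    let ?G0 = "mat_grad (Q n) x" and ?G1 = "mat_grad (Q (Suc n)) x"
    have "mat_grad \<Phi> x = mat_grad (\<lambda>y. (1/2) *\<^sub>R Q (Suc n) y + (-1/2) *\<^sub>R transpose (Q (Suc n) y)) x"
      by (rule mat_grad_cong_regular [OF _ x]) (simp add: \<Phi>_eq scaleR_diff_right)
    also have "\<dots> = (1/2) *\<^sub>R ?G1 + (-1/2) *\<^sub>R mat_grad (\<lambda>y. transpose (Q (Suc n) y)) x"
      by (rule mat_grad_lincomb [OF Q1 pw_affine_mat_transpose [OF Q1] x])
    finally have g\<Phi>: "mat_grad \<Phi> x $ i $ j = (1/2) *\<^sub>R (?G1 $ i $ j - ?G1 $ j $ i)" for i j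
      by (simp add: mat_grad_transpose scaleR_diff_right)
    have "mat_grad (\<lambda>y. transpose (Q n y)) x = ?G0"
      by (rule mat_grad_cong_regular [OF sym x])
    then have G0: "?G0 $ i $ j = ?G0 $ j $ i" for i j
      by (metis mat_grad_transpose)
    have "mat_grad (\<lambda>y. midpt (\<lambda>m. Q m y) n) x \<bullet> mat_grad \<Phi> x
        = 1 / 4 * (\<Sum>i\<in>UNIV. \<Sum>j\<in>UNIV. (?G0 $ i $ j + ?G1 $ i $ j) \<bullet> (?G1 $ i $ j - ?G1 $ j $ i))"
      unfolding mat_grad_midpt [of Q n x, OF Q0 Q1 x]
      by (simp add: inner_vec_def [of _ "mat_grad \<Phi> x"] inner_vec_def [of _ "mat_grad \<Phi> x $ i" for i]
          g\<Phi> sum_distrib_left sum_divide_distrib)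
    also have "\<dots> \<ge> 0"
      using sum_sym_skew_nonneg [of "\<lambda>i j. ?G0 $ i $ j" "\<lambda>i j. ?G1 $ i $ j"] G0 by simp
    finally show "mat_grad (\<lambda>y. midpt (\<lambda>m. Q m y) n) x \<bullet> mat_grad \<Phi> x \<ge> 0" .
  qed
  have bulk_term: "integ (\<lambda>x. (dF1 b \<beta>1 \<beta>2 (Q (Suc n) x) - dF2 a c \<beta>1 \<beta>2 (Q n x)) \<bullet> \<Phi> x) \<ge> 0"
    using beta by (intro integral_nonneg_regular bulk_skew_nonneg sym \<Phi>_eq) auto
  \<comment> \<open>Both the symmetric part and the multiple of the identity are symmetric matrices,
    hence orthogonal to the skew \<Phi>.\<close>
  have coupling: "integ (\<lambda>x. let S = hadamard (P_tilde \<T> (Q (Suc n) x) (Q n x))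
                    (outer (grad (u n) x) (grad (u (Suc n)) x))
          in (sym_part S - (1 / real CARD('n) * trace S) *\<^sub>R mat 1) \<bullet> \<Phi> x) = 0"
    unfolding Let_def
    by (intro integral_zero_regular inner_sym_skew skew)
       (simp add: sym_part_def transpose_diff transpose_scalar transpose_add add.commute)
  have sp: "sym_part (\<Phi> y) = 0" for y
    by (simp add: sym_part_def skew)
  have tr: "trace (\<Phi> y) = 0" for y
    using trace_transpose_real [of "\<Phi> y"] skew [of y] by (simp add: trace_def sum_negf)
  have flex: "integ (\<lambda>x. let p = grad (\<lambda>y. midpt (\<lambda>m. u m y) n) x
          in p \<bullet> mat_div (\<lambda>y. sym_part (\<Phi> y)) x
             - 1 / real CARD('n) * (p \<bullet> grad (\<lambda>y. trace (\<Phi> y)) x)) = 0"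
    by (simp add: Let_def sp tr mat_div_zero grad_zero)
  \<comment> \<open>The equation equates minus a nonnegative time term with a sum of nonnegative
    terms, so the time term is zero.\<close>
  have "- ((1 / dt) * integ (\<lambda>x. \<Phi> x \<bullet> \<Phi> x)) \<ge> 0"
    using Q_eq [OF n \<Phi>] unfolding Q_equation_def time coupling flex
    using elastic bulk_term L by simp
  moreover have "integ (\<lambda>x. \<Phi> x \<bullet> \<Phi> x) \<ge> 0"
    by (rule integral_nonneg_regular) simp
  ultimately have "integ (\<lambda>x. \<Phi> x \<bullet> \<Phi> x) = 0"
    using dt by (simp add: field_simps)
  then have "\<Phi> x = 0"
    by (intro piecewise_inner_zero [OF piecewise_pw_affine_mat [OF X_h_pw_affine_mat [OF \<Phi>]] _ x])
  then have "Q (Suc n) x = transpose (Q (Suc n) x)"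
    unfolding \<Phi>_eq [OF x] by simp
  then show ?thesis by (rule HOL.sym)
qed

text \<open>Tested with the trace times the identity, the two electric terms vanish because of their
  1/d trace corrections, while the elastic and bulk terms are nonnegative and the time term is minus
  a squared norm. The trace of \<open>qh\<close> is zero on \<open>regular\<close>, so subtracting
  it to meet the boundary condition leaves the trace unchanged there.\<close>

lemma Q_Suc_tracefree:
  assumes n: "n < N" and tr0: "\<And>x. x \<in> regular \<Longrightarrow> trace (Q n x) = 0" and x: "x \<in> regular"
  shows "trace (Q (Suc n) x) = 0"
proof -
  define V where "V = (\<lambda>x. Q (Suc n) x - qh x)"
  define t where "t = (\<lambda>x. trace (V x))"
  define \<Phi> where "\<Phi> = (\<lambda>x. t x *\<^sub>R (mat 1 :: real^'n^'n))"
  have V: "V \<in> X_h \<Omega> Th"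
    unfolding V_def using n by (intro Q_diff_X_h) simp
  have \<Phi>: "\<Phi> \<in> X_h \<Omega> Th"
    unfolding \<Phi>_def t_def by (rule X_h_trace_mat_1 [OF V])
  have t: "t \<in> pw_affine"
    unfolding t_def by (intro pw_affine_trace X_h_pw_affine_mat V)
  have Q1: "Q (Suc n) \<in> pw_affine_mat" and Q0: "Q n \<in> pw_affine_mat"
    using n by (auto intro: Q_pw_affine_mat)
  have t_eq: "t x = trace (Q (Suc n) x)" if "x \<in> regular" for x
    using qh_sym(2) [OF that] by (simp add: t_def V_def trace_sub)
  have time: "integ (\<lambda>x. D_plus dt (\<lambda>m. Q m x) n \<bullet> \<Phi> x) = (1 / dt) * integ (\<lambda>x. t x \<bullet> t x)"
    unfolding set_integral_mult_right [symmetric]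
    by (rule integral_cong_regular)
       (simp add: D_plus_def \<Phi>_def inner_mat_1 trace_scaleR trace_sub tr0 t_eq)
  have elastic: "integ (\<lambda>x. mat_grad (\<lambda>y. midpt (\<lambda>m. Q m y) n) x \<bullet> mat_grad \<Phi> x) \<ge> 0"
  proof (rule integral_nonneg_regular)
    fix x assume x: "x \<in> regular"
    let ?M = "mat_grad (\<lambda>y. midpt (\<lambda>m. Q m y) n) x"
    have entry: "(\<lambda>y. \<Phi> y $ i $ j) = (if i = j then t else (\<lambda>y. 0))" for i j
      by (simp add: \<Phi>_def mat_def fun_eq_iff)
    have g\<Phi>: "mat_grad \<Phi> x $ i $ j = (if i = j then grad t x else 0)" for i j
      by (simp add: mat_grad_def entry grad_zero)
    have "?M \<bullet> mat_grad \<Phi> x = (\<Sum>i\<in>UNIV. ?M $ i $ i) \<bullet> grad t x"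
      by (simp add: inner_vec_def [of _ "mat_grad \<Phi> x"] inner_vec_def [of _ "mat_grad \<Phi> x $ i" for i]
          g\<Phi> inner_sum_left if_distrib cong: if_cong)
    also have "(\<Sum>i\<in>UNIV. ?M $ i $ i) = (1/2) *\<^sub>R (grad (\<lambda>y. trace (Q n y)) x + grad (\<lambda>y. trace (Q (Suc n) y)) x)"
      unfolding mat_grad_midpt [of Q n x, OF Q0 Q1 x] grad_trace [OF Q0 x] grad_trace [OF Q1 x]
      by (simp add: sum.distrib scaleR_sum_right scaleR_add_right)
    also have "grad (\<lambda>y. trace (Q n y)) x = 0"
      using grad_cong_regular [of "\<lambda>y. trace (Q n y)" "\<lambda>y. 0", OF tr0 x] by (simp add: grad_zero)
    also have "grad (\<lambda>y. trace (Q (Suc n) y)) x = grad t x"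
      using t_eq by (intro grad_cong_regular [OF _ x]) simp
    finally have "?M \<bullet> mat_grad \<Phi> x = 1 / 2 * (grad t x \<bullet> grad t x)" by simp
    then show "?M \<bullet> mat_grad \<Phi> x \<ge> 0" by (metis inner_ge_zero mult_nonneg_nonneg zero_le_divide_1_iff zero_le_numeral)
  qed
  have bulk_term: "integ (\<lambda>x. (dF1 b \<beta>1 \<beta>2 (Q (Suc n) x) - dF2 a c \<beta>1 \<beta>2 (Q n x)) \<bullet> \<Phi> x) \<ge> 0"
    unfolding \<Phi>_def
  proof (rule integral_nonneg_regular)
    fix x assume "x \<in> regular"
    then show "0 \<le> (dF1 b \<beta>1 \<beta>2 (Q (Suc n) x) - dF2 a c \<beta>1 \<beta>2 (Q n x)) \<bullet> (t x *\<^sub>R mat 1)"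
      unfolding t_eq [OF \<open>x \<in> regular\<close>] using beta by (intro bulk_trace_nonneg tr0) auto
  qed
  have tr1: "trace (mat 1 :: real^'n^'n) = real CARD('n)"
    by (simp add: trace_def mat_def)
  have trs: "trace (sym_part S) = trace S" for S :: "real^'n^'n"
    by (simp add: sym_part_def trace_scaleR trace_add trace_transpose_real)
  have coupling: "integ (\<lambda>x. let S = hadamard (P_tilde \<T> (Q (Suc n) x) (Q n x))
                    (outer (grad (u n) x) (grad (u (Suc n)) x))
          in (sym_part S - (1 / real CARD('n) * trace S) *\<^sub>R mat 1) \<bullet> \<Phi> x) = 0"
    unfolding Let_def
    by (intro integral_zero_regular) (simp add: \<Phi>_def inner_mat_1 trace_sub trace_scaleR tr1 trs)
  have flex: "integ (\<lambda>x. let p = grad (\<lambda>y. midpt (\<lambda>m. u m y) n) x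
          in p \<bullet> mat_div (\<lambda>y. sym_part (\<Phi> y)) x
             - 1 / real CARD('n) * (p \<bullet> grad (\<lambda>y. trace (\<Phi> y)) x)) = 0"
    unfolding Let_def
  \<comment> \<open>The divergence of \<open>t\<close> times the identity is the gradient of
    \<open>t\<close>, and the gradient of its trace is d times that; the factor 1/d makes the two
    terms cancel.\<close>
  proof (intro integral_zero_regular)
    fix x assume x: "x \<in> regular"
    have entry: "(\<lambda>y. sym_part (\<Phi> y) $ i $ j) = (if i = j then t else (\<lambda>y. 0))" for i j
      by (simp add: \<Phi>_def sym_part_def transpose_scalar mat_def transpose_def fun_eq_iff)
    have "mat_div (\<lambda>y. sym_part (\<Phi> y)) x $ i = grad t x $ i" for i
    proof -
      have "mat_div (\<lambda>y. sym_part (\<Phi> y)) x $ i = (\<Sum>j\<in>UNIV. if i = j then grad t x $ j else 0)"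
        unfolding mat_div_def entry by (simp add: grad_zero if_distrib [of "\<lambda>f. grad f x $ j" for j] cong: if_cong)
      then show ?thesis by simp
    qed
    then have "mat_div (\<lambda>y. sym_part (\<Phi> y)) x = grad t x"
      by (simp add: vec_eq_iff)
    moreover have "grad (\<lambda>y. trace (\<Phi> y)) x = real CARD('n) *\<^sub>R grad t x"
      using grad_mult [OF t x, of "real CARD('n)"]
      by (simp add: \<Phi>_def trace_scaleR tr1 mult.commute)
    ultimately show "grad (\<lambda>y. midpt (\<lambda>m. u m y) n) x \<bullet> mat_div (\<lambda>y. sym_part (\<Phi> y)) x
        - 1 / real CARD('n) * (grad (\<lambda>y. midpt (\<lambda>m. u m y) n) x \<bullet> grad (\<lambda>y. trace (\<Phi> y)) x) = 0"
      by simp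
  qed
  have "- ((1 / dt) * integ (\<lambda>x. t x \<bullet> t x)) \<ge> 0"
    using Q_eq [OF n \<Phi>] unfolding Q_equation_def time coupling flex
    using elastic bulk_term L by simp
  moreover have "integ (\<lambda>x. t x \<bullet> t x) \<ge> 0"
    by (rule integral_nonneg_regular) simp
  ultimately have "integ (\<lambda>x. t x \<bullet> t x) = 0"
    using dt by (simp add: field_simps)
  then have "t x = 0"
    by (intro piecewise_inner_zero [OF piecewise_pw_affine [OF t] _ x])
  then show ?thesis using t_eq [OF x] by simp
qed

lemma Q_sym_tracefree:
  assumes "n \<le> N" "x \<in> regular"
  shows "transpose (Q n x) = Q n x" "trace (Q n x) = 0"
proof -
  have "\<forall>x\<in>regular. transpose (Q n x) = Q n x \<and> trace (Q n x) = 0"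
    using assms(1)
  proof (induction n)
    case 0
    then show ?case
      using solution regular_subset by (auto simp: discrete_solution_def)
  next
    case (Suc n)
    then show ?case
      using Q_Suc_sym [of n] Q_Suc_tracefree [of n] by auto
  qed
  with assms(2) show "transpose (Q n x) = Q n x" "trace (Q n x) = 0" by blast+
qed

end

section \<open>Energy balance\<close>

lemma young_inner:
  fixes v w :: "'a::real_inner"
  assumes "\<eta> > 0"
  shows "\<bar>v \<bullet> w\<bar> \<le> \<eta> * (norm v)\<^sup>2 + (norm w)\<^sup>2 / \<eta>"
proof -
  have "2 * (norm v * norm w) = 2 * (sqrt \<eta> * norm v) * (norm w / sqrt \<eta>)"
    using assms by simp
  also have "\<dots> \<le> (sqrt \<eta> * norm v)\<^sup>2 + (norm w / sqrt \<eta>)\<^sup>2"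
    by (rule sum_squares_bound)
  also have "\<dots> = \<eta> * (norm v)\<^sup>2 + (norm w)\<^sup>2 / \<eta>"
    using assms by (simp add: power_mult_distrib power_divide)
  finally have "2 * (norm v * norm w) \<le> \<eta> * (norm v)\<^sup>2 + (norm w)\<^sup>2 / \<eta>" .
  moreover have "0 \<le> norm v * norm w" by simp
  ultimately show ?thesis
    using Cauchy_Schwarz_ineq2 [of v w] by linarith
qed

lemma sym_matrix_bilinear: "transpose A = A \<Longrightarrow> v \<bullet> (A *v w) = w \<bullet> (A *v v)" for A :: "real^'n^'n"
  by (metis dot_lmul_matrix inner_commute transpose_matrix_vector)

context mesh
begin

lemma piecewise_matrix_vector_mult:
  fixes A :: "real^'n \<Rightarrow> real^'n^'n" and v :: "real^'n \<Rightarrow> real^'n"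
  assumes "piecewise A" "piecewise v"
  shows "piecewise (\<lambda>x. A x *v v x)"
proof (rule piecewise_compose2 [OF assms])
  show "continuous_on UNIV (\<lambda>z. fst z *v (snd z) :: real^'n)"
    unfolding matrix_vector_mult_def
    by (intro continuous_on_vec_lambda continuous_on_sum continuous_on_mult continuous_on_component
        continuous_on_fst continuous_on_snd continuous_on_id)
qed

lemmas piecewise_intros =
  piecewise_add piecewise_diff piecewise_scaleR piecewise_inner piecewise_mult piecewise_const
  piecewise_matrix_vector_mult piecewise_norm_power2

lemma integ_lincomb:
  assumes "piecewise f" "piecewise g"
  shows "integ (\<lambda>x. r * f x + s * g x) = r * integ f + s * integ g"
  by (subst piecewise_integral_add(1)) (auto intro: piecewise_intros assms)

end

context scheme
begin

abbreviation "e n \<equiv> grad (u n)"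
abbreviation "G n \<equiv> grad (gh n)"
abbreviation "DQ n \<equiv> mat_grad (Q n)"

text \<open>The field which the equation for \<open>u\<close> makes orthogonal to the gradients of
  all test functions in \<open>Y_h\<close>.\<close>

definition flux :: "nat \<Rightarrow> real^'n \<Rightarrow> real^'n" where
  "flux n x = \<epsilon>1 *\<^sub>R e n x + \<epsilon>2 *\<^sub>R (\<T> (Q n x) *v e n x) + \<epsilon>3 *\<^sub>R mat_div (Q n) x"

definition dielectric :: "nat \<Rightarrow> real^'n \<Rightarrow> real" where
  "dielectric n x = (\<epsilon>1 *\<^sub>R e n x + \<epsilon>2 *\<^sub>R (\<T> (Q n x) *v e n x)) \<bullet> e n x"

lemma piecewise_Q: "n \<le> N \<Longrightarrow> piecewise (Q n)"
  and piecewise_DQ: "n \<le> N \<Longrightarrow> piecewise (DQ n)"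
  and piecewise_divQ: "n \<le> N \<Longrightarrow> piecewise (mat_div (Q n))"
  and piecewise_e: "n \<le> N \<Longrightarrow> piecewise (e n)"
  and piecewise_G: "n \<le> N \<Longrightarrow> piecewise (G n)"
  by (simp_all add: piecewise_pw_affine_mat piecewise_mat_grad piecewise_mat_div piecewise_grad Q_pw_affine_mat u_pw_affine gh_pw_affine)

lemma piecewise_T: "n \<le> N \<Longrightarrow> piecewise (\<lambda>x. \<T> (Q n x))"
  using piecewise_compose [OF piecewise_Q continuous_on_truncation [OF trunc]] .

lemma piecewise_F_B: "n \<le> N \<Longrightarrow> piecewise (\<lambda>x. F_B a b c A0 (Q n x))"
  using piecewise_compose [OF piecewise_Q continuous_on_F_B] .

lemma piecewise_flux: "n \<le> N \<Longrightarrow> piecewise (flux n)"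
  unfolding flux_def [abs_def]
  by (intro piecewise_intros piecewise_T piecewise_e piecewise_divQ)

lemma piecewise_dielectric: "n \<le> N \<Longrightarrow> piecewise (dielectric n)"
  unfolding dielectric_def [abs_def]
  by (intro piecewise_intros piecewise_T piecewise_e)

lemmas piecewise_scheme =
  piecewise_DQ piecewise_divQ piecewise_e piecewise_G piecewise_T piecewise_F_B piecewise_flux
  piecewise_dielectric

text \<open>\<open>coupling\<close> and \<open>flexo\<close> are the two electric contributions to
  the tested equation for \<open>Q\<close>, freed of constant factors and of the step size; the
  tested equation for \<open>u\<close> returns the same quantities.\<close>

definition coupling :: "nat \<Rightarrow> real" where
  "coupling n = integ (\<lambda>x. e n x \<bullet> ((\<T> (Q (Suc n) x) - \<T> (Q n x)) *v e (Suc n) x))"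

definition flexo :: "nat \<Rightarrow> real" where
  "flexo n = integ (\<lambda>x. (e n x + e (Suc n) x) \<bullet> (mat_div (Q (Suc n)) x - mat_div (Q n) x))"

text \<open>The time difference of \<open>Q\<close> is the test function. The midpoint gradient
  makes the elastic term an exact difference of squares, the convex splitting bounds the bulk term
  from below, and the squared time difference is dropped as nonnegative.\<close>

lemma director_energy:
  assumes n: "n < N"
  shows "integ (\<lambda>x. F_B a b c A0 (Q (Suc n) x)) - integ (\<lambda>x. F_B a b c A0 (Q n x))
     + L / 2 * (integ (\<lambda>x. (norm (DQ (Suc n) x))\<^sup>2) - integ (\<lambda>x. (norm (DQ n x))\<^sup>2))
     \<le> \<epsilon>2 / 2 * coupling n + \<epsilon>3 / 2 * flexo n"
proof -
  have nN: "n \<le> N" "Suc n \<le> N" using n by auto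
  note Q0 = Q_pw_affine_mat [OF nN(1)] and Q1 = Q_pw_affine_mat [OF nN(2)]
  define \<Phi> where "\<Phi> = (\<lambda>x. D_plus dt (\<lambda>m. Q m x) n)"
  have \<Phi>_eq: "\<Phi> x = (1 / dt) *\<^sub>R (Q (Suc n) x - Q n x)" for x
    by (simp add: \<Phi>_def D_plus_def)
  \<comment> \<open>The boundary datum \<open>qh\<close> does not depend on time and cancels, so the
    difference quotient lies in the test space.\<close>
  have "\<Phi> = (\<lambda>x. (1 / dt) *\<^sub>R (Q (Suc n) x - qh x) + (- 1 / dt) *\<^sub>R (Q n x - qh x))"
    by (simp add: \<Phi>_eq fun_eq_iff scaleR_diff_right)
  then have \<Phi>: "\<Phi> \<in> X_h \<Omega> Th"
    using X_h_lincomb [OF Q_diff_X_h [OF nN(2)] Q_diff_X_h [OF nN(1)], of "1 / dt" "- 1 / dt"] by simp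
  have \<Phi>_sym: "transpose (\<Phi> x) = \<Phi> x" "trace (\<Phi> x) = 0" if "x \<in> regular" for x
    using Q_sym_tracefree [OF nN(1) that] Q_sym_tracefree [OF nN(2) that]
    by (simp_all add: \<Phi>_eq transpose_scalar transpose_diff trace_scaleR trace_sub)
  have time: "integ (\<lambda>x. D_plus dt (\<lambda>m. Q m x) n \<bullet> \<Phi> x) \<ge> 0"
    by (rule integral_nonneg_regular) (simp add: \<Phi>_def)
  have \<Phi>_lin: "\<Phi> = (\<lambda>y. (1 / dt) *\<^sub>R Q (Suc n) y + (- 1 / dt) *\<^sub>R Q n y)"
    by (simp add: \<Phi>_eq fun_eq_iff scaleR_diff_right)
  have elastic: "integ (\<lambda>x. mat_grad (\<lambda>y. midpt (\<lambda>m. Q m y) n) x \<bullet> mat_grad \<Phi> x)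
      = (1 / (2 * dt)) * (integ (\<lambda>x. (norm (DQ (Suc n) x))\<^sup>2) - integ (\<lambda>x. (norm (DQ n x))\<^sup>2))"
  proof -
    have "integ (\<lambda>x. mat_grad (\<lambda>y. midpt (\<lambda>m. Q m y) n) x \<bullet> mat_grad \<Phi> x)
        = integ (\<lambda>x. (1 / (2 * dt)) * (norm (DQ (Suc n) x))\<^sup>2 + (- 1 / (2 * dt)) * (norm (DQ n x))\<^sup>2)"
    proof (rule integral_cong_regular)
      fix x assume x: "x \<in> regular"
      have "mat_grad \<Phi> x = (1 / dt) *\<^sub>R (DQ (Suc n) x - DQ n x)"
        unfolding \<Phi>_lin mat_grad_lincomb [OF Q1 Q0 x] by (simp add: scaleR_diff_right)
      then show "mat_grad (\<lambda>y. midpt (\<lambda>m. Q m y) n) x \<bullet> mat_grad \<Phi> x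
          = (1 / (2 * dt)) * (norm (DQ (Suc n) x))\<^sup>2 + (- 1 / (2 * dt)) * (norm (DQ n x))\<^sup>2"
        unfolding mat_grad_midpt [of Q n x, OF Q0 Q1 x] power2_norm_eq_inner
        by (simp add: inner_add_left inner_diff_right inner_commute [of "DQ (Suc n) x" "DQ n x"]
            diff_divide_distrib [symmetric] add_divide_distrib [symmetric])
    qed
    also have "\<dots> = (1 / (2 * dt)) * integ (\<lambda>x. (norm (DQ (Suc n) x))\<^sup>2)
        + (- 1 / (2 * dt)) * integ (\<lambda>x. (norm (DQ n x))\<^sup>2)"
      by (intro integ_lincomb piecewise_intros piecewise_DQ nN)
    finally show ?thesis by (simp add: diff_divide_distrib)
  qed
  have bulk_term: "integ (\<lambda>x. (dF1 b \<beta>1 \<beta>2 (Q (Suc n) x) - dF2 a c \<beta>1 \<beta>2 (Q n x)) \<bullet> \<Phi> x)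
      \<ge> (1 / dt) * (integ (\<lambda>x. F_B a b c A0 (Q (Suc n) x)) - integ (\<lambda>x. F_B a b c A0 (Q n x)))"
  proof -
    have "(1 / dt) * (integ (\<lambda>x. F_B a b c A0 (Q (Suc n) x)) - integ (\<lambda>x. F_B a b c A0 (Q n x)))
        = integ (\<lambda>x. (1 / dt) * (F_B a b c A0 (Q (Suc n) x) - F_B a b c A0 (Q n x)))"
      by (simp add: piecewise_integral_add piecewise_F_B nN)
    also have "\<dots> \<le> integ (\<lambda>x. (dF1 b \<beta>1 \<beta>2 (Q (Suc n) x) - dF2 a c \<beta>1 \<beta>2 (Q n x)) \<bullet> \<Phi> x)"
    proof (rule integral_mono_regular)
      show "piecewise (\<lambda>x. (1 / dt) * (F_B a b c A0 (Q (Suc n) x) - F_B a b c A0 (Q n x)))"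
        by (intro piecewise_intros piecewise_F_B nN)
      show "piecewise (\<lambda>x. (dF1 b \<beta>1 \<beta>2 (Q (Suc n) x) - dF2 a c \<beta>1 \<beta>2 (Q n x)) \<bullet> \<Phi> x)"
        by (intro piecewise_intros piecewise_pw_affine_mat [OF X_h_pw_affine_mat [OF \<Phi>]]
            piecewise_compose [OF piecewise_Q [OF nN(2)] continuous_on_dF1]
            piecewise_compose [OF piecewise_Q [OF nN(1)] continuous_on_dF2])
      fix x assume x: "x \<in> regular"
      have "(1 / dt) * (F_B a b c A0 (Q (Suc n) x) - F_B a b c A0 (Q n x))
          \<le> (1 / dt) * ((dF1 b \<beta>1 \<beta>2 (Q (Suc n) x) - dF2 a c \<beta>1 \<beta>2 (Q n x)) \<bullet> (Q (Suc n) x - Q n x))"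
        using dt by (intro mult_left_mono bulk_convex_splitting Q_sym_tracefree nN x beta) auto
      then show "(1 / dt) * (F_B a b c A0 (Q (Suc n) x) - F_B a b c A0 (Q n x))
          \<le> (dF1 b \<beta>1 \<beta>2 (Q (Suc n) x) - dF2 a c \<beta>1 \<beta>2 (Q n x)) \<bullet> \<Phi> x"
        unfolding \<Phi>_eq inner_scaleR_right .
    qed
    finally show ?thesis .
  qed
  have coupling: "integ (\<lambda>x. let S = hadamard (P_tilde \<T> (Q (Suc n) x) (Q n x))
                    (outer (grad (u n) x) (grad (u (Suc n)) x))
          in (sym_part S - (1 / real CARD('n) * trace S) *\<^sub>R mat 1) \<bullet> \<Phi> x) = (1 / dt) * coupling n"
    unfolding coupling_def set_integral_mult_right [symmetric] Let_def \<Phi>_eq inner_scaleR_right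
    using nN
    by (intro integral_cong_regular arg_cong [of _ _ "(*) (1 / dt)"] P_tilde_contraction [OF trunc]
        Q_sym_tracefree)
  have flex: "integ (\<lambda>x. let p = grad (\<lambda>y. midpt (\<lambda>m. u m y) n) x
          in p \<bullet> mat_div (\<lambda>y. sym_part (\<Phi> y)) x
             - 1 / real CARD('n) * (p \<bullet> grad (\<lambda>y. trace (\<Phi> y)) x)) = (1 / (2 * dt)) * flexo n"
    unfolding flexo_def set_integral_mult_right [symmetric] Let_def
  proof (rule integral_cong_regular)
    fix x assume x: "x \<in> regular"
    \<comment> \<open>\<Phi> is symmetric and trace-free throughout the open set
      \<open>regular\<close>, so its symmetric part may be replaced by \<Phi> under the divergence,
      and the gradient of its trace is zero.\<close>
    have "mat_div (\<lambda>y. sym_part (\<Phi> y)) x = mat_div \<Phi> x"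
      by (intro mat_grad_cong_regular(2) [OF _ x])
         (simp add: sym_part_def \<Phi>_sym scaleR_add_right [symmetric] scaleR_2 [symmetric])
    also have "\<dots> = (1 / dt) *\<^sub>R (mat_div (Q (Suc n)) x - mat_div (Q n) x)"
      unfolding \<Phi>_lin mat_div_lincomb [OF Q1 Q0 x] by (simp add: scaleR_diff_right)
    finally have 1: "mat_div (\<lambda>y. sym_part (\<Phi> y)) x = (1 / dt) *\<^sub>R (mat_div (Q (Suc n)) x - mat_div (Q n) x)" .
    have 2: "grad (\<lambda>y. trace (\<Phi> y)) x = 0"
      using grad_cong_regular [of "\<lambda>y. trace (\<Phi> y)" "\<lambda>y. 0", OF \<Phi>_sym(2) x] by (simp add: grad_zero)
    show "grad (\<lambda>y. midpt (\<lambda>m. u m y) n) x \<bullet> mat_div (\<lambda>y. sym_part (\<Phi> y)) x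
             - 1 / real CARD('n) * (grad (\<lambda>y. midpt (\<lambda>m. u m y) n) x \<bullet> grad (\<lambda>y. trace (\<Phi> y)) x)
        = (1 / (2 * dt)) * ((e n x + e (Suc n) x) \<bullet> (mat_div (Q (Suc n)) x - mat_div (Q n) x))"
      unfolding 1 2 grad_midpt [of u n x, OF u_pw_affine [OF nN(1)] u_pw_affine [OF nN(2)] x] by simp
  qed
  define F1 F0 K1 K0 where "F1 = integ (\<lambda>x. F_B a b c A0 (Q (Suc n) x))"
    and "F0 = integ (\<lambda>x. F_B a b c A0 (Q n x))"
    and "K1 = integ (\<lambda>x. (norm (DQ (Suc n) x))\<^sup>2)" and "K0 = integ (\<lambda>x. (norm (DQ n x))\<^sup>2)"
  have "L * ((1 / (2 * dt)) * (K1 - K0)) + (1 / dt) * (F1 - F0)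
      \<le> \<epsilon>2 / 2 * ((1 / dt) * coupling n) + \<epsilon>3 * ((1 / (2 * dt)) * flexo n)"
    using Q_eq [OF n \<Phi>] time bulk_term unfolding Q_equation_def elastic coupling flex
      F1_def F0_def K1_def K0_def by linarith
  then have "dt * (L * ((1 / (2 * dt)) * (K1 - K0)) + (1 / dt) * (F1 - F0))
      \<le> dt * (\<epsilon>2 / 2 * ((1 / dt) * coupling n) + \<epsilon>3 * ((1 / (2 * dt)) * flexo n))"
    using dt by (intro mult_left_mono) auto
  also have "dt * (\<epsilon>2 / 2 * ((1 / dt) * coupling n) + \<epsilon>3 * ((1 / (2 * dt)) * flexo n))
      = \<epsilon>2 / 2 * coupling n + \<epsilon>3 / 2 * flexo n"
    using dt by (simp add: field_simps)
  also have "dt * (L * ((1 / (2 * dt)) * (K1 - K0)) + (1 / dt) * (F1 - F0)) = F1 - F0 + L / 2 * (K1 - K0)"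
    using dt by (simp add: field_simps)
  finally show ?thesis unfolding F1_def F0_def K1_def K0_def .
qed

text \<open>The levels \<open>n\<close> and \<open>m\<close> are independent:
  \<open>u m - gh m\<close> is a test function for the equation at any level.\<close>

lemma flux_orthogonal:
  assumes "n \<le> N" "m \<le> N"
  shows "integ (\<lambda>x. flux n x \<bullet> e m x) = integ (\<lambda>x. flux n x \<bullet> G m x)"
proof -
  have "0 = integ (\<lambda>x. flux n x \<bullet> grad (\<lambda>y. u m y - gh m y) x)"
    using u_eq [OF assms(1) u_diff_Y_h [OF assms(2)]] by (simp add: u_equation_def flux_def)
  also have "\<dots> = integ (\<lambda>x. flux n x \<bullet> e m x - flux n x \<bullet> G m x)"
    by (rule integral_cong_regular)
       (simp add: grad_diff u_pw_affine gh_pw_affine assms inner_diff_right)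
  also have "\<dots> = integ (\<lambda>x. flux n x \<bullet> e m x) - integ (\<lambda>x. flux n x \<bullet> G m x)"
    by (intro piecewise_integral_add piecewise_intros piecewise_scheme assms)
  finally show ?thesis by simp
qed

text \<open>Expands the flux increment against the sum of the two gradients. Equal levels give the
  dielectric energies; in the mixed terms the \<epsilon>1 parts cancel, and symmetry of the
  truncated \<open>Q n\<close> merges the \<epsilon>2 parts into \<open>coupling\<close>. The
  \<epsilon>3 parts of all four pairings together form \<open>flexo\<close>.\<close>

lemma electric_energy:
  assumes n: "n < N"
  shows "\<epsilon>2 / 2 * coupling n + \<epsilon>3 / 2 * flexo n
     = 1 / 2 * (integ (\<lambda>x. flux (Suc n) x \<bullet> G n x) + integ (\<lambda>x. flux (Suc n) x \<bullet> G (Suc n) x)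
         - integ (\<lambda>x. flux n x \<bullet> G n x) - integ (\<lambda>x. flux n x \<bullet> G (Suc n) x))
       - 1 / 2 * (integ (dielectric (Suc n)) - integ (dielectric n))"
proof -
  have nN: "n \<le> N" "Suc n \<le> N" using n by auto
  note pw = piecewise_intros piecewise_scheme nN
  have "integ (\<lambda>x. flux (Suc n) x \<bullet> e n x) + integ (\<lambda>x. flux (Suc n) x \<bullet> e (Suc n) x)
         - integ (\<lambda>x. flux n x \<bullet> e n x) - integ (\<lambda>x. flux n x \<bullet> e (Suc n) x)
      = integ (\<lambda>x. flux (Suc n) x \<bullet> e n x + flux (Suc n) x \<bullet> e (Suc n) x
         - flux n x \<bullet> e n x - flux n x \<bullet> e (Suc n) x)"
    by (subst piecewise_integral_add, (intro pw)+)+ simp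
  also have "\<dots> = integ (\<lambda>x. dielectric (Suc n) x - dielectric n x
      + (\<epsilon>2 * (e n x \<bullet> ((\<T> (Q (Suc n) x) - \<T> (Q n x)) *v e (Suc n) x))
         + \<epsilon>3 * ((e n x + e (Suc n) x) \<bullet> (mat_div (Q (Suc n)) x - mat_div (Q n) x))))"
  proof (rule integral_cong_regular)
    fix x assume x: "x \<in> regular"
    have "e (Suc n) x \<bullet> (\<T> (Q n x) *v e n x) = e n x \<bullet> (\<T> (Q n x) *v e (Suc n) x)"
      by (intro sym_matrix_bilinear transpose_truncation [OF trunc] Q_sym_tracefree nN x)
    then show "flux (Suc n) x \<bullet> e n x + flux (Suc n) x \<bullet> e (Suc n) x
         - flux n x \<bullet> e n x - flux n x \<bullet> e (Suc n) x
       = dielectric (Suc n) x - dielectric n x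
        + (\<epsilon>2 * (e n x \<bullet> ((\<T> (Q (Suc n) x) - \<T> (Q n x)) *v e (Suc n) x))
           + \<epsilon>3 * ((e n x + e (Suc n) x) \<bullet> (mat_div (Q (Suc n)) x - mat_div (Q n) x)))"
      unfolding flux_def dielectric_def
      by (simp add: inner_add_left inner_add_right inner_diff_left inner_diff_right inner_commute
          matrix_vector_mult_diff_rdistrib algebra_simps)
  qed
  also have "\<dots> = integ (dielectric (Suc n)) - integ (dielectric n) + (\<epsilon>2 * coupling n + \<epsilon>3 * flexo n)"
    unfolding coupling_def flexo_def
    by (subst integ_lincomb [symmetric] piecewise_integral_add, (intro pw)+)+ simp
  finally show ?thesis
    by (simp add: flux_orthogonal nN field_simps)
qed

text \<open>Summation by parts moves the time difference from the flux to the boundary data.\<close>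

lemma energy_step:
  assumes n: "n < N"
  shows "integ (\<lambda>x. F_B a b c A0 (Q (Suc n) x)) + L / 2 * integ (\<lambda>x. (norm (DQ (Suc n) x))\<^sup>2)
       + integ (dielectric (Suc n)) / 2
     - (integ (\<lambda>x. F_B a b c A0 (Q n x)) + L / 2 * integ (\<lambda>x. (norm (DQ n x))\<^sup>2)
       + integ (dielectric n) / 2)
     \<le> integ (\<lambda>x. flux (Suc n) x \<bullet> G (Suc n) x) - integ (\<lambda>x. flux n x \<bullet> G n x)
       - dt * (1 / 2 * integ (\<lambda>x. flux n x \<bullet> D_plus dt (\<lambda>m. G m x) n)
         + 1 / 2 * integ (\<lambda>x. flux (Suc n) x \<bullet> D_plus dt (\<lambda>m. G m x) n))"
proof -
  have nN: "n \<le> N" "Suc n \<le> N" using n by auto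
  have D: "dt * integ (\<lambda>x. flux m x \<bullet> D_plus dt (\<lambda>m. G m x) n)
      = integ (\<lambda>x. flux m x \<bullet> G (Suc n) x) - integ (\<lambda>x. flux m x \<bullet> G n x)" if "m \<le> N" for m
  proof -
    have "dt * integ (\<lambda>x. flux m x \<bullet> D_plus dt (\<lambda>m. G m x) n)
        = integ (\<lambda>x. flux m x \<bullet> G (Suc n) x - flux m x \<bullet> G n x)"
      unfolding set_integral_mult_right [symmetric]
      using dt by (simp add: D_plus_def inner_diff_right)
    also have "\<dots> = integ (\<lambda>x. flux m x \<bullet> G (Suc n) x) - integ (\<lambda>x. flux m x \<bullet> G n x)"
      by (intro piecewise_integral_add piecewise_intros piecewise_scheme nN that)
    finally show ?thesis .
  qed
  show ?thesis
    \<comment> \<open>With fluxes f0, f1 and data gradients G0, G1, half of (f1 - f0) . (G0 + G1)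
      equals f1 . G1 - f0 . G0 minus half of (f0 + f1) . (G1 - G0).\<close>
    using director_energy [OF n] D [OF nN(1)] D [OF nN(2)]
    unfolding electric_energy [OF n] by (simp add: algebra_simps)
qed

lemma truncated_form_bound: "\<bar>\<epsilon>2 * ((\<T> A *v v) \<bullet> v)\<bar> \<le> \<bar>\<epsilon>2\<bar> * R * (norm v)\<^sup>2"
proof -
  have "\<bar>(\<T> A *v v) \<bullet> v\<bar> \<le> norm (\<T> A *v v) * norm v"
    by (rule Cauchy_Schwarz_ineq2)
  also have "\<dots> \<le> (norm (\<T> A) * norm v) * norm v"
    by (intro mult_right_mono norm_matrix_vector_mult_le) simp
  also have "\<dots> \<le> (R * norm v) * norm v"
    by (intro mult_right_mono norm_truncation_le [OF trunc R]) simp_all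
  finally have "\<bar>\<epsilon>2\<bar> * \<bar>(\<T> A *v v) \<bullet> v\<bar> \<le> \<bar>\<epsilon>2\<bar> * ((R * norm v) * norm v)"
    by (rule mult_left_mono) simp
  then show ?thesis by (simp add: abs_mult power2_eq_square mult_ac)
qed

text \<open>The truncation changes the quadratic form by at most |\<epsilon>2| R; the lower bound is
  coercive exactly under the assumption on \<epsilon>1.\<close>

lemma dielectric_bounds:
  "(\<epsilon>1 - \<bar>\<epsilon>2\<bar> * R) * (norm (e n x))\<^sup>2 \<le> dielectric n x"
  "dielectric n x \<le> (\<epsilon>1 + \<bar>\<epsilon>2\<bar> * R) * (norm (e n x))\<^sup>2"
  using truncated_form_bound [of "Q n x" "e n x"]
  by (auto simp: dielectric_def inner_add_left power2_norm_eq_inner [symmetric] algebra_simps abs_le_iff)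

text \<open>The first summand bounds the coefficient of the squared gradient of u, the second that
  of Q; their sum serves for both.\<close>

definition flux_const :: real where
  "flux_const = 2 * (\<bar>\<epsilon>1\<bar> + \<bar>\<epsilon>2\<bar> * R)\<^sup>2 + 2 * \<epsilon>3\<^sup>2 * real CARD('n)"

lemma norm_flux_le: "(norm (flux n x))\<^sup>2 \<le> flux_const * ((norm (DQ n x))\<^sup>2 + (norm (e n x))\<^sup>2)"
proof -
  let ?\<Lambda> = "\<bar>\<epsilon>1\<bar> + \<bar>\<epsilon>2\<bar> * R"
  have "norm (\<T> (Q n x) *v e n x) \<le> R * norm (e n x)"
    by (rule order_trans [OF norm_matrix_vector_mult_le])
       (intro mult_right_mono norm_truncation_le [OF trunc R], simp)
  then have "\<bar>\<epsilon>2\<bar> * norm (\<T> (Q n x) *v e n x) \<le> \<bar>\<epsilon>2\<bar> * (R * norm (e n x))"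
    by (rule mult_left_mono) simp
  then have "norm (flux n x) \<le> ?\<Lambda> * norm (e n x) + \<bar>\<epsilon>3\<bar> * norm (mat_div (Q n) x)"
    using norm_triangle_ineq [of "\<epsilon>1 *\<^sub>R e n x + \<epsilon>2 *\<^sub>R (\<T> (Q n x) *v e n x)" "\<epsilon>3 *\<^sub>R mat_div (Q n) x"]
      norm_triangle_ineq [of "\<epsilon>1 *\<^sub>R e n x" "\<epsilon>2 *\<^sub>R (\<T> (Q n x) *v e n x)"]
    by (simp add: flux_def algebra_simps)
  then have "(norm (flux n x))\<^sup>2 \<le> (?\<Lambda> * norm (e n x) + \<bar>\<epsilon>3\<bar> * norm (mat_div (Q n) x))\<^sup>2"
    by (intro power_mono) auto
  also have "\<dots> \<le> 2 * (?\<Lambda> * norm (e n x))\<^sup>2 + 2 * (\<bar>\<epsilon>3\<bar> * norm (mat_div (Q n) x))\<^sup>2"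
    using sum_squares_bound [of "?\<Lambda> * norm (e n x)" "\<bar>\<epsilon>3\<bar> * norm (mat_div (Q n) x)"]
    unfolding power2_sum by linarith
  also have "\<dots> = 2 * ?\<Lambda>\<^sup>2 * (norm (e n x))\<^sup>2 + 2 * \<epsilon>3\<^sup>2 * (norm (mat_div (Q n) x))\<^sup>2"
    by (simp add: power_mult_distrib)
  also have "\<dots> \<le> 2 * ?\<Lambda>\<^sup>2 * (norm (e n x))\<^sup>2 + 2 * \<epsilon>3\<^sup>2 * (real CARD('n) * (norm (DQ n x))\<^sup>2)"
    by (intro add_left_mono mult_left_mono norm_mat_div_le) simp
  also have "\<dots> \<le> flux_const * (norm (e n x))\<^sup>2 + flux_const * (norm (DQ n x))\<^sup>2"
    unfolding mult.assoc [symmetric] by (intro add_mono mult_right_mono) (auto simp: flux_const_def)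
  finally show ?thesis by (simp add: algebra_simps)
qed

text \<open>Young's inequality with parameter \<eta> divided by \<open>flux_const\<close>, so that
  the bound on the squared flux turns the coefficient of the energy into \<eta> itself.\<close>

lemma flux_pairing_bound:
  fixes H :: "real^'n \<Rightarrow> real^'n"
  assumes n: "n \<le> N" and H: "piecewise H" and "\<eta> > 0" "flux_const > 0"
  shows "\<bar>integ (\<lambda>x. flux n x \<bullet> H x)\<bar>
    \<le> \<eta> * (integ (\<lambda>x. (norm (DQ n x))\<^sup>2) + integ (\<lambda>x. (norm (e n x))\<^sup>2))
      + flux_const / \<eta> * integ (\<lambda>x. (norm (H x))\<^sup>2)"
proof -
  let ?b = "\<lambda>x. \<eta> * ((norm (DQ n x))\<^sup>2 + (norm (e n x))\<^sup>2) + flux_const / \<eta> * (norm (H x))\<^sup>2"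
  have bound: "\<bar>flux n x \<bullet> H x\<bar> \<le> ?b x" for x
  proof -
    have "\<bar>flux n x \<bullet> H x\<bar> \<le> \<eta> / flux_const * (norm (flux n x))\<^sup>2 + (norm (H x))\<^sup>2 / (\<eta> / flux_const)"
      using assms by (intro young_inner) simp
    also have "\<eta> / flux_const * (norm (flux n x))\<^sup>2
        \<le> \<eta> / flux_const * (flux_const * ((norm (DQ n x))\<^sup>2 + (norm (e n x))\<^sup>2))"
      using assms by (intro mult_left_mono norm_flux_le) simp
    finally show ?thesis using assms by (simp add: mult.commute)
  qed
  have pwb: "piecewise ?b"
    by (intro piecewise_intros piecewise_scheme n H)
  have pwf: "piecewise (\<lambda>x. flux n x \<bullet> H x)"
    by (intro piecewise_intros piecewise_scheme n H)
  have "integ (\<lambda>x. flux n x \<bullet> H x) \<le> integ ?b"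
    using bound by (intro integral_mono_regular pwb pwf) (simp add: abs_le_iff)
  moreover have "integ (\<lambda>x. (- 1) * (flux n x \<bullet> H x)) \<le> integ ?b"
    using bound by (intro integral_mono_regular pwb piecewise_mult [OF piecewise_const pwf])
      (simp add: abs_le_iff)
  then have "- integ (\<lambda>x. flux n x \<bullet> H x) \<le> integ ?b"
    unfolding set_integral_mult_right by simp
  ultimately have "\<bar>integ (\<lambda>x. flux n x \<bullet> H x)\<bar> \<le> integ ?b" by linarith
  also have "integ ?b = \<eta> * integ (\<lambda>x. (norm (DQ n x))\<^sup>2 + (norm (e n x))\<^sup>2)
      + flux_const / \<eta> * integ (\<lambda>x. (norm (H x))\<^sup>2)"
    by (intro integ_lincomb piecewise_intros piecewise_scheme n H)
  also have "integ (\<lambda>x. (norm (DQ n x))\<^sup>2 + (norm (e n x))\<^sup>2)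
      = integ (\<lambda>x. (norm (DQ n x))\<^sup>2) + integ (\<lambda>x. (norm (e n x))\<^sup>2)"
    by (intro piecewise_integral_add piecewise_intros piecewise_scheme n)
  finally show ?thesis .
qed

lemma bulk_energy_nonneg: "n \<le> N \<Longrightarrow> integ (\<lambda>x. F_B a b c A0 (Q n x)) \<ge> 0"
  by (intro integral_nonneg_regular bulk Q_sym_tracefree)

lemma dielectric_energy_bounds:
  assumes "n \<le> N"
  shows "(\<epsilon>1 - \<bar>\<epsilon>2\<bar> * R) * integ (\<lambda>x. (norm (e n x))\<^sup>2) \<le> integ (dielectric n)"
    "integ (dielectric n) \<le> (\<epsilon>1 + \<bar>\<epsilon>2\<bar> * R) * integ (\<lambda>x. (norm (e n x))\<^sup>2)"
  unfolding set_integral_mult_right [symmetric]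
  by (intro integral_mono_regular dielectric_bounds piecewise_intros piecewise_scheme assms)+

end

theorem theorem2p3:
  fixes \<Omega> :: "(real^'n) set"
    and \<T> :: "real^'n^'n \<Rightarrow> real^'n^'n"
    and L \<epsilon>1 \<epsilon>2 \<epsilon>3 a b c A0 R CT \<beta>1 \<beta>2 \<gamma> :: real
  assumes dim: "CARD('n) = 2 \<or> CARD('n) = 3"
    and dom: "polyhedral_domain \<Omega>"
    and pos: "L > 0" "\<epsilon>1 > 0" "c > 0" "R > 0" "CT > 0"
    and beta: "\<beta>1 \<ge> max \<bar>b\<bar> a" "\<beta>2 \<ge> max \<bar>b\<bar> c"
    and trunc: "truncation R CT \<T>"
    and bulk: "\<And>A :: real^'n^'n. transpose A = A \<Longrightarrow> F_B a b c A0 A \<ge> 0"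
    and quasi: "\<gamma> > 0"
    and ellipticity: "\<epsilon>1 > \<bar>\<epsilon>2\<bar> * R"
  shows "\<exists>C>0. \<forall>(T::real) (g :: real \<Rightarrow> real^'n \<Rightarrow> real) (q :: real^'n \<Rightarrow> real^'n^'n)
      (Th :: (real^'n) set set) (dt::real) (N::nat)
      (qh :: real^'n \<Rightarrow> real^'n^'n) (gh :: nat \<Rightarrow> real^'n \<Rightarrow> real)
      (Q :: nat \<Rightarrow> real^'n \<Rightarrow> real^'n^'n) (u :: nat \<Rightarrow> real^'n \<Rightarrow> real).
    T > 0 \<longrightarrow>
    g \<in> Linf_H1 T \<Omega> \<inter> W12_H1 T \<Omega> \<and> H1_continuous T \<Omega> g \<longrightarrow>
    (\<forall>i j. (\<lambda>x. q x $ i $ j) \<in> H1 \<Omega>) \<longrightarrow>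
    (AE x\<in>\<Omega> in lebesgue. transpose (q x) = q x \<and> trace (q x) = 0) \<longrightarrow>
    mesh_of \<Omega> Th \<and> quasi_uniform \<gamma> Th \<longrightarrow>
    dt > 0 \<and> T = real N * dt \<longrightarrow>
    (\<epsilon>3 \<noteq> 0 \<longrightarrow> dt < L / (2 * real CARD('n) * \<bar>\<epsilon>3\<bar>)) \<longrightarrow>
    dt < (\<epsilon>1 - \<bar>\<epsilon>2\<bar> * R) / (3 * (\<epsilon>1 + \<bar>\<epsilon>2\<bar> * R\<^sup>2)) \<longrightarrow>
    L2_projection \<Omega> (P1_mat \<Omega> Th) q qh \<longrightarrow>
    (\<forall>n\<le>N. L2_projection \<Omega> (P1 \<Omega> Th) (g (real n * dt)) (gh n)) \<longrightarrow>
    discrete_solution \<Omega> Th L \<epsilon>1 \<epsilon>2 \<epsilon>3 a b c \<beta>1 \<beta>2 \<T> dt N qh gh Q u \<longrightarrow>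
    (LINT x:\<Omega>|lebesgue. F_B a b c A0 (Q N x))
      + 1 / 4 * (L - 2 * real CARD('n) * dt * \<bar>\<epsilon>3\<bar>) * (L2_norm \<Omega> (mat_grad (Q N)))\<^sup>2
      + 1 / 6 * (\<epsilon>1 - \<bar>\<epsilon>2\<bar> * R) * (L2_norm \<Omega> (grad (u N)))\<^sup>2
    \<le> C * (1 + real N * dt * exp (C * (real N * dt))) *
        ((L2_norm \<Omega> (mat_grad (Q 0)))\<^sup>2 + (LINT x:\<Omega>|lebesgue. F_B a b c A0 (Q 0 x))
          + (1 + R) * (L2_norm \<Omega> (grad (u 0)))\<^sup>2 + (L2_norm \<Omega> (grad (gh 0)))\<^sup>2)
      + C * (1 + real N * dt * exp (C * (real N * dt))) * dt *
          (\<Sum>n<N. (L2_norm \<Omega> (\<lambda>x. D_plus dt (\<lambda>m. grad (gh m) x) n))\<^sup>2)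
      + C * (L2_norm \<Omega> (grad (gh N)))\<^sup>2
      + C * exp (C * (real N * dt)) * dt * (\<Sum>n<N. (L2_norm \<Omega> (grad (gh n)))\<^sup>2)"
proof -
  \<comment> \<open>These numbers depend only on the model parameters and the dimension, and with
    \<open>L\<close> they determine \<open>C\<close>. \<open>B\<close> spells out the value of
    \<open>flux_const\<close>, which belongs to one discretization and becomes available only after
    \<open>C\<close> is fixed.\<close>
  define lam Lam B dmax where "lam = \<epsilon>1 - \<bar>\<epsilon>2\<bar> * R" and "Lam = \<epsilon>1 + \<bar>\<epsilon>2\<bar> * R"
    and "B = 2 * (\<bar>\<epsilon>1\<bar> + \<bar>\<epsilon>2\<bar> * R)\<^sup>2 + 2 * \<epsilon>3\<^sup>2 * real CARD('n)"
    and "dmax = (\<epsilon>1 - \<bar>\<epsilon>2\<bar> * R) / (3 * (\<epsilon>1 + \<bar>\<epsilon>2\<bar> * R\<^sup>2))"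
  have "lam > 0" using ellipticity by (simp add: lam_def)
  moreover have "Lam > 0" using pos by (simp add: Lam_def add_pos_nonneg)
  moreover from \<open>Lam > 0\<close> pos have "B > 0"
    by (simp add: B_def Lam_def [symmetric] add_pos_nonneg)
  moreover have "dmax > 0" using ellipticity pos by (simp add: dmax_def add_pos_nonneg)
  ultimately obtain C where C: "C > 0" and bound: "\<And>dt N F k p E j r (\<gamma> :: nat \<Rightarrow> real) s.
    0 < dt \<Longrightarrow> dt \<le> dmax \<Longrightarrow>
    (\<And>n. n \<le> N \<Longrightarrow> F n \<ge> 0 \<and> k n \<ge> 0 \<and> p n \<ge> 0 \<and> \<gamma> n \<ge> 0 \<and> s n \<ge> 0 \<and>
       lam * p n \<le> E n \<and> E n \<le> Lam * p n) \<Longrightarrow>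
    (\<And>n \<eta>. n \<le> N \<Longrightarrow> \<eta> > 0 \<Longrightarrow> \<bar>j n\<bar> \<le> \<eta> * (k n + p n) + B / \<eta> * \<gamma> n) \<Longrightarrow>
    (\<And>n \<eta>. n < N \<Longrightarrow> \<eta> > 0 \<Longrightarrow>
       \<bar>r n\<bar> \<le> \<eta> * (k n + p n + (k (Suc n) + p (Suc n))) + B / \<eta> * s n) \<Longrightarrow>
    (\<And>n. n < N \<Longrightarrow> F (Suc n) + L / 2 * k (Suc n) + E (Suc n) / 2 - (F n + L / 2 * k n + E n / 2)
       \<le> j (Suc n) - j n - dt * r n) \<Longrightarrow>
    F N + L / 4 * k N + lam / 4 * p N
      \<le> C * (1 + real N * dt * exp (C * (real N * dt))) * (k 0 + F 0 + p 0 + \<gamma> 0)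
        + C * (1 + real N * dt * exp (C * (real N * dt))) * dt * (\<Sum>n<N. s n)
        + C * \<gamma> N + C * exp (C * (real N * dt)) * dt * (\<Sum>n<N. \<gamma> n)"
    using discrete_energy_bound [OF pos(1), of lam Lam B dmax] by metis
  show ?thesis
  proof (intro exI [of _ C] conjI allI impI)
    show "C > 0" by (rule C)
    fix T :: real and g :: "real \<Rightarrow> real^'n \<Rightarrow> real" and q :: "real^'n \<Rightarrow> real^'n^'n"
      and Th :: "(real^'n) set set" and dt :: real and N :: nat
      and qh :: "real^'n \<Rightarrow> real^'n^'n" and gh :: "nat \<Rightarrow> real^'n \<Rightarrow> real"
      and Q :: "nat \<Rightarrow> real^'n \<Rightarrow> real^'n^'n" and u :: "nat \<Rightarrow> real^'n \<Rightarrow> real"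
    assume q: "AE x\<in>\<Omega> in lebesgue. transpose (q x) = q x \<and> trace (q x) = 0"
      and Th: "mesh_of \<Omega> Th \<and> quasi_uniform \<gamma> Th"
      and dt: "dt > 0 \<and> T = real N * dt"
      and dt_le: "dt < (\<epsilon>1 - \<bar>\<epsilon>2\<bar> * R) / (3 * (\<epsilon>1 + \<bar>\<epsilon>2\<bar> * R\<^sup>2))"
      and qh: "L2_projection \<Omega> (P1_mat \<Omega> Th) q qh"
      and gh: "\<forall>n\<le>N. L2_projection \<Omega> (P1 \<Omega> Th) (g (real n * dt)) (gh n)"
      and sol: "discrete_solution \<Omega> Th L \<epsilon>1 \<epsilon>2 \<epsilon>3 a b c \<beta>1 \<beta>2 \<T> dt N qh gh Q u"
    interpret mesh \<Omega> Th
      using dom Th by unfold_locales (auto simp: polyhedral_domain_def)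
    interpret scheme \<Omega> Th L \<epsilon>1 \<epsilon>2 \<epsilon>3 a b c A0 R CT \<beta>1 \<beta>2 dt \<T> N q qh gh Q u
    proof unfold_locales
      show "gh n \<in> pw_affine" if "n \<le> N" for n
        using gh that by (auto simp: L2_projection_def intro: P1_pw_affine)
    qed (fact pos beta trunc q qh sol | use dt bulk in blast)+
    have B: "flux_const = B" by (simp add: flux_const_def B_def)
    define Dg where "Dg n = (\<lambda>x. D_plus dt (\<lambda>m. grad (gh m) x) n)" for n
    have Dg: "piecewise (Dg n)" if "n < N" for n
      unfolding Dg_def D_plus_def using that by (intro piecewise_intros piecewise_scheme) auto
    define F k p E where "F n = integ (\<lambda>x. F_B a b c A0 (Q n x))"
      and "k n = integ (\<lambda>x. (norm (mat_grad (Q n) x))\<^sup>2)"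
      and "p n = integ (\<lambda>x. (norm (grad (u n) x))\<^sup>2)"
      and "E n = integ (dielectric n)" for n
    define \<gamma>' s where "\<gamma>' n = integ (\<lambda>x. (norm (grad (gh n) x))\<^sup>2)"
      and "s n = integ (\<lambda>x. (norm (Dg n x))\<^sup>2)" for n
    define j r where "j n = integ (\<lambda>x. flux n x \<bullet> grad (gh n) x)"
      and "r n = 1 / 2 * integ (\<lambda>x. flux n x \<bullet> Dg n x) + 1 / 2 * integ (\<lambda>x. flux (Suc n) x \<bullet> Dg n x)" for n
    have nonneg: "k n \<ge> 0" "p n \<ge> 0" "\<gamma>' n \<ge> 0" "s n \<ge> 0" for n
      by (simp_all add: k_def p_def \<gamma>'_def s_def integral_nonneg_regular)
    have F_nonneg: "F n \<ge> 0" if "n \<le> N" for n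
      using bulk_energy_nonneg [OF that] by (simp add: F_def)
    have main: "F N + L / 4 * k N + lam / 4 * p N
      \<le> C * (1 + real N * dt * exp (C * (real N * dt))) * (k 0 + F 0 + p 0 + \<gamma>' 0)
        + C * (1 + real N * dt * exp (C * (real N * dt))) * dt * (\<Sum>n<N. s n)
        + C * \<gamma>' N + C * exp (C * (real N * dt)) * dt * (\<Sum>n<N. \<gamma>' n)"
    proof (rule bound [of dt N F k p \<gamma>' s E j r])
      show "0 < dt" "dt \<le> dmax" using dt dt_le by (auto simp: dmax_def)
      show "0 \<le> F n \<and> 0 \<le> k n \<and> 0 \<le> p n \<and> 0 \<le> \<gamma>' n \<and> 0 \<le> s n \<and> lam * p n \<le> E n \<and> E n \<le> Lam * p n"
        if "n \<le> N" for n
        using dielectric_energy_bounds [OF that] F_nonneg [OF that] nonneg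
        by (simp add: lam_def Lam_def p_def E_def)
      show "\<bar>j n\<bar> \<le> \<eta> * (k n + p n) + B / \<eta> * \<gamma>' n" if "n \<le> N" "\<eta> > 0" for n \<eta>
        unfolding j_def k_def p_def \<gamma>'_def B [symmetric]
        using that \<open>B > 0\<close> B by (intro flux_pairing_bound piecewise_scheme) auto
      show "\<bar>r n\<bar> \<le> \<eta> * (k n + p n + (k (Suc n) + p (Suc n))) + B / \<eta> * s n"
        if "n < N" "\<eta> > 0" for n \<eta>
      proof -
        have "\<bar>integ (\<lambda>x. flux m x \<bullet> Dg n x)\<bar> \<le> \<eta> * (k m + p m) + B / \<eta> * s n" if "m \<le> N" for m
          unfolding k_def p_def s_def B [symmetric]
          using that \<open>n < N\<close> \<open>\<eta> > 0\<close> \<open>B > 0\<close> B by (intro flux_pairing_bound Dg) auto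
        note pair = this
        \<comment> \<open>The two pairings in \<open>r n\<close> share the term with
          \<open>s n\<close>: averaging keeps one copy of it, and the halves of the energy terms are
          enlarged to whole ones.\<close>
        have avg: "\<bar>1 / 2 * x + 1 / 2 * y\<bar> \<le> x' + y' + z"
          if "\<bar>x\<bar> \<le> x' + z" "\<bar>y\<bar> \<le> y' + z" "0 \<le> x'" "0 \<le> y'" for x y x' y' z :: real
          using that by (simp add: abs_le_iff)
        show ?thesis
          unfolding r_def distrib_left [of \<eta> "k n + p n"]
          using that nonneg by (intro avg pair mult_nonneg_nonneg add_nonneg_nonneg) auto
      qed
      show "F (Suc n) + L / 2 * k (Suc n) + E (Suc n) / 2 - (F n + L / 2 * k n + E n / 2)
          \<le> j (Suc n) - j n - dt * r n" if "n < N" for n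
        using energy_step [OF that] by (simp add: F_def k_def E_def j_def r_def Dg_def)
    qed
    \<comment> \<open>The abstract bound has L/4, \<open>lam / 4\<close> and weight 1 on
      \<open>p 0\<close>; the three comparisons that follow pass to the coefficients of the
      claim.\<close>
    have "1 / 4 * (L - 2 * real CARD('n) * dt * \<bar>\<epsilon>3\<bar>) * k N \<le> L / 4 * k N"
      using dt nonneg(1) [of N] by (intro mult_right_mono) auto
    moreover have "1 / 6 * (\<epsilon>1 - \<bar>\<epsilon>2\<bar> * R) * p N \<le> lam / 4 * p N"
      using nonneg(2) [of N] \<open>lam > 0\<close> unfolding lam_def [symmetric] by (intro mult_right_mono) auto
    moreover have "C * (1 + real N * dt * exp (C * (real N * dt))) * (k 0 + F 0 + p 0 + \<gamma>' 0)
        \<le> C * (1 + real N * dt * exp (C * (real N * dt))) * (k 0 + F 0 + (1 + R) * p 0 + \<gamma>' 0)"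
    proof (rule mult_left_mono)
      have "p 0 \<le> (1 + R) * p 0"
        using nonneg(2) [of 0] pos(4) by (simp add: distrib_right)
      then show "k 0 + F 0 + p 0 + \<gamma>' 0 \<le> k 0 + F 0 + (1 + R) * p 0 + \<gamma>' 0" by simp
      show "0 \<le> C * (1 + real N * dt * exp (C * (real N * dt)))"
        using C dt by (intro mult_nonneg_nonneg add_nonneg_nonneg) auto
    qed
    ultimately show "(LINT x:\<Omega>|lebesgue. F_B a b c A0 (Q N x))
      + 1 / 4 * (L - 2 * real CARD('n) * dt * \<bar>\<epsilon>3\<bar>) * (L2_norm \<Omega> (mat_grad (Q N)))\<^sup>2
      + 1 / 6 * (\<epsilon>1 - \<bar>\<epsilon>2\<bar> * R) * (L2_norm \<Omega> (grad (u N)))\<^sup>2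
    \<le> C * (1 + real N * dt * exp (C * (real N * dt))) *
        ((L2_norm \<Omega> (mat_grad (Q 0)))\<^sup>2 + (LINT x:\<Omega>|lebesgue. F_B a b c A0 (Q 0 x))
          + (1 + R) * (L2_norm \<Omega> (grad (u 0)))\<^sup>2 + (L2_norm \<Omega> (grad (gh 0)))\<^sup>2)
      + C * (1 + real N * dt * exp (C * (real N * dt))) * dt *
          (\<Sum>n<N. (L2_norm \<Omega> (\<lambda>x. D_plus dt (\<lambda>m. grad (gh m) x) n))\<^sup>2)
      + C * (L2_norm \<Omega> (grad (gh N)))\<^sup>2
      + C * exp (C * (real N * dt)) * dt * (\<Sum>n<N. (L2_norm \<Omega> (grad (gh n)))\<^sup>2)"
      using main unfolding L2_norm_power2 F_def k_def p_def \<gamma>'_def s_def Dg_def by linarith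
  qed
qed

end
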